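(* Let $M$ be a smooth manifold, let $\mu$ be an $r$-form on $M$ and let $0\le i\le r$. Then $$\widetilde{d_T\mu}^{\,i}=(\kappa_M^{r-i})'\circ T\widetilde{\mu}^{\,i}\circ \kappa_M^i$$ as maps $\bigwedge^i TTM\to \bigwedge^{r-i}T^*TM$, where $T\widetilde\mu^{\,i}: T\bigwedge^i TM\to T\bigwedge^{r-i}T^*M$ is the tangent map of $\widetilde\mu^{\,i}$.
   Context: Everything is smooth. $\tau_M:TM\to M$ and $\pi_M:T^*M\to M$ are the projections. Local coordinates $(x^i)$ on $M$ induce $(x^i,\dot x^j)$ on $TM$, $(x^i,\dot x^j,\delta x^k,\delta\dot x^l)$ on $TTM$. By convention $\bigwedge^0TM=\bigwedge^0T^*M=M\times\mathbb R$. Contractions: for an $r$-form $\mu$ on a manifold $N$ and $0\le i\le r$, $\widetilde\mu^{\,i}:\bigwedge^iTN\to\bigwedge^{r-i}T^*N$ is the vector bundle morphism with $\langle\widetilde\mu^{\,i}(u),v\rangle=\mu(u\wedge v)$ (so $\widetilde\mu^{\,0}(x,t)=t\mu(x)$, and $\widetilde\mu^{\,r}$ takes values in $N\times\mathbb R$). Tangent lift of forms: put $v_T\mu=\tau_M^*\mu$. A second order vector field $\Gamma$ on $M$ is a vector field on $TM$ with $T\tau_M\circ\Gamma=\mathrm{id}_{TM}$. For $r>0$, $i_T\mu=i_\Gamma(v_T\mu)$ (an $(r-1)$-form on $TM$, independent of $\Gamma$); for $r=0$, $i_T\mu=0$. Then $d_T\mu=d\,i_T\mu+i_T\,d\mu=\mathcal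 L_\Gamma(v_T\mu)$, an $r$-form on $TM$. For a function $f$, $d_Tf(v)=\langle df,v\rangle$. The flip: $\kappa_M:TTM\to TTM$ is the canonical involution, $(x,\dot x,\delta x,\delta\dot x)\mapsto(x,\delta x,\dot x,\delta\dot x)$; it is an isomorphism from the vector bundle $\tau_{TM}$ to the vector bundle $T\tau_M$ over $TM$. For $r\ge1$ let $\bigwedge^r_M:TM\times_M\cdots\times_MTM\to\bigwedge^rTM$ be the wedge product map. Then $\kappa_M^r:\bigwedge^rTTM\to T\bigwedge^rTM$ is the vector bundle morphism over $TM$ determined by $\kappa_M^r(v_1\wedge\dots\wedge v_r)=T\bigwedge^r_M(\kappa_M(v_1),\dots,\kappa_M(v_r))$ for $v_1,\dots,v_r$ in a common fibre of $\tau_{TM}$. For $r=0$, $\kappa_M^0:TM\times\mathbb R\to T(M\times\mathbb R)$ maps $(x,\dot x,t)$ to the tangent vector with base point $(x,t)$ and components $(\dot x,\dot t)=(\dot x,0)$. The tangent pairing $\langle\cdot,\cdot\rangle'^{\,r}_{TM}:T\bigwedge^rTM\times_{TM}T\bigwedge^rT^*M\to\mathbb R$ is the tangent map of the canonical pairing $\bigwedge^rTM\times_M\bigwedge^rT^*M\to\mathbb R$ followed by the projection of $T\mathbb R=\mathbb R\times\mathbb R$ onto the fibre (derivative) component. The morphism $(\kappa_M^r)':T\bigwedge^rT^*M\to\bigwedge^rT^*TM$ is the dual: $\langle\kappa^r_M(v),w\rangle'^{\,r}_{TM}=\langle v,(\kappa^r_M)'(w)\rangle$. For $r=0$ it is $(x,\dot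 x,t,\dot t)\mapsto(x,\dot x,\dot t)$. *)

theory Defs
  imports "HOL-Analysis.Analysis" "HOL-Library.Function_Algebras"
begin

section \<open>Real-valued linear algebra on function types\<close>

instantiation "fun" :: (type, real_vector) real_vector
begin

definition scaleR_fun :: "real \<Rightarrow> ('a \<Rightarrow> 'b) \<Rightarrow> 'a \<Rightarrow> 'b" where
  "scaleR_fun a f = (\<lambda>x. a *\<^sub>R f x)"

instance
  by standard (simp_all add: scaleR_fun_def plus_fun_def fun_eq_iff algebra_simps)

end

text \<open>Tuples of vectors are lists. Alternating \<open>r\<close>-forms on a subspace \<open>V\<close> are extended by zero to
  all lists that are not \<open>r\<close>-tuples of elements of \<open>V\<close>.\<close>

type_synonym 'v form = "'v list \<Rightarrow> real"
type_synonym 'v mvec = "'v form \<Rightarrow> real"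

definition tuples :: "nat \<Rightarrow> 'v set \<Rightarrow> 'v list set" where
  "tuples r V = {vs. length vs = r \<and> set vs \<subseteq> V}"

definition alt_forms :: "nat \<Rightarrow> 'v::real_vector set \<Rightarrow> 'v form set" where
  "alt_forms r V = {\<alpha>.
     (\<forall>vs. vs \<notin> tuples r V \<longrightarrow> \<alpha> vs = 0) \<and>
     (\<forall>vs\<in>tuples r V. \<forall>j<r. \<forall>a\<in>V. \<forall>b\<in>V. \<forall>s t.
        \<alpha> (vs[j := s *\<^sub>R a + t *\<^sub>R b]) = s * \<alpha> (vs[j := a]) + t * \<alpha> (vs[j := b])) \<and>
     (\<forall>vs\<in>tuples r V. \<forall>j<r. \<forall>k<r. j \<noteq> k \<longrightarrow> vs ! j = vs ! k \<longrightarrow> \<alpha> vs = 0)}"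

text \<open>The exterior power of \<open>V\<close> is realised inside the dual of \<open>alt_forms r V\<close>, as the span of the
  decomposable elements \<open>\<alpha> \<mapsto> \<alpha> (v\<^sub>1, \<dots>, v\<^sub>r)\<close>. Hence the canonical pairing of an \<open>r\<close>-vector \<open>u\<close> with
  an \<open>r\<close>-form \<open>\<alpha>\<close> is \<open>u \<alpha>\<close>. For \<open>r = 0\<close> the number \<open>t\<close> corresponds to \<open>t *\<^sub>R wedge 0 V []\<close>
  and, on the dual side, to the form with value \<open>t\<close> at \<open>[]\<close>.\<close>

definition wedge :: "nat \<Rightarrow> 'v::real_vector set \<Rightarrow> 'v list \<Rightarrow> 'v mvec" where
  "wedge r V vs = (\<lambda>\<alpha>. if \<alpha> \<in> alt_forms r V then \<alpha> vs else 0)"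

definition ext_power :: "nat \<Rightarrow> 'v::real_vector set \<Rightarrow> 'v mvec set" where
  "ext_power r V = span (wedge r V ` tuples r V)"

text \<open>The product \<open>u \<and> v\<close> of multivectors of degrees adding up to \<open>r\<close>; it extends
  \<open>(u\<^sub>1 \<and> \<dots> \<and> u\<^sub>i) \<and> (v\<^sub>1 \<and> \<dots> \<and> v\<^sub>j) = u\<^sub>1 \<and> \<dots> \<and> u\<^sub>i \<and> v\<^sub>1 \<and> \<dots> \<and> v\<^sub>j\<close> bilinearly.\<close>

definition wedge_prod :: "nat \<Rightarrow> 'v::real_vector set \<Rightarrow> 'v mvec \<Rightarrow> 'v mvec \<Rightarrow> 'v mvec" where
  "wedge_prod r V u v =
     (\<lambda>\<omega>. if \<omega> \<in> alt_forms r V then u (\<lambda>us. v (\<lambda>vs. \<omega> (us @ vs))) else 0)"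


section \<open>Smooth manifolds\<close>

text \<open>The model space of a manifold is a linear subspace \<open>S\<close> of a normed space, so that the total
  spaces of the exterior bundles, whose dimension depends on the degree, can be given charts. For
  \<open>U\<close> open in \<open>S\<close>, derivatives within \<open>U\<close> are unique on vectors of \<open>S\<close>.\<close>

primrec Ck_on :: "nat \<Rightarrow> 'e::real_normed_vector set \<Rightarrow> 'e set \<Rightarrow> ('e \<Rightarrow> 'f::real_normed_vector) \<Rightarrow> bool"
where
  "Ck_on 0 S U f = continuous_on U f"
| "Ck_on (Suc k) S U f =
     (\<exists>f'. (\<forall>x\<in>U. (f has_derivative f' x) (at x within U)) \<and>
           (\<forall>h\<in>S. Ck_on k S U (\<lambda>x. f' x h)))"

definition smooth_on :: "'e::real_normed_vector set \<Rightarrow> 'e set \<Rightarrow> ('e \<Rightarrow> 'f::real_normed_vector) \<Rightarrow> bool"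
where
  "smooth_on S U f \<longleftrightarrow> (\<forall>k. Ck_on k S U f)"

text \<open>A chart is a domain together with a coordinate map, only the values on the domain matter.\<close>

type_synonym ('a, 'e) chart = "'a set \<times> ('a \<Rightarrow> 'e)"

definition chart_inv :: "('a, 'e) chart \<Rightarrow> 'e \<Rightarrow> 'a" where
  "chart_inv c = inv_into (fst c) (snd c)"

definition charts_at :: "('a, 'e) chart set \<Rightarrow> 'a \<Rightarrow> ('a, 'e) chart set" where
  "charts_at A x = {c \<in> A. x \<in> fst c}"

definition points :: "('a, 'e) chart set \<Rightarrow> 'a set" where
  "points A = (\<Union>c\<in>A. fst c)"

definition smooth_manifold ::
  "'a topology \<Rightarrow> 'e::real_normed_vector set \<Rightarrow> ('a, 'e) chart set \<Rightarrow> bool" where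
  "smooth_manifold X S A \<longleftrightarrow>
     Hausdorff_space X \<and>
     (\<exists>\<B>. countable \<B> \<and> (\<forall>W\<in>\<B>. openin X W) \<and>
          (\<forall>W. openin X W \<longrightarrow> (\<exists>\<C>\<subseteq>\<B>. \<Union>\<C> = W))) \<and>
     subspace S \<and>
     points A = topspace X \<and>
     (\<forall>(U, \<phi>)\<in>A. openin X U \<and> openin (top_of_set S) (\<phi> ` U) \<and>
        homeomorphic_map (subtopology X U) (top_of_set (\<phi> ` U)) \<phi>) \<and>
     (\<forall>(U, \<phi>)\<in>A. \<forall>(V, \<psi>)\<in>A. smooth_on S (\<phi> ` (U \<inter> V)) (\<psi> \<circ> chart_inv (U, \<phi>)))"

text \<open>\<open>\<real>\<^sup>I\<close>, of dimension \<open>card I\<close>; a subset \<open>I\<close> of the index type is used in order to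
  include dimension 0.\<close>

definition coord_space :: "'n set \<Rightarrow> (real ^ 'n::finite) set" where
  "coord_space I = {x. \<forall>k. k \<notin> I \<longrightarrow> x $ k = 0}"


section \<open>Tangent vectors and tangent maps\<close>

text \<open>Tangent vectors are velocities of curves. The class of a curve through \<open>x\<close> under the
  relation of having the same velocity in charts is encoded by \<open>x\<close> and the family of
  its velocities in all charts at \<open>x\<close>. Only differentiability at the parameter 0 is
  required of a curve; every class contains a smooth curve, so this gives the same vectors.\<close>

type_synonym ('a, 'e) tfib = "('a, 'e) chart \<Rightarrow> 'e"
type_synonym ('a, 'e) tvec = "'a \<times> ('a, 'e) tfib"
type_synonym ('a, 'e) ttfib = "(('a, 'e) tvec, 'e \<times> 'e) tfib"
type_synonym ('a, 'e) ttvec = "(('a, 'e) tvec, 'e \<times> 'e) tvec"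

definition curve_at0 :: "('a, 'e::real_normed_vector) chart set \<Rightarrow> (real \<Rightarrow> 'a) \<Rightarrow> bool" where
  "curve_at0 A \<gamma> \<longleftrightarrow> \<gamma> 0 \<in> points A \<and>
     (\<forall>c\<in>charts_at A (\<gamma> 0). (\<forall>\<^sub>F t in nhds 0. \<gamma> t \<in> fst c) \<and>
        (\<lambda>t. snd c (\<gamma> t)) differentiable (at 0))"

definition velocity :: "('a, 'e::real_normed_vector) chart set \<Rightarrow> (real \<Rightarrow> 'a)
    \<Rightarrow> ('a, 'e) tvec" where
  "velocity A \<gamma> = (\<gamma> 0, \<lambda>c. if c \<in> charts_at A (\<gamma> 0)
     then vector_derivative (\<lambda>t. snd c (\<gamma> t)) (at 0) else 0)"

definition tangent_bundle :: "('a, 'e::real_normed_vector) chart set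
    \<Rightarrow> ('a, 'e) tvec set" where
  "tangent_bundle A = velocity A ` {\<gamma>. curve_at0 A \<gamma>}"

definition tangent_space :: "('a, 'e::real_normed_vector) chart set \<Rightarrow> 'a
    \<Rightarrow> ('a, 'e) tfib set" where
  "tangent_space A x = {v. (x, v) \<in> tangent_bundle A}"

text \<open>The tangent vector at \<open>x\<close> with components \<open>h\<close> in the chart \<open>c\<close>.\<close>

definition coord_vec :: "('a, 'e::real_normed_vector) chart set \<Rightarrow> ('a, 'e) chart \<Rightarrow> 'a \<Rightarrow> 'e
    \<Rightarrow> ('a, 'e) chart \<Rightarrow> 'e" where
  "coord_vec A c x h = snd (velocity A (\<lambda>t. chart_inv c (snd c x + t *\<^sub>R h)))"

text \<open>The induced coordinates \<open>(x, \<dot>x)\<close> on the tangent bundle, modelled on \<open>S \<times> S\<close>.\<close>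

definition tangent_chart :: "('a, 'e::real_normed_vector) chart set \<Rightarrow> ('a, 'e) chart
    \<Rightarrow> (('a, 'e) tvec, 'e \<times> 'e) chart" where
  "tangent_chart A c = ({w \<in> tangent_bundle A. fst w \<in> fst c}, \<lambda>(x, v). (snd c x, v c))"

definition tangent_atlas :: "('a, 'e::real_normed_vector) chart set
    \<Rightarrow> (('a, 'e) tvec, 'e \<times> 'e) chart set" where
  "tangent_atlas A = tangent_chart A ` A"

definition tangent_map :: "('a, 'e::real_normed_vector) chart set
    \<Rightarrow> ('b, 'f::real_normed_vector) chart set \<Rightarrow> ('a \<Rightarrow> 'b)
    \<Rightarrow> ('a, 'e) tvec \<Rightarrow> ('b, 'f) tvec" where
  "tangent_map A B f w = velocity B (f \<circ> (SOME \<gamma>. curve_at0 A \<gamma> \<and> velocity A \<gamma> = w))"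

text \<open>Tangent map of a map \<open>f\<close> defined on the fibre product of several copies of a bundle \<open>E\<close>
  (with points \<open>(x, e)\<close> and projection \<open>fst\<close>): tangent vectors of the fibre product are
  represented by tuples of curves in \<open>E\<close> lying over one and the same curve in the base.\<close>

definition tangent_map_fibred :: "('a \<times> 'v, 'e::real_normed_vector) chart set
    \<Rightarrow> ('b, 'f::real_normed_vector) chart set \<Rightarrow> (('a \<times> 'v) list \<Rightarrow> 'b)
    \<Rightarrow> ('a \<times> 'v, 'e) tvec list \<Rightarrow> ('b, 'f) tvec" where
  "tangent_map_fibred E B f ws =
     (let \<gamma>s = (SOME \<gamma>s. list_all2 (\<lambda>\<gamma> w. curve_at0 E \<gamma> \<and> velocity E \<gamma> = w) \<gamma>s ws \<and>
                  (\<forall>\<^sub>F t in nhds 0. \<forall>\<gamma>\<in>set \<gamma>s. \<forall>\<delta>\<in>set \<gamma>s. fst (\<gamma> t) = fst (\<delta> t)))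
      in velocity B (\<lambda>t. f (map (\<lambda>\<gamma>. \<gamma> t) \<gamma>s)))"


section \<open>Exterior bundles\<close>

text \<open>Notation for manifolds modelled on a coordinate subspace of \<open>real ^ 'n\<close>: atlases, fibres of the
  tangent bundle and of the iterated tangent bundle, coordinates on and tangent vectors of the
  exterior bundles.\<close>

type_synonym ('a, 'n) natlas = "('a, (real, 'n) vec) chart set"
type_synonym ('a, 'n) nfib = "('a, (real, 'n) vec) tfib"
type_synonym ('a, 'n) nvec = "('a, (real, 'n) vec) tvec"
type_synonym ('a, 'n) nnfib = "('a, (real, 'n) vec) ttfib"
type_synonym 'n bmodel = "(real, 'n) vec \<times> (real, 'n set) vec"
type_synonym ('a, 'n) mvec_tvec = "('a \<times> ('a, 'n) nfib mvec, 'n bmodel) tvec"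
type_synonym ('a, 'n) form_tvec = "('a \<times> ('a, 'n) nfib form, 'n bmodel) tvec"

definition ext_bundle :: "('a, 'e::real_normed_vector) chart set \<Rightarrow> nat
    \<Rightarrow> ('a \<times> ('a, 'e) tfib mvec) set" where
  "ext_bundle A r = {(x, u). x \<in> points A \<and> u \<in> ext_power r (tangent_space A x)}"

definition coext_bundle :: "('a, 'e::real_normed_vector) chart set \<Rightarrow> nat
    \<Rightarrow> ('a \<times> ('a, 'e) tfib form) set" where
  "coext_bundle A r = {(x, \<alpha>). x \<in> points A \<and> \<alpha> \<in> alt_forms r (tangent_space A x)}"

text \<open>\<open>dx\<^sup>b\<^sup>1 \<and> \<dots> \<and> dx\<^sup>b\<^sup>r\<close> at \<open>x\<close>, where \<open>b1 < \<dots> < br\<close> are the elements of \<open>B\<close>.\<close>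

definition coord_form :: "('a, 'n::{finite,linorder}) natlas \<Rightarrow> ('a, (real, 'n) vec) chart \<Rightarrow> 'a
    \<Rightarrow> 'n set \<Rightarrow> ('a, 'n) nfib form" where
  "coord_form A c x B = (\<lambda>vs. if vs \<in> tuples (card B) (tangent_space A x)
     then \<Sum>p | p permutes {..<card B}. of_int (sign p) *
            (\<Prod>k<card B. (vs ! k) c $ (sorted_list_of_set B ! p k))
     else 0)"

text \<open>The charts of the total spaces: base coordinates together with the components indexed by
  the \<open>r\<close>-element subsets of \<open>I\<close>. The model space is \<open>\<real>\<^sup>I\<close> times the space of families supported on
  these subsets.\<close>

definition ext_atlas :: "('a, 'n::{finite,linorder}) natlas \<Rightarrow> 'n set \<Rightarrow> nat
    \<Rightarrow> ('a \<times> ('a, 'n) nfib mvec, 'n bmodel) chart set" where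
  "ext_atlas A I r = (\<lambda>c. ({w \<in> ext_bundle A r. fst w \<in> fst c},
     \<lambda>(x, u). (snd c x, \<chi> B. if B \<subseteq> I \<and> card B = r then u (coord_form A c x B) else 0))) ` A"

definition coext_atlas :: "('a, 'n::{finite,linorder}) natlas \<Rightarrow> 'n set \<Rightarrow> nat
    \<Rightarrow> ('a \<times> ('a, 'n) nfib form, 'n bmodel) chart set" where
  "coext_atlas A I r = (\<lambda>c. ({w \<in> coext_bundle A r. fst w \<in> fst c},
     \<lambda>(x, \<alpha>). (snd c x, \<chi> B. if B \<subseteq> I \<and> card B = r
        then \<alpha> (map (\<lambda>b. coord_vec A c x (axis b 1)) (sorted_list_of_set B)) else 0))) ` A"


section \<open>Differential forms\<close>

definition diff_form :: "'e::real_normed_vector set \<Rightarrow> ('a, 'e) chart set \<Rightarrow> nat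
    \<Rightarrow> ('a \<Rightarrow> ('a, 'e) tfib form) \<Rightarrow> bool" where
  "diff_form S A r \<mu> \<longleftrightarrow>
     (\<forall>x\<in>points A. \<mu> x \<in> alt_forms r (tangent_space A x)) \<and>
     (\<forall>c\<in>A. \<forall>hs\<in>tuples r S. smooth_on S (snd c ` fst c)
        (\<lambda>p. \<mu> (chart_inv c p) (map (coord_vec A c (chart_inv c p)) hs)))"

text \<open>The coordinate formula
  \<open>d\<mu> (v\<^sub>0, \<dots>, v\<^sub>r) = \<Sum>\<^sub>j (-1)\<^sup>j D\<^bsub>v\<^sub>j\<^esub> \<mu> (v\<^sub>0, \<dots>, v\<^sub>j omitted, \<dots>, v\<^sub>r)\<close>, in a chart at the point in
  question; it does not depend on the chart.\<close>

definition ext_deriv :: "('a, 'e::real_normed_vector) chart set \<Rightarrow> nat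
    \<Rightarrow> ('a \<Rightarrow> ('a, 'e) tfib form)
    \<Rightarrow> 'a \<Rightarrow> ('a, 'e) tfib form" where
  "ext_deriv A r \<mu> x vs =
     (if vs \<in> tuples (Suc r) (tangent_space A x) then
        let c = (SOME c. c \<in> charts_at A x) in
        \<Sum>j\<le>r. (-1) ^ j *
          deriv (\<lambda>t. let y = chart_inv c (snd c x + t *\<^sub>R (vs ! j) c)
                     in \<mu> y (map (\<lambda>v. coord_vec A c y (v c)) (take j vs @ drop (Suc j) vs))) 0
      else 0)"

definition pullback_form :: "('a, 'e::real_normed_vector) chart set
    \<Rightarrow> ('b, 'f::real_normed_vector) chart set \<Rightarrow> ('a \<Rightarrow> 'b) \<Rightarrow> nat
    \<Rightarrow> ('b \<Rightarrow> ('b, 'f) tfib form)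
    \<Rightarrow> 'a \<Rightarrow> ('a, 'e) tfib form" where
  "pullback_form A B f r \<mu> x vs =
     (if vs \<in> tuples r (tangent_space A x)
      then \<mu> (f x) (map (\<lambda>v. snd (tangent_map A B f (x, v))) vs) else 0)"

definition interior_prod :: "('a, 'e::real_normed_vector) chart set \<Rightarrow> nat
    \<Rightarrow> ('a \<Rightarrow> ('a, 'e) tvec)
    \<Rightarrow> ('a \<Rightarrow> ('a, 'e) tfib form)
    \<Rightarrow> 'a \<Rightarrow> ('a, 'e) tfib form" where
  "interior_prod A r \<Gamma> \<nu> x vs =
     (if vs \<in> tuples (r - 1) (tangent_space A x) then \<nu> x (snd (\<Gamma> x) # vs) else 0)"

text \<open>\<open>contraction A r i \<mu>\<close> sends \<open>(x, u)\<close> to the form whose pairing with \<open>v = v\<^sub>1 \<and> \<dots> \<and> v\<^bsub>r-i\<^esub>\<close>,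
  i.e. whose value at \<open>(v\<^sub>1, \<dots>, v\<^bsub>r-i\<^esub>)\<close>, is \<open>\<mu> (u \<and> v)\<close>.\<close>

definition contraction :: "('a, 'e::real_normed_vector) chart set \<Rightarrow> nat \<Rightarrow> nat
    \<Rightarrow> ('a \<Rightarrow> ('a, 'e) tfib form)
    \<Rightarrow> 'a \<times> ('a, 'e) tfib mvec
    \<Rightarrow> 'a \<times> ('a, 'e) tfib form" where
  "contraction A r i \<mu> = (\<lambda>(x, u). (x, \<lambda>vs.
     if vs \<in> tuples (r - i) (tangent_space A x)
     then wedge_prod r (tangent_space A x) u (wedge (r - i) (tangent_space A x) vs) (\<mu> x)
     else 0))"


section \<open>Tangent lift of forms\<close>

text \<open>A second order vector field. Smoothness is not required: only the value of \<open>\<Gamma>\<close> at a point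
  enters the interior product there, and \<open>i_T \<mu>\<close> does not depend on \<open>\<Gamma>\<close>.\<close>

definition second_order :: "('a, 'e::real_normed_vector) chart set
    \<Rightarrow> (('a, 'e) tvec
        \<Rightarrow> ('a, 'e) ttvec) \<Rightarrow> bool" where
  "second_order A \<Gamma> \<longleftrightarrow> (\<forall>w\<in>tangent_bundle A.
     \<Gamma> w \<in> tangent_bundle (tangent_atlas A) \<and> fst (\<Gamma> w) = w \<and>
     tangent_map (tangent_atlas A) A fst (\<Gamma> w) = w)"

definition v_T :: "('a, 'e::real_normed_vector) chart set \<Rightarrow> nat
    \<Rightarrow> ('a \<Rightarrow> ('a, 'e) tfib form)
    \<Rightarrow> ('a, 'e) tvec
    \<Rightarrow> ('a, 'e) ttfib form" where
  "v_T A r \<mu> = pullback_form (tangent_atlas A) A fst r \<mu>"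

definition i_T :: "('a, 'e::real_normed_vector) chart set \<Rightarrow> nat
    \<Rightarrow> ('a \<Rightarrow> ('a, 'e) tfib form)
    \<Rightarrow> ('a, 'e) tvec
    \<Rightarrow> ('a, 'e) ttfib form" where
  "i_T A r \<mu> = (if r = 0 then 0 else
     interior_prod (tangent_atlas A) r (SOME \<Gamma>. second_order A \<Gamma>) (v_T A r \<mu>))"

definition d_T :: "('a, 'e::real_normed_vector) chart set \<Rightarrow> nat
    \<Rightarrow> ('a \<Rightarrow> ('a, 'e) tfib form)
    \<Rightarrow> ('a, 'e) tvec
    \<Rightarrow> ('a, 'e) ttfib form" where
  "d_T A r \<mu> = (if r = 0 then 0 else ext_deriv (tangent_atlas A) (r - 1) (i_T A r \<mu>))
     + i_T A (Suc r) (ext_deriv A r \<mu>)"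


section \<open>The flip and its exterior powers\<close>

text \<open>The coordinates \<open>((x, \<dot>x), (\<delta>x, \<delta>\<dot>x))\<close> on the second tangent bundle.\<close>

definition TT_coords :: "('a, 'e::real_normed_vector) chart set \<Rightarrow> ('a, 'e) chart
    \<Rightarrow> ('a, 'e) ttvec
    \<Rightarrow> ('e \<times> 'e) \<times> ('e \<times> 'e)" where
  "TT_coords A c = snd (tangent_chart (tangent_atlas A) (tangent_chart A c))"

definition kappa :: "('a, 'e::real_normed_vector) chart set
    \<Rightarrow> ('a, 'e) ttvec
    \<Rightarrow> ('a, 'e) ttvec" where
  "kappa A z = (THE y. y \<in> tangent_bundle (tangent_atlas A) \<and> fst (fst y) = fst (fst z) \<and>
     (\<forall>c\<in>charts_at A (fst (fst z)). \<forall>x x' dx dx'.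
        TT_coords A c z = ((x, x'), (dx, dx')) \<longrightarrow> TT_coords A c y = ((x, dx), (x', dx'))))"

text \<open>The operations of the vector bundle \<open>T\<pi>\<close>, where \<open>\<pi>\<close> is the projection of the
  \<open>r\<close>-th exterior bundle: the tangent maps of fibrewise addition and scaling.\<close>

definition T_add :: "('a, 'n::{finite,linorder}) natlas \<Rightarrow> 'n set \<Rightarrow> nat
    \<Rightarrow> ('a, 'n) mvec_tvec \<Rightarrow> ('a, 'n) mvec_tvec \<Rightarrow> ('a, 'n) mvec_tvec" where
  "T_add A I r z z' = tangent_map_fibred (ext_atlas A I r) (ext_atlas A I r)
     (\<lambda>ps. (fst (hd ps), sum_list (map snd ps))) [z, z']"

definition T_scale :: "('a, 'n::{finite,linorder}) natlas \<Rightarrow> 'n set \<Rightarrow> nat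
    \<Rightarrow> real \<Rightarrow> ('a, 'n) mvec_tvec \<Rightarrow> ('a, 'n) mvec_tvec" where
  "T_scale A I r a = tangent_map (ext_atlas A I r) (ext_atlas A I r) (\<lambda>p. (fst p, a *\<^sub>R snd p))"

definition T_wedge :: "('a, 'n::{finite,linorder}) natlas \<Rightarrow> 'n set \<Rightarrow> nat
    \<Rightarrow> ('a, (real, 'n) vec) ttvec list \<Rightarrow> ('a, 'n) mvec_tvec" where
  "T_wedge A I r = tangent_map_fibred (tangent_atlas A) (ext_atlas A I r)
     (\<lambda>ps. (fst (hd ps), wedge r (tangent_space A (fst (hd ps))) (map snd ps)))"

text \<open>For \<open>r > 0\<close> the morphism is determined by its values on decomposable elements and linearity
  on the fibres. For \<open>r = 0\<close> the vector with base point \<open>(x, s)\<close> and components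
  \<open>(\<dot>x, 0)\<close> is the image of \<open>\<dot>x\<close> under the tangent map of the constant section \<open>x \<mapsto> (x, s)\<close>;
  here \<open>s\<close> is the number corresponding to the 0-vector \<open>U\<close>.\<close>

definition is_kappa_pow :: "('a, 'n::{finite,linorder}) natlas \<Rightarrow> 'n set \<Rightarrow> nat
    \<Rightarrow> (('a, 'n) nvec \<times> ('a, 'n) nnfib mvec \<Rightarrow> ('a, 'n) mvec_tvec) \<Rightarrow> bool" where
  "is_kappa_pow A I r K \<longleftrightarrow> (\<forall>w\<in>tangent_bundle A.
     let V = tangent_space (tangent_atlas A) w in
     (\<forall>U\<in>ext_power r V. K (w, U) \<in> tangent_bundle (ext_atlas A I r) \<and>
        tangent_map (ext_atlas A I r) A fst (K (w, U)) = w) \<and>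
     (\<forall>U\<in>ext_power r V. \<forall>U'\<in>ext_power r V.
        K (w, U + U') = T_add A I r (K (w, U)) (K (w, U'))) \<and>
     (\<forall>U\<in>ext_power r V. \<forall>a. K (w, a *\<^sub>R U) = T_scale A I r a (K (w, U))) \<and>
     (\<forall>vs\<in>tuples r V. K (w, wedge r V vs) = T_wedge A I r (map (\<lambda>v. kappa A (w, v)) vs)))"

definition kappa_pow :: "('a, 'n::{finite,linorder}) natlas \<Rightarrow> 'n set \<Rightarrow> nat
    \<Rightarrow> ('a, 'n) nvec \<times> ('a, 'n) nnfib mvec \<Rightarrow> ('a, 'n) mvec_tvec" where
  "kappa_pow A I r =
     (if r = 0 then
        (\<lambda>(w, U). let s = U (\<lambda>vs. if vs = [] then 1 else 0) in
           tangent_map A (ext_atlas A I 0)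
             (\<lambda>x. (x, s *\<^sub>R wedge 0 (tangent_space A x) [])) w)
      else (SOME K. is_kappa_pow A I r K))"

text \<open>As in \<open>tangent_map_fibred\<close>, a pair of tangent vectors over the same vector in the base is
  represented by two curves over the same base curve.\<close>

definition tangent_pairing :: "('a, 'n::{finite,linorder}) natlas \<Rightarrow> 'n set \<Rightarrow> nat
    \<Rightarrow> ('a, 'n) mvec_tvec \<Rightarrow> ('a, 'n) form_tvec \<Rightarrow> real" where
  "tangent_pairing A I r z w =
     (let (\<gamma>, \<delta>) = (SOME (\<gamma>, \<delta>).
            curve_at0 (ext_atlas A I r) \<gamma> \<and> velocity (ext_atlas A I r) \<gamma> = z \<and>
            curve_at0 (coext_atlas A I r) \<delta> \<and> velocity (coext_atlas A I r) \<delta> = w \<and>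
            (\<forall>\<^sub>F t in nhds 0. fst (\<gamma> t) = fst (\<delta> t)))
      in deriv (\<lambda>t. snd (\<gamma> t) (snd (\<delta> t))) 0)"

definition kappa_dual :: "('a, 'n::{finite,linorder}) natlas \<Rightarrow> 'n set \<Rightarrow> nat
    \<Rightarrow> ('a, 'n) form_tvec \<Rightarrow> ('a, 'n) nvec \<times> ('a, 'n) nnfib form" where
  "kappa_dual A I r w =
     (let y = tangent_map (coext_atlas A I r) A fst w;
          V = tangent_space (tangent_atlas A) y
      in (y, THE \<alpha>. \<alpha> \<in> alt_forms r V \<and>
            (\<forall>U\<in>ext_power r V. tangent_pairing A I r (kappa_pow A I r (y, U)) w = U \<alpha>)))"

end

theory Submission
  imports Defs
begin

text \<open>Everything is computed in one chart \<open>c\<close>. Let \<open>V\<^sub>1, \<dots>, V\<^sub>r\<close> be tangent vectors of the tangent bundle at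
  \<open>(x, q)\<close>, with coordinates \<open>(h\<^sub>j, k\<^sub>j)\<close>, and let \<open>x(t)\<close> be a curve with velocity \<open>q\<close>. Cartan's formula
  for the exterior derivative shows that \<open>d\<^sub>T \<mu> (V\<^sub>1, \<dots>, V\<^sub>r)\<close> is the derivative at \<open>t = 0\<close> of \<open>\<mu>\<close> at \<open>x(t)\<close>,
  evaluated on the vectors with components \<open>h\<^sub>j + t k\<^sub>j\<close>. The flip exchanges \<open>q\<close> and \<open>h\<^sub>j\<close>, so these vectors
  form curves with velocities \<open>\<kappa> V\<^sub>j\<close>, and \<open>\<kappa>\<^sup>i (V\<^sub>1 \<and> \<dots> \<and> V\<^sub>i)\<close> is the velocity of their wedge product
  \<open>u(t)\<close>. Paired with a further \<open>(r-i)\<close>-vector, both sides of the claim are therefore the derivative of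
  \<open>\<mu> (u(t) \<and> v(t))\<close> along \<open>x(t)\<close>. Second derivatives of the transition maps enter only through their
  symmetry, which makes the exterior derivative and the flip independent of the chart.\<close>

section \<open>Charts and curves\<close>

text \<open>Almost every object of the statement is made by choice: \<open>tangent_map\<close> and
  its fibred version pick curves, \<open>ext_deriv\<close> a chart, \<open>i_T\<close> a second
  order field, \<open>kappa_pow\<close> a morphism in positive degree, and \<open>kappa\<close> and
  \<open>kappa_dual\<close> are definite descriptions. The recurring obligation is to show that an
  admissible choice exists and that every admissible choice has the same coordinates. Derivatives in
  a chart are tested along curves only: this fits velocities, and it copes with model spaces that
  are proper subspaces, off which a Frechet derivative is not determined. The exterior bundles enter
  only through differentiable transition maps (\<open>bundle_curve_atlas\<close>). The coordinates
  are adapted to the flip: \<open>hcoord\<close> and \<open>vcoord\<close> of an r-vector on the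
  tangent bundle are the position and the velocity of its image under \<kappa>^r, so that the
  tangent pairing becomes the product rule for a finite sum. Expanding one function of time in two
  ways (\<open>lift_coord_append\<close>) takes the place of a Laplace expansion of minors.\<close>

definition curve_in :: "('a, 'e::real_normed_vector) chart \<Rightarrow> (real \<Rightarrow> 'a) \<Rightarrow> 'a \<Rightarrow> 'e \<Rightarrow> bool" where
  "curve_in c \<gamma> x h \<longleftrightarrow> \<gamma> 0 = x \<and> (\<forall>\<^sub>F t in nhds 0. \<gamma> t \<in> fst c) \<and>
     ((\<lambda>t. snd c (\<gamma> t)) has_vector_derivative h) (at 0)"

text \<open>The derivative at \<open>x\<close> of \<open>g\<close> in the chart \<open>c\<close>, tested along curves only. It is determined by
  \<open>g\<close> on the model space of the chart.\<close>

definition has_cderiv :: "('a, 'e::real_normed_vector) chart \<Rightarrow> ('a \<Rightarrow> 'f::real_normed_vector)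
    \<Rightarrow> ('e \<Rightarrow> 'f) \<Rightarrow> 'a \<Rightarrow> bool" where
  "has_cderiv c g D x \<longleftrightarrow> linear D \<and>
     (\<forall>\<gamma> h. curve_in c \<gamma> x h \<longrightarrow> ((\<lambda>t. g (\<gamma> t)) has_vector_derivative D h) (at 0))"

lemma hvd_cong:
  assumes "\<forall>\<^sub>F t in nhds a. f t = g t"
  shows "(f has_vector_derivative D) (at a) \<longleftrightarrow> (g has_vector_derivative D) (at a)"
  using assms eventually_nhds_x_imp_x[OF assms]
  by (intro has_vector_derivative_cong_ev) (auto elim: eventually_mono)

text \<open>Difference quotients of \<open>f\<close> at 0 lie in \<open>S\<close>, and a subspace of
  a Euclidean space is closed, so their limit stays in it.\<close>

lemma closed_subspace_hvd:
  fixes f :: "real \<Rightarrow> 'e::euclidean_space"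
  assumes S: "subspace S" and ev: "\<forall>\<^sub>F t in nhds 0. f t \<in> S"
    and D: "(f has_vector_derivative h) (at 0)"
  shows "h \<in> S"
proof -
  have f0: "f 0 \<in> S" using eventually_nhds_x_imp_x[OF ev] .
  have lim: "((\<lambda>t. (f t - f 0) /\<^sub>R t) \<longlongrightarrow> h) (at 0)"
  proof -
    have "((\<lambda>t. (f t - f 0 - (t - 0) *\<^sub>R h) /\<^sub>R norm (t - 0)) \<longlongrightarrow> 0) (at 0)"
      using D unfolding has_vector_derivative_def has_derivative_def by simp
    from tendsto_norm_zero[OF this]
    have "((\<lambda>t. norm ((f t - f 0 - t *\<^sub>R h) /\<^sub>R norm t)) \<longlongrightarrow> 0) (at 0)"
      by simp
    moreover have "\<forall>\<^sub>F t in at 0. norm ((f t - f 0 - t *\<^sub>R h) /\<^sub>R norm t) = norm ((f t - f 0) /\<^sub>R t - h)"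
    proof -
      have "norm ((f t - f 0 - t *\<^sub>R h) /\<^sub>R norm t) = norm ((f t - f 0) /\<^sub>R t - h)" if "t \<noteq> 0" for t :: real
      proof -
        have "(f t - f 0) /\<^sub>R t - h = (f t - f 0 - t *\<^sub>R h) /\<^sub>R t"
          using that by (simp add: scaleR_diff_right)
        then show ?thesis by simp
      qed
      then show ?thesis by (simp add: eventually_at_filter)
    qed
    ultimately have "((\<lambda>t. norm ((f t - f 0) /\<^sub>R t - h)) \<longlongrightarrow> 0) (at 0)"
      by (simp cong: tendsto_cong)
    then show ?thesis
      by (rule LIM_zero_cancel[OF tendsto_norm_zero_cancel])
  qed
  have "\<forall>\<^sub>F t in at 0. (f t - f 0) /\<^sub>R t \<in> S"
    using eventually_nhds_conv_at[THEN iffD1, OF ev]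
    by (auto elim!: eventually_mono intro!: S f0 subspace_diff subspace_scale)
  then show ?thesis
    by (rule Lim_in_closed_set[OF closed_subspace[OF S] _ _ lim]) simp
qed

lemma has_cderivD:
  assumes "has_cderiv c g D x" "curve_in c \<gamma> x h"
  shows "((\<lambda>t. g (\<gamma> t)) has_vector_derivative D h) (at 0)"
  using assms by (auto simp: has_cderiv_def)

lemma has_cderiv_const: "has_cderiv c (\<lambda>y. a) (\<lambda>h. 0) x"
  by (auto simp: has_cderiv_def intro!: linear_zero)

lemma has_cderiv_chart: "has_cderiv c (snd c) (\<lambda>h. h) x"
  by (auto simp: has_cderiv_def curve_in_def linear_iff)

text \<open>What velocities of curves need of an atlas. The total space of a bundle inherits it when the
  coefficients of the transition maps are differentiable, without any smoothness.\<close>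

locale curve_atlas =
  fixes S :: "'e::euclidean_space set" and A :: "('a, 'e) chart set"
  assumes subspace: "subspace S"
    and inj: "c \<in> A \<Longrightarrow> inj_on (snd c) (fst c)"
    and open_image: "c \<in> A \<Longrightarrow> openin (top_of_set S) (snd c ` fst c)"
    and domain_nhd: "\<lbrakk>c \<in> charts_at A x; c' \<in> charts_at A x; curve_in c \<gamma> x h\<rbrakk>
      \<Longrightarrow> \<forall>\<^sub>F t in nhds 0. \<gamma> t \<in> fst c'"
    and transition: "\<lbrakk>c \<in> charts_at A x; c' \<in> charts_at A x\<rbrakk> \<Longrightarrow> \<exists>D. has_cderiv c (snd c') D x"
begin

lemma chart_in_S: "c \<in> A \<Longrightarrow> y \<in> fst c \<Longrightarrow> snd c y \<in> S"
  using open_image openin_imp_subset by blast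

lemma chart_inv_chart [simp]: "c \<in> A \<Longrightarrow> y \<in> fst c \<Longrightarrow> chart_inv c (snd c y) = y"
  by (simp add: chart_inv_def inj)

lemma chart_inv_in: "p \<in> snd c ` fst c \<Longrightarrow> chart_inv c p \<in> fst c"
  by (simp add: chart_inv_def inv_into_into)

lemma chart_chart_inv: "p \<in> snd c ` fst c \<Longrightarrow> snd c (chart_inv c p) = p"
  by (simp add: chart_inv_def f_inv_into_f)

lemma line_in_image:
  assumes c: "c \<in> charts_at A x" and h: "h \<in> S"
  shows "\<forall>\<^sub>F t::real in nhds 0. snd c x + t *\<^sub>R h \<in> snd c ` fst c"
proof -
  have x: "c \<in> A" "x \<in> fst c" using c by (auto simp: charts_at_def)
  obtain T where T: "open T" "snd c ` fst c = S \<inter> T"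
    using open_image[OF x(1)] by (meson openin_open)
  have "snd c x \<in> T" using x T by blast
  have "((\<lambda>t. snd c x + t *\<^sub>R h) \<longlongrightarrow> snd c x + 0 *\<^sub>R h) (nhds (0::real))"
    by (intro tendsto_intros) (simp add: filterlim_ident)
  then have "\<forall>\<^sub>F t::real in nhds 0. snd c x + t *\<^sub>R h \<in> T"
    using T(1) \<open>snd c x \<in> T\<close> by (auto dest: topological_tendstoD)
  moreover have "snd c x + t *\<^sub>R h \<in> S" for t
    using chart_in_S[OF x] h subspace by (simp add: subspace_add subspace_scale)
  ultimately show ?thesis using T(2) by (auto elim: eventually_mono)
qed

lemma curve_in_line:
  assumes c: "c \<in> charts_at A x" and h: "h \<in> S"
  shows "curve_in c (\<lambda>t. chart_inv c (snd c x + t *\<^sub>R h)) x h"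
    and "\<forall>\<^sub>F t in nhds 0. snd c (chart_inv c (snd c x + t *\<^sub>R h)) = snd c x + t *\<^sub>R h"
proof -
  have x: "c \<in> A" "x \<in> fst c" using c by (auto simp: charts_at_def)
  note ev = line_in_image[OF assms]
  show ev2: "\<forall>\<^sub>F t in nhds 0. snd c (chart_inv c (snd c x + t *\<^sub>R h)) = snd c x + t *\<^sub>R h"
    using ev by eventually_elim (rule chart_chart_inv)
  have "((\<lambda>t. snd c x + t *\<^sub>R h) has_vector_derivative h) (at 0)"
    by (auto intro!: derivative_eq_intros)
  then have "((\<lambda>t. snd c (chart_inv c (snd c x + t *\<^sub>R h))) has_vector_derivative h) (at 0)"
    by (subst hvd_cong[OF ev2])
  then show "curve_in c (\<lambda>t. chart_inv c (snd c x + t *\<^sub>R h)) x h"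
    using x ev unfolding curve_in_def by (auto elim!: eventually_mono intro: chart_inv_in)
qed

lemma curve_in_S:
  assumes "c \<in> A" "curve_in c \<gamma> x h" shows "h \<in> S"
  by (rule closed_subspace_hvd[OF subspace, of "\<lambda>t. snd c (\<gamma> t)"])
    (use assms in \<open>auto simp: curve_in_def elim!: eventually_mono intro: chart_in_S\<close>)

text \<open>By \<open>transition\<close> the velocity of \<gamma> in any other chart is a linear
  image of \<open>h\<close>, so it agrees with that of the straight coordinate line used in
  \<open>coord_vec\<close>. One chart thus decides differentiability and velocity in all charts at
  the point.\<close>

lemma velocity_curve_in:
  assumes c: "c \<in> charts_at A x" and \<gamma>: "curve_in c \<gamma> x h"
  shows "curve_at0 A \<gamma>" and "velocity A \<gamma> = (x, coord_vec A c x h)"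
proof -
  have x: "c \<in> A" "x \<in> fst c" using c by (auto simp: charts_at_def)
  have x0: "\<gamma> 0 = x" using \<gamma> by (simp add: curve_in_def)
  have h: "h \<in> S" using curve_in_S[OF x(1) \<gamma>] .
  show "curve_at0 A \<gamma>"
    unfolding curve_at0_def x0
  proof (intro conjI ballI)
    show "x \<in> points A" using x by (auto simp: points_def)
    fix c' assume c': "c' \<in> charts_at A x"
    show "\<forall>\<^sub>F t in nhds 0. \<gamma> t \<in> fst c'" using domain_nhd[OF c c' \<gamma>] .
    obtain D where "has_cderiv c (snd c') D x" using transition[OF c c'] by blast
    from has_cderivD[OF this \<gamma>] show "(\<lambda>t. snd c' (\<gamma> t)) differentiable at 0"
      by (rule differentiableI_vector)
  qed
  let ?l = "\<lambda>t. chart_inv c (snd c x + t *\<^sub>R h)"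
  have l0: "?l 0 = x" using x by simp
  have "vector_derivative (\<lambda>t. snd c' (\<gamma> t)) (at 0) = vector_derivative (\<lambda>t. snd c' (?l t)) (at 0)"
    if c': "c' \<in> charts_at A x" for c'
  proof -
    obtain D where D: "has_cderiv c (snd c') D x" using transition[OF c c'] by blast
    show ?thesis
      using vector_derivative_at[OF has_cderivD[OF D \<gamma>]]
        vector_derivative_at[OF has_cderivD[OF D curve_in_line(1)[OF c h]]] by simp
  qed
  then show "velocity A \<gamma> = (x, coord_vec A c x h)"
    unfolding velocity_def coord_vec_def x0 l0 by auto
qed

lemma curve_at0_curve_in:
  assumes "curve_at0 A \<gamma>" "velocity A \<gamma> = (x, v)" "c \<in> charts_at A x"
  shows "curve_in c \<gamma> x (v c)"
proof -
  have x: "\<gamma> 0 = x" using assms(2) by (simp add: velocity_def)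
  then have "v c = vector_derivative (\<lambda>t. snd c (\<gamma> t)) (at 0)"
    using assms by (auto simp: velocity_def)
  then show ?thesis
    using assms x unfolding curve_in_def curve_at0_def
    by (auto simp: vector_derivative_works)
qed

lemma coord_vec_apply:
  assumes "c \<in> charts_at A x" "c' \<in> charts_at A x" "has_cderiv c (snd c') D x" "h \<in> S"
  shows "coord_vec A c x h c' = D h"
proof -
  have x: "c \<in> A" "x \<in> fst c" using assms by (auto simp: charts_at_def)
  have "coord_vec A c x h c' = vector_derivative (\<lambda>t. snd c' (chart_inv c (snd c x + t *\<^sub>R h))) (at 0)"
    using assms x by (simp add: coord_vec_def velocity_def)
  then show ?thesis
    using vector_derivative_at[OF has_cderivD[OF assms(3) curve_in_line(1)[OF assms(1,4)]]] by simp
qed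

lemma coord_vec_other: "c \<in> charts_at A x \<Longrightarrow> c' \<notin> charts_at A x \<Longrightarrow> coord_vec A c x h c' = 0"
  by (auto simp: coord_vec_def velocity_def charts_at_def)

lemma coord_vec_self [simp]: "c \<in> charts_at A x \<Longrightarrow> h \<in> S \<Longrightarrow> coord_vec A c x h c = h"
  using coord_vec_apply[OF _ _ has_cderiv_chart, of c x h] by simp

lemma coord_vec_in: 
  assumes "c \<in> charts_at A x" "h \<in> S" shows "coord_vec A c x h \<in> tangent_space A x"
  using velocity_curve_in[OF assms(1) curve_in_line(1)[OF assms]]
  unfolding tangent_space_def tangent_bundle_def by force

lemma tangent_spaceE:
  assumes "v \<in> tangent_space A x"
  obtains \<gamma> where "curve_at0 A \<gamma>" "velocity A \<gamma> = (x, v)"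
  using assms unfolding tangent_space_def tangent_bundle_def by auto

lemma coords_in_S: 
  assumes "c \<in> charts_at A x" "v \<in> tangent_space A x" shows "v c \<in> S"
proof -
  obtain \<gamma> where \<gamma>: "curve_at0 A \<gamma>" "velocity A \<gamma> = (x, v)" using assms tangent_spaceE by blast
  show ?thesis
    using curve_in_S[OF _ curve_at0_curve_in[OF \<gamma> assms(1)]] assms(1) by (simp add: charts_at_def)
qed

lemma coord_vec_coords [simp]: 
  assumes "c \<in> charts_at A x" "v \<in> tangent_space A x" shows "coord_vec A c x (v c) = v"
proof -
  obtain \<gamma> where \<gamma>: "curve_at0 A \<gamma>" "velocity A \<gamma> = (x, v)" using assms tangent_spaceE by blast
  from velocity_curve_in(2)[OF assms(1) curve_at0_curve_in[OF \<gamma> assms(1)]] \<gamma>(2)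
  show ?thesis by simp
qed

lemma tangent_space_eqI:
  assumes "c \<in> charts_at A x" "v \<in> tangent_space A x" "v' \<in> tangent_space A x" "v c = v' c"
  shows "v = v'"
  by (metis assms coord_vec_coords)

text \<open>A tangent vector is a family of components over all charts, so linearity is checked
  chart by chart: at charts around \<open>x\<close> it is that of the transition derivative,
  elsewhere everything is zero.\<close>

lemma coord_vec_lin:
  assumes c: "c \<in> charts_at A x" and h: "h \<in> S" "k \<in> S"
  shows "coord_vec A c x (s *\<^sub>R h + t *\<^sub>R k) = s *\<^sub>R coord_vec A c x h + t *\<^sub>R coord_vec A c x k"
proof
  fix c'
  have hk: "s *\<^sub>R h + t *\<^sub>R k \<in> S" using h subspace by (simp add: subspace_add subspace_scale)
  show "coord_vec A c x (s *\<^sub>R h + t *\<^sub>R k) c' = (s *\<^sub>R coord_vec A c x h + t *\<^sub>R coord_vec A c x k) c'"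
  proof (cases "c' \<in> charts_at A x")
    case True
    then obtain D where D: "has_cderiv c (snd c') D x" using transition[OF c] by blast
    then have "linear D" by (simp add: has_cderiv_def)
    then show ?thesis
      using coord_vec_apply[OF c True D] h hk by (simp add: scaleR_fun_def linear_add linear_scale)
  qed (simp add: coord_vec_other[OF c] scaleR_fun_def)
qed

lemma tangent_space_lin:
  assumes c: "c \<in> charts_at A x" and v: "v \<in> tangent_space A x" "v' \<in> tangent_space A x"
  shows "s *\<^sub>R v + t *\<^sub>R v' \<in> tangent_space A x"
proof -
  have "s *\<^sub>R v + t *\<^sub>R v' = coord_vec A c x (s *\<^sub>R v c + t *\<^sub>R v' c)"
    using coord_vec_lin[OF c coords_in_S[OF c v(1)] coords_in_S[OF c v(2)]] c v by simp
  then show ?thesis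
    using coord_vec_in[OF c] coords_in_S[OF c] v subspace by (simp add: subspace_add subspace_scale)
qed

lemma subspace_tangent_space:
  assumes c: "c \<in> charts_at A x" shows "subspace (tangent_space A x)"
proof -
  have "coord_vec A c x 0 \<in> tangent_space A x" by (rule coord_vec_in[OF c subspace_0[OF subspace]])
  from tangent_space_lin[OF c this this, of 0 0] have 0: "0 \<in> tangent_space A x" by simp
  show ?thesis
    by (rule subspaceI) (use 0 tangent_space_lin[OF c, of _ _ 1 1] tangent_space_lin[OF c _ 0] in auto)
qed

lemma bij_coords:
  assumes c: "c \<in> charts_at A x" shows "bij_betw (\<lambda>v. v c) (tangent_space A x) S"
  by (rule bij_betw_byWitness[where f' = "coord_vec A c x"])
    (simp_all add: c coords_in_S[OF c] coord_vec_in[OF c] image_subset_iff)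

lemma points_charts_at: "x \<in> points A \<longleftrightarrow> charts_at A x \<noteq> {}"
  unfolding points_def charts_at_def by blast

lemma tangent_space_points: "v \<in> tangent_space A x \<Longrightarrow> x \<in> points A"
  by (auto elim!: tangent_spaceE simp: curve_at0_def velocity_def)

end

section \<open>Tangent maps\<close>

lemma tangent_bundle_iff: "(x, v) \<in> tangent_bundle A \<longleftrightarrow> v \<in> tangent_space A x"
  by (simp add: tangent_space_def)

text \<open>Exposes the curve chosen in \<open>tangent_map\<close>; later evaluations must work for
  whichever curve it is.\<close>

lemma (in curve_atlas) tangent_map_curve:
  assumes "w \<in> tangent_bundle A"
  shows "\<exists>\<gamma>. curve_at0 A \<gamma> \<and> velocity A \<gamma> = w \<and> tangent_map A B f w = velocity B (f \<circ> \<gamma>)"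
proof -
  let ?P = "\<lambda>\<gamma>. curve_at0 A \<gamma> \<and> velocity A \<gamma> = w"
  have "\<exists>\<gamma>. ?P \<gamma>" using assms by (auto simp: tangent_bundle_def)
  then have "?P (SOME \<gamma>. ?P \<gamma>)" by (rule someI_ex)
  then show ?thesis unfolding tangent_map_def by blast
qed

text \<open>The hypothesis on domains stands in for continuity of \<open>f\<close>: it keeps the
  image of the chosen curve inside \<open>d\<close>, after which only the velocity
  \<open>v c\<close> matters.\<close>

lemma tangent_map_eq:
  assumes A: "curve_atlas S A" and B: "curve_atlas S' B"
    and c: "c \<in> charts_at A x" and d: "d \<in> charts_at B (f x)"
    and v: "v \<in> tangent_space A x"
    and dom: "\<And>y. y \<in> fst c \<Longrightarrow> f y \<in> fst d"
    and D: "has_cderiv c (\<lambda>y. snd d (f y)) D x"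
  shows "tangent_map A B f (x, v) = (f x, coord_vec B d (f x) (D (v c)))"
proof -
  interpret A: curve_atlas S A by fact
  interpret B: curve_atlas S' B by fact
  obtain \<gamma> where \<gamma>0: "curve_at0 A \<gamma>" "velocity A \<gamma> = (x, v)"
    and map: "tangent_map A B f (x, v) = velocity B (f \<circ> \<gamma>)"
    using A.tangent_map_curve v tangent_bundle_iff by metis
  have \<gamma>: "curve_in c \<gamma> x (v c)" by (rule A.curve_at0_curve_in[OF \<gamma>0 c])
  have "curve_in d (f \<circ> \<gamma>) (f x) (D (v c))"
    using \<gamma> has_cderivD[OF D \<gamma>] unfolding curve_in_def by (auto elim!: eventually_mono intro: dom)
  from B.velocity_curve_in(2)[OF d this] show ?thesis
    unfolding map .
qed

section \<open>Symmetry of second derivatives\<close>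

lemma subspace_line_in_open:
  fixes S :: "'e::real_normed_vector set"
  assumes W: "openin (top_of_set S) W" and S: "subspace S" and p: "p \<in> W" and h: "h \<in> S" and k: "k \<in> S"
  shows "\<exists>r>0. \<forall>s t. \<bar>s\<bar> < r \<longrightarrow> \<bar>t\<bar> < r \<longrightarrow> p + s *\<^sub>R h + t *\<^sub>R k \<in> W"
proof -
  obtain e where e: "e > 0" "ball p e \<inter> S \<subseteq> W"
    using W p by (auto simp: openin_contains_ball)
  have pS: "p \<in> S" using W p openin_imp_subset by blast
  define r where "r = e / (norm h + norm k + 1)"
  have d: "norm h + norm k + 1 > 0" by (smt (verit) norm_ge_zero)
  have r: "r > 0" using e d by (simp add: r_def)
  have "p + s *\<^sub>R h + t *\<^sub>R k \<in> W" if st: "\<bar>s\<bar> < r" "\<bar>t\<bar> < r" for s t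
  proof -
    have "norm (s *\<^sub>R h + t *\<^sub>R k) \<le> \<bar>s\<bar> * norm h + \<bar>t\<bar> * norm k"
      by (metis norm_scaleR norm_triangle_ineq)
    also have "\<dots> \<le> r * norm h + r * norm k"
      using st by (intro add_mono mult_right_mono) auto
    also have "\<dots> < r * (norm h + norm k + 1)" using r by (simp add: algebra_simps)
    also have "\<dots> = e" using d by (simp add: r_def)
    finally have "p + s *\<^sub>R h + t *\<^sub>R k \<in> ball p e"
      by (simp add: dist_norm norm_minus_commute[of p] add.assoc del: minus_add_distrib diff_add_eq_diff_diff_swap)
    moreover have "p + s *\<^sub>R h + t *\<^sub>R k \<in> S"
      using S pS h k by (simp add: subspace_add subspace_scale)
    ultimately show ?thesis using e by blast
  qed
  then show ?thesis using r by blast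
qed

text \<open>The second difference quotient tends to \<open>D\<^sub>k D\<^sub>h f\<close>, by the mean value theorem; it is symmetric
  in \<open>h\<close> and \<open>k\<close>.\<close>

lemma second_difference_limit:
  fixes f :: "'e::real_normed_vector \<Rightarrow> real"
  assumes S: "subspace S" and W: "openin (top_of_set S) W" and p: "p \<in> W" and hk: "h \<in> S" "k \<in> S"
    and f': "\<And>x. x \<in> W \<Longrightarrow> (f has_derivative f' x) (at x within W)"
    and f'': "((\<lambda>x. f' x h) has_derivative G) (at p within W)"
  shows "((\<lambda>s. (f (p + s *\<^sub>R h + s *\<^sub>R k) - f (p + s *\<^sub>R h) - f (p + s *\<^sub>R k) + f p) / s\<^sup>2)
    \<longlongrightarrow> G k) (at_right 0)"
proof (rule tendstoI)
  fix e :: real assume e: "e > 0"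
  \<comment> \<open>\<open>N\<close> has to exceed |h| + |k| strictly, also when both are zero. It
    bounds the distance from \<open>p\<close> of the points that occur by \<open>s * N\<close>; the
    factor 2 in \<open>e'\<close> accounts for the two remainder estimates \<open>R1\<close> and
    \<open>R2\<close>.\<close>
  define N where "N = 2 * norm h + norm k + 1"
  have N: "N > 0" unfolding N_def by (smt (verit) norm_ge_zero)
  define e' where "e' = e / (2 * N)"
  have e': "e' > 0" using e N by (simp add: e'_def)
  have lin: "linear G" using f'' has_derivative_linear by blast
  obtain d where d: "d > 0"
    "\<And>y. y \<in> W \<Longrightarrow> norm (y - p) < d \<Longrightarrow> norm (f' y h - f' p h - G (y - p)) \<le> e' * norm (y - p)"
    using f'' e' unfolding has_derivative_within_alt by blast
  obtain r where r: "r > 0" "\<And>s t. \<bar>s\<bar> < r \<Longrightarrow> \<bar>t\<bar> < r \<Longrightarrow> p + s *\<^sub>R h + t *\<^sub>R k \<in> W"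
    using subspace_line_in_open[OF W S p hk] by blast
  have "\<bar>(f (p + s *\<^sub>R h + s *\<^sub>R k) - f (p + s *\<^sub>R h) - f (p + s *\<^sub>R k) + f p) / s\<^sup>2 - G k\<bar> < e"
    if s: "0 < s" "s < min r (d / N)" for s
  proof -
    \<comment> \<open>\<open>g s - g 0\<close> is the second difference. The mean value theorem
      along \<open>h\<close> turns it into a difference of first derivatives at two points, which
      differentiability of x \<mapsto> f' x h at the single point \<open>p\<close> then
      evaluates.\<close>
    define g where "g t = f (p + t *\<^sub>R h + s *\<^sub>R k) - f (p + t *\<^sub>R h)" for t
    have W1: "p + t *\<^sub>R h + s *\<^sub>R k \<in> W" "p + t *\<^sub>R h \<in> W" if "0 \<le> t" "t \<le> s" for t
      using r(2)[of t s] r(2)[of t 0] that s by auto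
    have line: "((\<lambda>t. f (q + t *\<^sub>R h)) has_derivative (\<lambda>\<tau>. f' (q + t *\<^sub>R h) (\<tau> *\<^sub>R h))) (at t within {0..s})"
      if q: "\<And>t. 0 \<le> t \<Longrightarrow> t \<le> s \<Longrightarrow> q + t *\<^sub>R h \<in> W" and t: "0 \<le> t" "t \<le> s" for q t
    proof -
      have 1: "((\<lambda>t. q + t *\<^sub>R h) has_derivative (\<lambda>\<tau>. \<tau> *\<^sub>R h)) (at t within {0..s})"
        by (auto intro!: derivative_eq_intros)
      have 2: "(f has_derivative f' (q + t *\<^sub>R h)) (at (q + t *\<^sub>R h) within (\<lambda>t. q + t *\<^sub>R h) ` {0..s})"
        by (rule has_derivative_subset[OF f']) (use q t in auto)
      show ?thesis using has_derivative_in_compose[OF 1 2] by (simp add: o_def)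
    qed
    have gd: "(g has_derivative (\<lambda>\<tau>. f' (p + t *\<^sub>R h + s *\<^sub>R k) (\<tau> *\<^sub>R h) - f' (p + t *\<^sub>R h) (\<tau> *\<^sub>R h)))
        (at t within {0..s})" if t: "0 \<le> t" "t \<le> s" for t
    proof -
      have eq: "p + t *\<^sub>R h + s *\<^sub>R k = p + s *\<^sub>R k + t *\<^sub>R h" for t by simp
      from line[of "p + s *\<^sub>R k" t] line[of p t] t W1 show ?thesis
        unfolding g_def eq by (intro has_derivative_diff) auto
    qed
    obtain \<xi> where \<xi>: "0 < \<xi>" "\<xi> < s"
      "g s - g 0 = f' (p + \<xi> *\<^sub>R h + s *\<^sub>R k) ((s - 0) *\<^sub>R h) - f' (p + \<xi> *\<^sub>R h) ((s - 0) *\<^sub>R h)"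
      using mvt_simple[OF s(1) gd] by auto
    have linf': "linear (f' x)" if "x \<in> W" for x using f'[OF that] has_derivative_linear by blast
    have \<Delta>: "g s - g 0 = s * (f' (p + \<xi> *\<^sub>R h + s *\<^sub>R k) h - f' (p + \<xi> *\<^sub>R h) h)"
      using \<xi> linear_scale[OF linf'] W1[of \<xi>] by (simp add: algebra_simps)
    have small: "norm (y - p) < d \<and> norm (y - p) \<le> s * (norm h + norm k)"
      if "y - p = \<xi> *\<^sub>R h + t *\<^sub>R k" "0 \<le> t" "t \<le> s" for y t
    proof -
      have "norm (y - p) \<le> \<xi> * norm h + t * norm k"
        unfolding that(1) using norm_triangle_ineq[of "\<xi> *\<^sub>R h" "t *\<^sub>R k"] \<xi> that by simp
      also have "\<dots> \<le> s * norm h + s * norm k"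
        using \<xi> that by (intro add_mono mult_right_mono) auto
      finally have 1: "norm (y - p) \<le> s * (norm h + norm k)" by (simp add: algebra_simps)
      also have "\<dots> \<le> s * N" unfolding N_def using s by (intro mult_left_mono) auto
      also have "\<dots> < d" using s N by (simp add: pos_less_divide_eq)
      finally show ?thesis using 1 by simp
    qed
    let ?R = "\<lambda>y. f' y h - f' p h - G (y - p)"
    have R: "\<bar>?R y\<bar> \<le> e' * (s * (norm h + norm k))"
      if "y - p = \<xi> *\<^sub>R h + t *\<^sub>R k" "0 \<le> t" "t \<le> s" "y \<in> W" for y t
      using d(2)[OF that(4)] small[OF that(1-3)] e' by (smt (verit, best) mult_left_mono real_norm_def)
    have R1: "\<bar>?R (p + \<xi> *\<^sub>R h + s *\<^sub>R k)\<bar> \<le> e' * (s * (norm h + norm k))"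
      by (rule R[of _ s]) (use \<xi> s W1 in auto)
    have R2: "\<bar>?R (p + \<xi> *\<^sub>R h)\<bar> \<le> e' * (s * (norm h + norm k))"
      by (rule R[of _ 0]) (use \<xi> s W1 in auto)
    \<comment> \<open>Both points are compared with \<open>p\<close>; the contributions of \<xi> and
      \<open>h\<close> cancel in the difference and only the direction \<open>k\<close>
      survives.\<close>
    have "G (p + \<xi> *\<^sub>R h + s *\<^sub>R k - p) - G (p + \<xi> *\<^sub>R h - p) = s * G k"
      using lin by (simp add: linear_add linear_scale add.assoc)
    then have "\<bar>(f' (p + \<xi> *\<^sub>R h + s *\<^sub>R k) h - f' (p + \<xi> *\<^sub>R h) h) - s * G k\<bar>
        \<le> 2 * (e' * (s * (norm h + norm k)))"
      using R1 R2 by linarith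
    also have "\<dots> = s * (2 * e' * (norm h + norm k))" by (simp add: algebra_simps)
    also have "\<dots> < s * (2 * e' * N)" unfolding N_def
      using s e' norm_ge_zero[of h] by (intro mult_strict_left_mono) linarith+
    also have "\<dots> = s * e" using N by (simp add: e'_def)
    finally have "\<bar>(f' (p + \<xi> *\<^sub>R h + s *\<^sub>R k) h - f' (p + \<xi> *\<^sub>R h) h) - s * G k\<bar> < s * e" .
    then have "\<bar>(f' (p + \<xi> *\<^sub>R h + s *\<^sub>R k) h - f' (p + \<xi> *\<^sub>R h) h) - s * G k\<bar> / s < e"
      using s by (simp add: pos_divide_less_eq mult.commute)
    moreover have "(g s - g 0) / s\<^sup>2 - G k
        = ((f' (p + \<xi> *\<^sub>R h + s *\<^sub>R k) h - f' (p + \<xi> *\<^sub>R h) h) - s * G k) / s"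
      unfolding \<Delta> using s by (simp add: power2_eq_square field_simps)
    ultimately have "\<bar>(g s - g 0) / s\<^sup>2 - G k\<bar> < e" using s by simp
    then show ?thesis by (simp add: g_def algebra_simps)
  qed
  moreover have "min r (d / N) > 0" using r d N by simp
  ultimately show "\<forall>\<^sub>F s in at_right 0.
      dist ((f (p + s *\<^sub>R h + s *\<^sub>R k) - f (p + s *\<^sub>R h) - f (p + s *\<^sub>R k) + f p) / s\<^sup>2) (G k) < e"
    unfolding eventually_at_right_field dist_real_def by blast
qed

text \<open>Pairing with an arbitrary \<open>z\<close> reduces to real functions. The second
  difference quotient is symmetric in \<open>h\<close> and \<open>k\<close>, so it converges to both
  sides, and limits are unique.\<close>

lemma second_derivative_symmetric:
  fixes f :: "'e::real_normed_vector \<Rightarrow> 'f::real_inner"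
  assumes S: "subspace S" and W: "openin (top_of_set S) W" and p: "p \<in> W" and hk: "h \<in> S" "k \<in> S"
    and f': "\<And>x. x \<in> W \<Longrightarrow> (f has_derivative f' x) (at x within W)"
    and G: "((\<lambda>x. f' x h) has_derivative G) (at p within W)"
    and H: "((\<lambda>x. f' x k) has_derivative H) (at p within W)"
  shows "G k = H h"
proof -
  have "z \<bullet> G k = z \<bullet> H h" for z
  proof (rule tendsto_unique[OF _ _ ])
    have f: "((\<lambda>y. z \<bullet> f y) has_derivative (\<lambda>u. z \<bullet> f' x u)) (at x within W)" if "x \<in> W" for x
      using f'[OF that] by (rule has_derivative_inner_right)
    show "((\<lambda>s. (z \<bullet> f (p + s *\<^sub>R h + s *\<^sub>R k) - z \<bullet> f (p + s *\<^sub>R h) - z \<bullet> f (p + s *\<^sub>R k) + z \<bullet> f p) / s\<^sup>2)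
      \<longlongrightarrow> z \<bullet> G k) (at_right 0)"
      by (rule second_difference_limit[OF S W p hk f has_derivative_inner_right[OF G]])
    show "((\<lambda>s. (z \<bullet> f (p + s *\<^sub>R h + s *\<^sub>R k) - z \<bullet> f (p + s *\<^sub>R h) - z \<bullet> f (p + s *\<^sub>R k) + z \<bullet> f p) / s\<^sup>2)
      \<longlongrightarrow> z \<bullet> H h) (at_right 0)"
      using second_difference_limit[OF S W p hk(2,1) f has_derivative_inner_right[OF H]]
      by (simp add: algebra_simps)
  qed simp
  then show ?thesis by (metis vector_eq_rdot inner_commute)
qed

section \<open>Smooth manifolds\<close>

text \<open>Chain rule within a set: near time 0 the coordinates of the curve stay in
  \<open>W\<close>, so a derivative within \<open>W\<close> is enough even where \<open>W\<close>
  has no interior in the ambient space.\<close>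

lemma has_cderiv_frechet:
  assumes D: "(f has_derivative D) (at (snd c x) within W)"
    and W: "\<And>\<gamma> h. curve_in c \<gamma> x h \<Longrightarrow> \<forall>\<^sub>F t in nhds 0. snd c (\<gamma> t) \<in> W \<and> g (\<gamma> t) = f (snd c (\<gamma> t))"
  shows "has_cderiv c g D x"
  unfolding has_cderiv_def
proof (intro conjI allI impI)
  show lin: "linear D" using D has_derivative_linear by blast
  fix \<gamma> h assume \<gamma>: "curve_in c \<gamma> x h"
  have x0: "\<gamma> 0 = x" using \<gamma> by (simp add: curve_in_def)
  from W[OF \<gamma>] obtain T where T: "open T" "0 \<in> T"
    "\<And>t. t \<in> T \<Longrightarrow> snd c (\<gamma> t) \<in> W" "\<And>t. t \<in> T \<Longrightarrow> g (\<gamma> t) = f (snd c (\<gamma> t))"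
    by (auto simp: eventually_nhds)
  have 1: "((\<lambda>t. snd c (\<gamma> t)) has_derivative (\<lambda>s. s *\<^sub>R h)) (at 0 within T)"
    using \<gamma> by (simp add: curve_in_def has_vector_derivative_def has_derivative_at_withinI)
  have 2: "(f has_derivative D) (at (snd c (\<gamma> 0)) within (\<lambda>t. snd c (\<gamma> t)) ` T)"
    unfolding x0 by (rule has_derivative_subset[OF D]) (use T in auto)
  have "((\<lambda>t. f (snd c (\<gamma> t))) has_vector_derivative D h) (at 0 within T)"
    using has_derivative_in_compose[OF 1 2] lin
    by (simp add: has_vector_derivative_def linear_scale)
  then have "((\<lambda>t. f (snd c (\<gamma> t))) has_vector_derivative D h) (at 0)"
    using T at_within_open by metis
  moreover have "\<forall>\<^sub>F t in nhds 0. f (snd c (\<gamma> t)) = g (\<gamma> t)"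
    using W[OF \<gamma>] by (auto elim: eventually_mono)
  ultimately show "((\<lambda>t. g (\<gamma> t)) has_vector_derivative D h) (at 0)"
    by (simp add: hvd_cong)
qed

lemma smooth_manifold_chart:
  assumes M: "smooth_manifold X S A" and c: "c \<in> A"
  shows "inj_on (snd c) (fst c)" and "openin (top_of_set S) (snd c ` fst c)"
proof -
  have 1: "openin X (fst c)" "openin (top_of_set S) (snd c ` fst c)"
    "homeomorphic_map (subtopology X (fst c)) (top_of_set (snd c ` fst c)) (snd c)"
    using M c unfolding smooth_manifold_def by auto
  show "openin (top_of_set S) (snd c ` fst c)" by fact
  have "topspace (subtopology X (fst c)) = fst c"
    using openin_subset[OF 1(1)] by auto
  then show "inj_on (snd c) (fst c)" using homeomorphic_imp_injective_map[OF 1(3)] by simp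
qed

lemma smooth_manifold_overlap:
  assumes M: "smooth_manifold X S A" and c: "c \<in> A" "c' \<in> A"
  shows "openin (top_of_set S) (snd c ` (fst c \<inter> fst c'))"
    and "smooth_on S (snd c ` (fst c \<inter> fst c')) (snd c' \<circ> chart_inv c)"
proof -
  have 1: "openin X (fst c)" "openin (top_of_set S) (snd c ` fst c)" "openin X (fst c')"
    "homeomorphic_map (subtopology X (fst c)) (top_of_set (snd c ` fst c)) (snd c)"
    using M c unfolding smooth_manifold_def by auto
  have "openin (subtopology X (fst c)) (fst c \<inter> fst c')"
    using 1 by (metis openin_subtopology_Int inf_commute)
  then have "openin (top_of_set (snd c ` fst c)) (snd c ` (fst c \<inter> fst c'))"
    using homeomorphic_imp_open_map[OF 1(4)] by (simp add: open_map_def)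
  then show "openin (top_of_set S) (snd c ` (fst c \<inter> fst c'))"
    using openin_trans 1(2) by blast
  show "smooth_on S (snd c ` (fst c \<inter> fst c')) (snd c' \<circ> chart_inv c)"
    using M c unfolding smooth_manifold_def by (cases c, cases c') auto
qed

text \<open>Continuity of the curve is known only for its coordinates in \<open>c\<close>. Relative
  openness keeps these in the image of the overlap, and injectivity of the chart brings the
  conclusion back to the manifold.\<close>

lemma smooth_manifold_curve_overlap:
  assumes M: "smooth_manifold X S A" and c: "c \<in> charts_at A x" "c' \<in> charts_at A x"
    and \<gamma>: "curve_in c \<gamma> x h"
  shows "\<forall>\<^sub>F t in nhds 0. \<gamma> t \<in> fst c \<and> \<gamma> t \<in> fst c'"
proof -
  have x: "c \<in> A" "c' \<in> A" "x \<in> fst c \<inter> fst c'" using c by (auto simp: charts_at_def)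
  obtain T where T: "open T" "snd c ` (fst c \<inter> fst c') = S \<inter> T"
    using smooth_manifold_overlap(1)[OF M x(1,2)] by (meson openin_open)
  have S: "snd c ` fst c \<subseteq> S"
    using smooth_manifold_chart(2)[OF M x(1)] openin_imp_subset by blast
  have "snd c (\<gamma> 0) \<in> T" using \<gamma> x(3) T(2) by (auto simp: curve_in_def)
  moreover have "((\<lambda>t. snd c (\<gamma> t)) \<longlongrightarrow> snd c (\<gamma> 0)) (nhds 0)"
    by (rule tendsto_at_iff_tendsto_nhds[THEN iffD1])
      (use has_vector_derivative_continuous[of "\<lambda>t. snd c (\<gamma> t)" h 0 UNIV] \<gamma>
        in \<open>simp add: curve_in_def continuous_at\<close>)
  ultimately have "\<forall>\<^sub>F t in nhds 0. snd c (\<gamma> t) \<in> T"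
    using T(1) by (auto dest: topological_tendstoD)
  moreover have "\<forall>\<^sub>F t in nhds 0. \<gamma> t \<in> fst c" using \<gamma> by (simp add: curve_in_def)
  ultimately show ?thesis
  proof eventually_elim
    case (elim t)
    then have "snd c (\<gamma> t) \<in> snd c ` (fst c \<inter> fst c')" using S unfolding T(2) by blast
    then show ?case
      using elim smooth_manifold_chart(1)[OF M x(1)] by (auto dest: inj_onD)
  qed
qed

text \<open>Two derivatives are extracted: the first moves velocities between charts, the second is
  the one whose symmetry is used. \<open>Ck_on\<close> differentiates directional derivatives one
  direction at a time, so \<open>f''\<close> is indexed by the direction and assembled by
  choice.\<close>

lemma smooth_manifold_transition:
  assumes M: "smooth_manifold X S A" and c: "c \<in> A" "c' \<in> A"
  obtains f' f'' where
    "\<And>y. y \<in> fst c \<inter> fst c' \<Longrightarrow>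
      (snd c' \<circ> chart_inv c has_derivative f' (snd c y)) (at (snd c y) within snd c ` (fst c \<inter> fst c'))"
    "\<And>y h. y \<in> fst c \<inter> fst c' \<Longrightarrow> h \<in> S \<Longrightarrow>
      ((\<lambda>p. f' p h) has_derivative f'' h (snd c y)) (at (snd c y) within snd c ` (fst c \<inter> fst c'))"
proof -
  let ?W = "snd c ` (fst c \<inter> fst c')"
  have "Ck_on (Suc (Suc 0)) S ?W (snd c' \<circ> chart_inv c)"
    using smooth_manifold_overlap(2)[OF M c] unfolding smooth_on_def by blast
  then obtain f' where f': "\<forall>x\<in>?W. (snd c' \<circ> chart_inv c has_derivative f' x) (at x within ?W)"
    and Ck1: "\<forall>h\<in>S. Ck_on (Suc 0) S ?W (\<lambda>x. f' x h)"
    unfolding Ck_on.simps(2)[of "Suc 0"] by (elim exE conjE)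
  have "\<forall>h\<in>S. \<exists>g. \<forall>x\<in>?W. ((\<lambda>x. f' x h) has_derivative g x) (at x within ?W)"
  proof
    fix h assume "h \<in> S"
    with Ck1 have "Ck_on (Suc 0) S ?W (\<lambda>x. f' x h)" by (rule bspec)
    then show "\<exists>g. \<forall>x\<in>?W. ((\<lambda>x. f' x h) has_derivative g x) (at x within ?W)"
      unfolding Ck_on.simps(2)[of 0] by (elim exE conjE) (rule exI)
  qed
  from bchoice[OF this] obtain f'' where
    "\<forall>h\<in>S. \<forall>x\<in>?W. ((\<lambda>x. f' x h) has_derivative f'' h x) (at x within ?W)"
    by blast
  with f' show thesis by (intro that[of f' f'']) auto
qed

lemma smooth_manifold_has_cderiv:
  assumes M: "smooth_manifold X S A" and c: "c \<in> charts_at A x" "c' \<in> charts_at A x"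
    and f: "(f has_derivative D) (at (snd c x) within snd c ` (fst c \<inter> fst c'))"
    and g: "\<And>y. y \<in> fst c \<inter> fst c' \<Longrightarrow> g y = f (snd c y)"
  shows "has_cderiv c g D x"
proof (rule has_cderiv_frechet[OF f])
  fix \<gamma> h assume "curve_in c \<gamma> x h"
  from smooth_manifold_curve_overlap[OF M c this]
  show "\<forall>\<^sub>F t in nhds 0. snd c (\<gamma> t) \<in> snd c ` (fst c \<inter> fst c') \<and> g (\<gamma> t) = f (snd c (\<gamma> t))"
    by eventually_elim (use g in blast)
qed

lemma smooth_manifold_curve_atlas:
  fixes S :: "'e::euclidean_space set"
  assumes M: "smooth_manifold X S A"
  shows "curve_atlas S A"
proof
  show "subspace S" using M by (simp add: smooth_manifold_def)
  show "inj_on (snd c) (fst c)" "openin (top_of_set S) (snd c ` fst c)" if "c \<in> A" for c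
    using smooth_manifold_chart[OF M that] .
  fix c c' x assume c: "c \<in> charts_at A x" "c' \<in> charts_at A x"
  then have x: "c \<in> A" "c' \<in> A" "x \<in> fst c \<inter> fst c'" by (auto simp: charts_at_def)
  show "\<forall>\<^sub>F t in nhds 0. \<gamma> t \<in> fst c'" if "curve_in c \<gamma> x h" for \<gamma> h
    using smooth_manifold_curve_overlap[OF M c that] by (auto elim: eventually_mono)
  obtain f' where f': "\<And>y. y \<in> fst c \<inter> fst c' \<Longrightarrow>
      (snd c' \<circ> chart_inv c has_derivative f' (snd c y)) (at (snd c y) within snd c ` (fst c \<inter> fst c'))"
    by (rule smooth_manifold_transition[OF M x(1,2)]) (rule that)
  have "has_cderiv c (snd c') (f' (snd c x)) x"
    by (rule smooth_manifold_has_cderiv[OF M c f'[OF x(3)]])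
      (use smooth_manifold_chart(1)[OF M x(1)] in \<open>auto simp: chart_inv_def\<close>)
  then show "\<exists>D. has_cderiv c (snd c') D x" by blast
qed

text \<open>In \<open>c'\<close> the coordinate vector with components \<open>h\<close> is the
  Jacobian of the transition map applied to \<open>h\<close>. Hence \<open>T\<close> is the second
  derivative of that map at \<open>x\<close>, symmetric by
  \<open>second_derivative_symmetric\<close>.\<close>

lemma coord_vec_has_cderiv:
  fixes S :: "'e::euclidean_space set"
  assumes M: "smooth_manifold X S A" and c: "c \<in> charts_at A x" "c' \<in> charts_at A x"
  obtains T where "\<And>h. h \<in> S \<Longrightarrow> has_cderiv c (\<lambda>y. coord_vec A c y h c') (T h) x"
    and "\<And>h k. h \<in> S \<Longrightarrow> k \<in> S \<Longrightarrow> T h k = T k h"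
proof -
  interpret curve_atlas S A by (rule smooth_manifold_curve_atlas[OF M])
  have x: "c \<in> A" "c' \<in> A" "x \<in> fst c \<inter> fst c'" using c by (auto simp: charts_at_def)
  let ?W = "snd c ` (fst c \<inter> fst c')"
  obtain f' f'' where f': "\<And>y. y \<in> fst c \<inter> fst c' \<Longrightarrow>
      (snd c' \<circ> chart_inv c has_derivative f' (snd c y)) (at (snd c y) within ?W)"
    and f'': "\<And>y h. y \<in> fst c \<inter> fst c' \<Longrightarrow> h \<in> S \<Longrightarrow>
      ((\<lambda>p. f' p h) has_derivative f'' h (snd c y)) (at (snd c y) within ?W)"
    using smooth_manifold_transition[OF M x(1,2)] by metis
  have eq: "coord_vec A c y h c' = f' (snd c y) h" if y: "y \<in> fst c \<inter> fst c'" and h: "h \<in> S" for y h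
  proof -
    have cy: "c \<in> charts_at A y" "c' \<in> charts_at A y" using x y by (auto simp: charts_at_def)
    have "has_cderiv c (snd c') (f' (snd c y)) y"
      by (rule smooth_manifold_has_cderiv[OF M cy f'[OF y]]) (use x in auto)
    then show ?thesis by (rule coord_vec_apply[OF cy _ h])
  qed
  show thesis
  proof
    show "has_cderiv c (\<lambda>y. coord_vec A c y h c') (f'' h (snd c x)) x" if h: "h \<in> S" for h
      by (rule smooth_manifold_has_cderiv[OF M c f''[OF x(3) h]]) (simp add: eq h)
    show "f'' h (snd c x) k = f'' k (snd c x) h" if hk: "h \<in> S" "k \<in> S" for h k
    proof (rule second_derivative_symmetric[OF subspace smooth_manifold_overlap(1)[OF M x(1,2)] _ hk])
      show "snd c x \<in> ?W" using x by blast
      show "(snd c' \<circ> chart_inv c has_derivative f' p) (at p within ?W)" if "p \<in> ?W" for p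
        using f' that by blast
    qed (use f'' x hk in auto)
  qed
qed

section \<open>Bundles\<close>

text \<open>The common shape of the charts of the tangent bundle and of both exterior bundles;
  \<open>tangent_chart_eq\<close>, \<open>ext_atlas_eq\<close> and \<open>coext_atlas_eq\<close>
  make the identification, so that velocities and their coordinates are treated once for all
  three.\<close>

definition bundle_chart :: "('a \<Rightarrow> 'v set) \<Rightarrow> (('a, 'e) chart \<Rightarrow> 'a \<Rightarrow> 'v \<Rightarrow> 'f) \<Rightarrow> ('a, 'e) chart
    \<Rightarrow> ('a \<times> 'v, 'e \<times> 'f) chart" where
  "bundle_chart Fib \<Phi> c = ({w. fst w \<in> fst c \<and> snd w \<in> Fib (fst w)}, \<lambda>(x, e). (snd c x, \<Phi> c x e))"

lemma hvd_pair_iff: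
  fixes f :: "real \<Rightarrow> 'e::real_normed_vector" and g :: "real \<Rightarrow> 'f::real_normed_vector"
  shows "((\<lambda>t. (f t, g t)) has_vector_derivative (a, b)) (at x)
    \<longleftrightarrow> (f has_vector_derivative a) (at x) \<and> (g has_vector_derivative b) (at x)"
proof
  assume *: "((\<lambda>t. (f t, g t)) has_vector_derivative (a, b)) (at x)"
  show "(f has_vector_derivative a) (at x) \<and> (g has_vector_derivative b) (at x)"
    using bounded_linear.has_vector_derivative[OF bounded_linear_fst *]
      bounded_linear.has_vector_derivative[OF bounded_linear_snd *] by simp
next
  assume "(f has_vector_derivative a) (at x) \<and> (g has_vector_derivative b) (at x)"
  then show "((\<lambda>t. (f t, g t)) has_vector_derivative (a, b)) (at x)"
    by (intro has_vector_derivative_Pair) auto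
qed

lemma curve_in_bundle_chart:
  fixes c :: "('a, 'e::real_normed_vector) chart"
    and \<Phi> :: "('a, 'e) chart \<Rightarrow> 'a \<Rightarrow> 'v \<Rightarrow> 'f::real_normed_vector"
  shows "curve_in (bundle_chart Fib \<Phi> c) \<gamma> w k \<longleftrightarrow>
    \<gamma> 0 = w \<and> (\<forall>\<^sub>F t in nhds 0. snd (\<gamma> t) \<in> Fib (fst (\<gamma> t))) \<and>
    curve_in c (\<lambda>t. fst (\<gamma> t)) (fst w) (fst k) \<and>
    ((\<lambda>t. \<Phi> c (fst (\<gamma> t)) (snd (\<gamma> t))) has_vector_derivative snd k) (at 0)"
proof -
  have "((\<lambda>t. snd (bundle_chart Fib \<Phi> c) (\<gamma> t)) has_vector_derivative k) (at 0) \<longleftrightarrow>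
    ((\<lambda>t. snd c (fst (\<gamma> t))) has_vector_derivative fst k) (at 0) \<and>
    ((\<lambda>t. \<Phi> c (fst (\<gamma> t)) (snd (\<gamma> t))) has_vector_derivative snd k) (at 0)"
    using hvd_pair_iff[of "\<lambda>t. snd c (fst (\<gamma> t))" "\<lambda>t. \<Phi> c (fst (\<gamma> t)) (snd (\<gamma> t))" "fst k" "snd k"]
    by (simp add: bundle_chart_def case_prod_beta)
  moreover have "(\<forall>\<^sub>F t in nhds 0. \<gamma> t \<in> fst (bundle_chart Fib \<Phi> c)) \<longleftrightarrow>
    (\<forall>\<^sub>F t in nhds 0. fst (\<gamma> t) \<in> fst c) \<and> (\<forall>\<^sub>F t in nhds 0. snd (\<gamma> t) \<in> Fib (fst (\<gamma> t)))"
    by (simp add: bundle_chart_def eventually_conj_iff)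
  ultimately show ?thesis unfolding curve_in_def by auto
qed

text \<open>Fibre coordinates change linearly, with coefficients \<open>G b\<close> differentiable
  along the base, so the transition map of the total space is differentiable by the product rule.
  The index \<open>b\<close> runs over the whole type; the applications put zero at indices outside
  the model space.\<close>

lemma bundle_curve_atlas:
  fixes A :: "('a, 'e::euclidean_space) chart set" and F :: "(real, 'm::finite) vec set"
    and \<Phi> :: "('a, 'e) chart \<Rightarrow> 'a \<Rightarrow> 'v \<Rightarrow> (real, 'm) vec"
  assumes A: "curve_atlas S A" and F: "subspace F"
    and bij: "\<And>c x. c \<in> charts_at A x \<Longrightarrow> bij_betw (\<Phi> c x) (Fib x) F"
    and trans: "\<And>c c' x. c \<in> charts_at A x \<Longrightarrow> c' \<in> charts_at A x \<Longrightarrow>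
      \<exists>G. (\<forall>y\<in>fst c \<inter> fst c'. \<forall>e\<in>Fib y. \<Phi> c' y e = (\<Sum>b\<in>UNIV. (\<Phi> c y e $ b) *\<^sub>R G b y)) \<and>
        (\<forall>b. \<exists>D. has_cderiv c (G b) D x)"
  shows "curve_atlas (S \<times> F) (bundle_chart Fib \<Phi> ` A)"
proof -
  interpret curve_atlas S A by fact
  let ?C = "bundle_chart Fib \<Phi>"
  have at: "\<exists>c'. C = ?C c' \<and> c' \<in> charts_at A (fst w) \<and> snd w \<in> Fib (fst w)"
    if C: "C \<in> charts_at (?C ` A) w" for C w
  proof -
    obtain c where "c \<in> A" "C = ?C c" "w \<in> fst (?C c)"
      using C unfolding charts_at_def by blast
    then show ?thesis by (intro exI[of _ c]) (simp add: charts_at_def bundle_chart_def)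
  qed
  show ?thesis
  proof
    show "subspace (S \<times> F)" using subspace F by (rule subspace_Times)
    fix C assume "C \<in> ?C ` A"
    then obtain c where c: "c \<in> A" "C = ?C c" by blast
    have bijc: "bij_betw (\<Phi> c x) (Fib x) F" if "x \<in> fst c" for x
      using bij c that by (simp add: charts_at_def)
    show "inj_on (snd C) (fst C)"
    proof (rule inj_onI)
      fix w w' assume w: "w \<in> fst C" "w' \<in> fst C" and eq: "snd C w = snd C w'"
      obtain x e x' e' where ww: "w = (x, e)" "w' = (x', e')" by fastforce
      have "x = x'" using inj[OF c(1)] w eq by (auto simp: c ww bundle_chart_def dest: inj_onD)
      moreover have "e = e'"
        using bij_betw_imp_inj_on[OF bijc[of x]] w eq \<open>x = x'\<close>
        by (auto simp: c ww bundle_chart_def dest: inj_onD)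
      ultimately show "w = w'" using ww by simp
    qed
    have "snd C ` fst C = (snd c ` fst c) \<times> F"
    proof (intro equalityI subsetI)
      fix z assume "z \<in> snd C ` fst C"
      then show "z \<in> (snd c ` fst c) \<times> F"
        using bij_betwE[OF bijc] by (auto simp: c bundle_chart_def)
    next
      fix z assume z: "z \<in> (snd c ` fst c) \<times> F"
      then obtain x where x: "x \<in> fst c" "fst z = snd c x" "snd z \<in> F" by auto
      then obtain e where "e \<in> Fib x" "\<Phi> c x e = snd z" 
        using bijc[OF x(1)] by (metis bij_betw_imp_surj_on imageE)
      then have "(x, e) \<in> fst C" "snd C (x, e) = z"
        using x by (auto simp: c bundle_chart_def prod_eq_iff)
      then show "z \<in> snd C ` fst C" by (metis imageI)
    qed
    then show "openin (top_of_set (S \<times> F)) (snd C ` fst C)"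
      using openin_Times[OF open_image[OF c(1)], of F F] by simp
  next
    fix C C' w assume CC: "C \<in> charts_at (?C ` A) w" "C' \<in> charts_at (?C ` A) w"
    obtain c where c: "C = ?C c" "c \<in> charts_at A (fst w)" and w: "snd w \<in> Fib (fst w)"
      using at[OF CC(1)] by blast
    obtain c' where c': "C' = ?C c'" "c' \<in> charts_at A (fst w)" using at[OF CC(2)] by blast
    show ev: "\<forall>\<^sub>F t in nhds 0. \<gamma> t \<in> fst C'" if \<gamma>: "curve_in C \<gamma> w k" for \<gamma> k
    proof -
      have "curve_in c (\<lambda>t. fst (\<gamma> t)) (fst w) (fst k)"
        "\<forall>\<^sub>F t in nhds 0. snd (\<gamma> t) \<in> Fib (fst (\<gamma> t))"
        using \<gamma> unfolding c curve_in_bundle_chart by auto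
      from domain_nhd[OF c(2) c'(2) this(1)] this(2) show ?thesis
        by eventually_elim (simp add: c' bundle_chart_def)
    qed
    obtain G where G: "\<And>y e. y \<in> fst c \<Longrightarrow> y \<in> fst c' \<Longrightarrow> e \<in> Fib y \<Longrightarrow>
        \<Phi> c' y e = (\<Sum>b\<in>UNIV. (\<Phi> c y e $ b) *\<^sub>R G b y)"
      and "\<forall>b. \<exists>D. has_cderiv c (G b) D (fst w)"
      using trans[OF c(2) c'(2)] by blast
    then obtain D where D: "\<And>b. has_cderiv c (G b) (D b) (fst w)" by metis
    obtain J where J: "has_cderiv c (snd c') J (fst w)" using transition[OF c(2) c'(2)] by blast
    let ?e = "\<Phi> c (fst w) (snd w)"
    \<comment> \<open>Base component: the derivative of the base transition. Fibre component: the
      product rule at \<open>w\<close> for the sum of \<open>\<Phi> c y e $ b\<close> times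
      \<open>G b y\<close>.\<close>
    let ?D = "\<lambda>k. (J (fst k), \<Sum>b\<in>UNIV. (?e $ b) *\<^sub>R D b (fst k) + (snd k $ b) *\<^sub>R G b (fst w))"
    have "has_cderiv C (snd C') ?D w"
      unfolding has_cderiv_def
    proof (intro conjI allI impI)
      have 1: "linear J" "\<And>b. linear (D b)" using J D by (auto simp: has_cderiv_def)
      show "linear ?D"
        by (rule linearI)
          (simp_all add: linear_add[OF 1(1)] linear_add[OF 1(2)] linear_scale[OF 1(1)]
            linear_scale[OF 1(2)] algebra_simps sum.distrib scaleR_sum_right)
      fix \<gamma> k assume \<gamma>: "curve_in C \<gamma> w k"
      have \<gamma>1: "\<gamma> 0 = w" "curve_in c (\<lambda>t. fst (\<gamma> t)) (fst w) (fst k)"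
        "\<forall>\<^sub>F t in nhds 0. snd (\<gamma> t) \<in> Fib (fst (\<gamma> t))"
        "((\<lambda>t. \<Phi> c (fst (\<gamma> t)) (snd (\<gamma> t))) has_vector_derivative snd k) (at 0)"
        using \<gamma> unfolding c curve_in_bundle_chart by auto
      have "((\<lambda>t. \<Phi> c (fst (\<gamma> t)) (snd (\<gamma> t)) $ b) has_vector_derivative snd k $ b) (at 0)" for b
        using bounded_linear.has_vector_derivative[OF bounded_linear_vec_nth \<gamma>1(4)] .
      then have "((\<lambda>t. \<Sum>b\<in>UNIV. (\<Phi> c (fst (\<gamma> t)) (snd (\<gamma> t)) $ b) *\<^sub>R G b (fst (\<gamma> t)))
        has_vector_derivative snd (?D k)) (at 0)"
        unfolding snd_conv using \<gamma>1(1)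
        by (intro has_vector_derivative_sum)
          (auto intro!: has_vector_derivative_eq_rhs[OF has_vector_derivative_scaleR]
            has_cderivD[OF D \<gamma>1(2)] simp: has_real_derivative_iff_has_vector_derivative)
      moreover have "\<forall>\<^sub>F t in nhds 0. (\<Sum>b\<in>UNIV. (\<Phi> c (fst (\<gamma> t)) (snd (\<gamma> t)) $ b) *\<^sub>R G b (fst (\<gamma> t)))
          = \<Phi> c' (fst (\<gamma> t)) (snd (\<gamma> t))"
        using \<gamma>1(3) domain_nhd[OF c(2) c'(2) \<gamma>1(2)] \<gamma>1(2)[unfolded curve_in_def, THEN conjunct2, THEN conjunct1]
        by eventually_elim (simp add: G)
      ultimately have "((\<lambda>t. \<Phi> c' (fst (\<gamma> t)) (snd (\<gamma> t))) has_vector_derivative snd (?D k)) (at 0)"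
        by (simp add: hvd_cong)
      with has_cderivD[OF J \<gamma>1(2)]
      show "((\<lambda>t. snd C' (\<gamma> t)) has_vector_derivative ?D k) (at 0)"
        by (simp add: c' bundle_chart_def case_prod_beta hvd_pair_iff)
    qed
    then show "\<exists>D. has_cderiv C (snd C') D w" by blast
  qed
qed

text \<open>Coordinates \<open>((x, u), (h, d))\<close> of a tangent vector of the total space:
  \<open>u\<close> is the fibre position, \<open>h\<close> the base velocity, \<open>d\<close> the
  fibre velocity. A relation suits vectors that come from choice operators;
  \<open>coords_unique\<close> and \<open>coords_exists\<close> show that the coordinates determine
  \<open>z\<close> and that all admissible values occur.\<close>

definition bundle_coords where
  "bundle_coords A Fib \<Phi> c x u h d z \<longleftrightarrow> z \<in> tangent_bundle (bundle_chart Fib \<Phi> ` A) \<and>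
     fst (fst z) = x \<and> \<Phi> c x (snd (fst z)) = u \<and> snd z (bundle_chart Fib \<Phi> c) = (h, d)"

locale bundle_atlas = curve_atlas S A
  for S :: "'e::euclidean_space set" and A :: "('a, 'e) chart set" +
  fixes Fib :: "'a \<Rightarrow> 'v set" and \<Phi> :: "('a, 'e) chart \<Rightarrow> 'a \<Rightarrow> 'v \<Rightarrow> (real, 'm::finite) vec"
    and F :: "(real, 'm) vec set"
  assumes total_atlas: "curve_atlas (S \<times> F) (bundle_chart Fib \<Phi> ` A)"
    and bij_fibre: "c \<in> charts_at A x \<Longrightarrow> bij_betw (\<Phi> c x) (Fib x) F"
begin

abbreviation "E \<equiv> bundle_chart Fib \<Phi> ` A"
abbreviation "C \<equiv> bundle_chart Fib \<Phi>"
abbreviation "coords \<equiv> bundle_coords A Fib \<Phi>"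

sublocale total: curve_atlas "S \<times> F" E
  by (rule total_atlas)

lemma chart_at: "c \<in> charts_at A x \<Longrightarrow> e \<in> Fib x \<Longrightarrow> C c \<in> charts_at E (x, e)"
  unfolding charts_at_def by (auto simp: bundle_chart_def)

lemma tangent_space_fibre:
  assumes "v \<in> tangent_space E (x, e)"
  shows "e \<in> Fib x" and "charts_at A x \<noteq> {}"
  using total.tangent_space_points[OF assms] unfolding points_def charts_at_def
  by (auto simp: bundle_chart_def)

lemma coordsD:
  assumes c: "c \<in> charts_at A x" and z: "coords c x u h d z"
  obtains e v where "z = ((x, e), v)" "v \<in> tangent_space E (x, e)" "v (C c) = (h, d)"
    "e \<in> Fib x" "\<Phi> c x e = u" "C c \<in> charts_at E (x, e)"
proof -
  obtain e v where z': "z = ((x, e), v)" using z by (cases z) (auto simp: bundle_coords_def)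
  then have v: "v \<in> tangent_space E (x, e)" using z by (simp add: bundle_coords_def tangent_bundle_iff)
  note e = tangent_space_fibre(1)[OF v]
  show thesis
    by (rule that[OF z' v _ e _ chart_at[OF c e]]) (use z z' in \<open>auto simp: bundle_coords_def\<close>)
qed

lemma coords_unique:
  assumes c: "c \<in> charts_at A x" and z: "coords c x u h d z" "coords c x u h d z'"
  shows "z = z'"
proof -
  obtain e v where 1: "z = ((x, e), v)" "v \<in> tangent_space E (x, e)" "v (C c) = (h, d)"
    "e \<in> Fib x" "\<Phi> c x e = u" "C c \<in> charts_at E (x, e)"
    by (rule coordsD[OF c z(1)])
  obtain e' v' where 2: "z' = ((x, e'), v')" "v' \<in> tangent_space E (x, e')" "v' (C c) = (h, d)"
    "e' \<in> Fib x" "\<Phi> c x e' = u"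
    by (rule coordsD[OF c z(2)])
  have "e = e'" using bij_betw_imp_inj_on[OF bij_fibre[OF c]] 1 2 by (metis inj_onD)
  moreover have "v = v'" using total.tangent_space_eqI[OF 1(6,2)] 1 2 \<open>e = e'\<close> by simp
  ultimately show ?thesis using 1 2 by simp
qed

lemma coords_exists:
  assumes c: "c \<in> charts_at A x" and "u \<in> F" "h \<in> S" "d \<in> F"
  shows "\<exists>z. coords c x u h d z"
proof -
  obtain e where e: "e \<in> Fib x" "\<Phi> c x e = u"
    using bij_betw_imp_surj_on[OF bij_fibre[OF c]] assms(2) by (metis imageE)
  have hd: "(h, d) \<in> S \<times> F" using assms by simp
  note C = chart_at[OF c e(1)]
  have "coords c x u h d ((x, e), coord_vec E (C c) (x, e) (h, d))"
    unfolding bundle_coords_def using e total.coord_vec_in[OF C hd] total.coord_vec_self[OF C hd]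
    by (simp add: tangent_bundle_iff)
  then show ?thesis by blast
qed

lemma coords_curveI:
  assumes c: "c \<in> charts_at A x" and \<gamma>: "curve_in (C c) \<gamma> (x, e) (h, d)"
  shows "coords c x (\<Phi> c x e) h d (velocity E \<gamma>)"
proof -
  have "\<forall>\<^sub>F t in nhds 0. snd (\<gamma> t) \<in> Fib (fst (\<gamma> t))" "\<gamma> 0 = (x, e)"
    using \<gamma> unfolding curve_in_bundle_chart by auto
  then have e: "e \<in> Fib x" using eventually_nhds_x_imp_x by fastforce
  note C = chart_at[OF c e]
  have hd: "(h, d) \<in> S \<times> F"
    by (rule total.curve_in_S[OF _ \<gamma>]) (use C in \<open>simp add: charts_at_def\<close>)
  show ?thesis
    unfolding total.velocity_curve_in(2)[OF C \<gamma>] bundle_coords_def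
    using total.coord_vec_in[OF C hd] total.coord_vec_self[OF C hd] by (simp add: tangent_bundle_iff)
qed

lemma coords_curveD:
  assumes c: "c \<in> charts_at A x" and z: "coords c x u h d z"
    and \<gamma>: "curve_at0 E \<gamma>" "velocity E \<gamma> = z"
  shows "curve_in (C c) \<gamma> (fst z) (h, d)"
proof -
  obtain e v where 1: "z = ((x, e), v)" "v (C c) = (h, d)" "C c \<in> charts_at E (x, e)"
    by (rule coordsD[OF c z])
  show ?thesis using total.curve_at0_curve_in[OF \<gamma>[unfolded 1(1)] 1(3)] 1 by simp
qed

text \<open>A straight line in the chart of the total space projects to the straight line with
  velocity \<open>h\<close> in the base chart. Vectors with the same base velocity hence have
  representatives over one base curve, which makes the choices in \<open>tangent_map_fibred\<close>
  and \<open>tangent_pairing\<close> possible.\<close>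

lemma coords_curve:
  assumes c: "c \<in> charts_at A x" and z: "coords c x u h d z"
  shows "\<exists>\<gamma>. curve_at0 E \<gamma> \<and> velocity E \<gamma> = z \<and>
    (\<forall>\<^sub>F t in nhds 0. fst (\<gamma> t) = chart_inv c (snd c x + t *\<^sub>R h))"
proof -
  have cA: "c \<in> A" using c by (simp add: charts_at_def)
  obtain e v where 1: "z = ((x, e), v)" "v \<in> tangent_space E (x, e)" "v (C c) = (h, d)"
    "C c \<in> charts_at E (x, e)"
    by (rule coordsD[OF c z])
  let ?l = "\<lambda>t. chart_inv (C c) (snd (C c) (x, e) + t *\<^sub>R v (C c))"
  note l = total.curve_in_line[OF 1(4) total.coords_in_S[OF 1(4,2)]]
  have "\<forall>\<^sub>F t in nhds 0. ?l t \<in> fst (C c)" using l(1) by (simp add: curve_in_def)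
  then have "\<forall>\<^sub>F t in nhds 0. fst (?l t) = chart_inv c (snd c x + t *\<^sub>R h)"
    using l(2)
  proof eventually_elim
    case (elim t)
    then have "fst (?l t) \<in> fst c" by (simp add: bundle_chart_def)
    moreover have "snd c (fst (?l t)) = snd c x + t *\<^sub>R h"
      using arg_cong[OF elim(2), of fst] 1(3) by (simp add: bundle_chart_def case_prod_beta)
    ultimately show ?case using cA chart_inv_chart by metis
  qed
  moreover have "curve_at0 E ?l" "velocity E ?l = z"
    using total.velocity_curve_in[OF 1(4) l(1)] total.coord_vec_coords[OF 1(4,2)] 1(1) by auto
  ultimately show ?thesis by blast
qed

lemma tangent_map_projection:
  assumes c: "c \<in> charts_at A x" and v: "v \<in> tangent_space E (x, e)"
  shows "tangent_map E A fst ((x, e), v) = (x, coord_vec A c x (fst (v (C c))))"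
proof -
  have C: "C c \<in> charts_at E (x, e)" by (rule chart_at[OF c tangent_space_fibre(1)[OF v]])
  have D: "has_cderiv (C c) (\<lambda>y. snd c (fst y)) fst (x, e)"
    unfolding has_cderiv_def
  proof (intro conjI allI impI)
    show "linear (fst :: 'e \<times> (real, 'm) vec \<Rightarrow> 'e)"
      by (simp add: bounded_linear.linear bounded_linear_fst)
    fix \<gamma> h assume "curve_in (C c) \<gamma> (x, e) h"
    then have "curve_in c (\<lambda>t. fst (\<gamma> t)) x (fst h)" unfolding curve_in_bundle_chart by simp
    then show "((\<lambda>t. snd c (fst (\<gamma> t))) has_vector_derivative fst h) (at 0)" by (simp add: curve_in_def)
  qed
  have "fst y \<in> fst c" if "y \<in> fst (C c)" for y using that by (simp add: bundle_chart_def)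
  with tangent_map_eq[OF total_atlas curve_atlas_axioms C _ v _ D] c show ?thesis by simp
qed

lemma coords_base:
  assumes c: "c \<in> charts_at A x" and z: "coords c x u h d z"
  shows "tangent_map E A fst z = (x, coord_vec A c x h)"
  by (rule coordsD[OF c z]) (simp add: tangent_map_projection[OF c])

text \<open>Membership and projection are what \<open>is_kappa_pow\<close> guarantees for an
  arbitrary value; here they become coordinates with a known base velocity.\<close>

lemma coords_of:
  assumes c: "c \<in> charts_at A x" and z: "z \<in> tangent_bundle E" and q: "tangent_map E A fst z = (x, q)"
  shows "\<exists>u d. coords c x u (q c) d z"
proof -
  obtain x' e v where z': "z = ((x', e), v)" and v: "v \<in> tangent_space E (x', e)"
    using z by (metis surj_pair tangent_bundle_iff)
  obtain c' where "c' \<in> charts_at A x'" using tangent_space_fibre(2)[OF v] by blast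
  from tangent_map_projection[OF this v] q have x: "x' = x" by (simp add: z')
  note v = v[unfolded x]
  have "fst (v (C c)) \<in> S"
    using total.coords_in_S[OF chart_at[OF c tangent_space_fibre(1)[OF v]] v] by (auto simp: mem_Times_iff)
  then have "q c = fst (v (C c))" using tangent_map_projection[OF c v] q coord_vec_self[OF c, of "fst (v (C c))"]
    by (simp add: z' x)
  then have "coords c x (\<Phi> c x e) (q c) (snd (v (C c))) z"
    using z by (simp add: bundle_coords_def z' x)
  then show ?thesis by blast
qed

end

section \<open>Alternating forms\<close>

lemma tuplesD: "vs \<in> tuples r V \<Longrightarrow> length vs = r" "vs \<in> tuples r V \<Longrightarrow> v \<in> set vs \<Longrightarrow> v \<in> V"
  by (auto simp: tuples_def)

lemma tuples_nth: "vs \<in> tuples r V \<Longrightarrow> j < r \<Longrightarrow> vs ! j \<in> V"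
  by (auto simp: tuples_def)

lemma tuples_update: "vs \<in> tuples r V \<Longrightarrow> a \<in> V \<Longrightarrow> vs[j := a] \<in> tuples r V"
  using set_update_subset_insert by (fastforce simp: tuples_def)

lemma tuples_map: "vs \<in> tuples r V \<Longrightarrow> (\<And>v. v \<in> V \<Longrightarrow> L v \<in> W) \<Longrightarrow> map L vs \<in> tuples r W"
  by (auto simp: tuples_def)

lemma tuples_0 [simp]: "tuples 0 V = {[]}"
  by (auto simp: tuples_def)

lemma tuples_Cons [simp]: "v # vs \<in> tuples (Suc r) V \<longleftrightarrow> v \<in> V \<and> vs \<in> tuples r V"
  by (auto simp: tuples_def)

lemma tuples_append: "us \<in> tuples i V \<Longrightarrow> vs \<in> tuples k V \<Longrightarrow> us @ vs \<in> tuples (i + k) V"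
  by (auto simp: tuples_def)

lemma tuples_append_iff: "vs \<in> tuples k V \<Longrightarrow> us @ vs \<in> tuples (i + k) V \<longleftrightarrow> us \<in> tuples i V"
  "us \<in> tuples i V \<Longrightarrow> us @ vs \<in> tuples (i + k) V \<longleftrightarrow> vs \<in> tuples k V"
  by (auto simp: tuples_def)

lemma alt_formsI:
  assumes "\<And>vs. vs \<notin> tuples r V \<Longrightarrow> \<alpha> vs = 0"
    and "\<And>vs j a b s t. vs \<in> tuples r V \<Longrightarrow> j < r \<Longrightarrow> a \<in> V \<Longrightarrow> b \<in> V \<Longrightarrow>
      \<alpha> (vs[j := s *\<^sub>R a + t *\<^sub>R b]) = s * \<alpha> (vs[j := a]) + t * \<alpha> (vs[j := b])"
    and "\<And>vs j k. vs \<in> tuples r V \<Longrightarrow> j < r \<Longrightarrow> k < r \<Longrightarrow> j \<noteq> k \<Longrightarrow> vs ! j = vs ! k \<Longrightarrow> \<alpha> vs = 0"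
  shows "\<alpha> \<in> alt_forms r V"
  using assms unfolding alt_forms_def by blast

lemma alt_form_outside: "\<alpha> \<in> alt_forms r V \<Longrightarrow> vs \<notin> tuples r V \<Longrightarrow> \<alpha> vs = 0"
  by (simp add: alt_forms_def)

lemma alt_form_lin: "\<alpha> \<in> alt_forms r V \<Longrightarrow> vs \<in> tuples r V \<Longrightarrow> j < r \<Longrightarrow> a \<in> V \<Longrightarrow> b \<in> V \<Longrightarrow>
      \<alpha> (vs[j := s *\<^sub>R a + t *\<^sub>R b]) = s * \<alpha> (vs[j := a]) + t * \<alpha> (vs[j := b])"
  by (simp add: alt_forms_def)

lemma alt_form_alt: "\<alpha> \<in> alt_forms r V \<Longrightarrow> vs \<in> tuples r V \<Longrightarrow> j < r \<Longrightarrow> k < r \<Longrightarrow> j \<noteq> k \<Longrightarrow>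
      vs ! j = vs ! k \<Longrightarrow> \<alpha> vs = 0"
  unfolding alt_forms_def by blast

lemma alt_forms_sum:
  assumes "\<And>i. i \<in> J \<Longrightarrow> \<alpha> i \<in> alt_forms r V"
  shows "(\<lambda>vs. \<Sum>i\<in>J. a i * \<alpha> i vs) \<in> alt_forms r V"
proof (rule alt_formsI)
  fix vs j x y s t assume *: "vs \<in> tuples r V" "j < r" "x \<in> V" "y \<in> V"
  have "(\<Sum>i\<in>J. a i * \<alpha> i (vs[j := s *\<^sub>R x + t *\<^sub>R y]))
      = (\<Sum>i\<in>J. s * (a i * \<alpha> i (vs[j := x])) + t * (a i * \<alpha> i (vs[j := y])))"
    by (rule sum.cong) (simp_all add: alt_form_lin[OF assms *] algebra_simps)
  then show "(\<Sum>i\<in>J. a i * \<alpha> i (vs[j := s *\<^sub>R x + t *\<^sub>R y]))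
      = s * (\<Sum>i\<in>J. a i * \<alpha> i (vs[j := x])) + t * (\<Sum>i\<in>J. a i * \<alpha> i (vs[j := y]))"
    by (simp add: sum.distrib sum_distrib_left)
next
  fix vs j k assume *: "vs \<in> tuples r V" "j < r" "k < r" "j \<noteq> k" "vs ! j = vs ! k"
  show "(\<Sum>i\<in>J. a i * \<alpha> i vs) = 0" by (simp add: alt_form_alt[OF assms *])
qed (simp add: alt_form_outside[OF assms])

lemma alt_forms_lin2:
  assumes "\<alpha> \<in> alt_forms r V" "\<beta> \<in> alt_forms r V"
  shows "(\<lambda>vs. s * \<alpha> vs + t * \<beta> vs) \<in> alt_forms r V"
  using alt_forms_sum[of "{True, False}" "\<lambda>b. if b then \<alpha> else \<beta>" r V "\<lambda>b. if b then s else t"] assms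
  by simp

lemma alt_forms_diff:
  assumes "\<alpha> \<in> alt_forms r V" "\<beta> \<in> alt_forms r V"
  shows "(\<lambda>vs. \<alpha> vs - \<beta> vs) \<in> alt_forms r V"
  using alt_forms_lin2[OF assms, of 1 "- 1"] by simp

lemma alt_forms_pullback:
  assumes \<alpha>: "\<alpha> \<in> alt_forms r W" and V: "subspace V" and L: "\<And>v. v \<in> V \<Longrightarrow> L v \<in> W"
    and lin: "\<And>a b s t. a \<in> V \<Longrightarrow> b \<in> V \<Longrightarrow> L (s *\<^sub>R a + t *\<^sub>R b) = s *\<^sub>R L a + t *\<^sub>R L b"
  shows "(\<lambda>vs. if vs \<in> tuples r V then \<alpha> (map L vs) else 0) \<in> alt_forms r V"
proof (rule alt_formsI)
  fix vs j a b s t assume *: "vs \<in> tuples r V" "j < r" "a \<in> V" "b \<in> V"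
  then have "s *\<^sub>R a + t *\<^sub>R b \<in> V" using V by (simp add: subspace_add subspace_scale)
  then show "(if vs[j := s *\<^sub>R a + t *\<^sub>R b] \<in> tuples r V then \<alpha> (map L (vs[j := s *\<^sub>R a + t *\<^sub>R b])) else 0)
     = s * (if vs[j := a] \<in> tuples r V then \<alpha> (map L (vs[j := a])) else 0)
     + t * (if vs[j := b] \<in> tuples r V then \<alpha> (map L (vs[j := b])) else 0)"
    using * alt_form_lin[OF \<alpha> tuples_map[OF *(1) L] *(2) L L]
    by (simp add: tuples_update map_update lin)
next
  fix vs j k assume *: "vs \<in> tuples r V" "j < r" "k < r" "j \<noteq> k" "vs ! j = vs ! k"
  then show "(if vs \<in> tuples r V then \<alpha> (map L vs) else 0) = 0"
    using alt_form_alt[OF \<alpha> tuples_map[OF *(1) L] *(2,3,4)] by (simp add: tuplesD)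
qed simp

lemma alt_forms_append:
  assumes \<omega>: "\<omega> \<in> alt_forms (i + k) V"
  shows "vs \<in> tuples k V \<Longrightarrow> (\<lambda>us. \<omega> (us @ vs)) \<in> alt_forms i V"
    and "us \<in> tuples i V \<Longrightarrow> (\<lambda>vs. \<omega> (us @ vs)) \<in> alt_forms k V"
proof -
  assume vs: "vs \<in> tuples k V"
  show "(\<lambda>us. \<omega> (us @ vs)) \<in> alt_forms i V"
  proof (rule alt_formsI)
    fix us assume "us \<notin> tuples i V"
    then show "\<omega> (us @ vs) = 0" using alt_form_outside[OF \<omega>] tuples_append_iff(1)[OF vs] by blast
  next
    fix us j a b s t assume *: "us \<in> tuples i V" "j < i" "a \<in> V" "b \<in> V"
    then show "\<omega> (us[j := s *\<^sub>R a + t *\<^sub>R b] @ vs) = s * \<omega> (us[j := a] @ vs) + t * \<omega> (us[j := b] @ vs)"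
      using alt_form_lin[OF \<omega> tuples_append[OF *(1) vs], of j a b s t]
      by (simp add: list_update_append tuplesD)
  next
    fix us j l assume *: "us \<in> tuples i V" "j < i" "l < i" "j \<noteq> l" "us ! j = us ! l"
    then show "\<omega> (us @ vs) = 0"
      using alt_form_alt[OF \<omega> tuples_append[OF *(1) vs], of j l] by (simp add: nth_append tuplesD)
  qed
next
  assume us: "us \<in> tuples i V"
  show "(\<lambda>vs. \<omega> (us @ vs)) \<in> alt_forms k V"
  proof (rule alt_formsI)
    fix vs assume "vs \<notin> tuples k V"
    then show "\<omega> (us @ vs) = 0" using alt_form_outside[OF \<omega>] tuples_append_iff(2)[OF us] by blast
  next
    fix vs j a b s t assume *: "vs \<in> tuples k V" "j < k" "a \<in> V" "b \<in> V"
    then show "\<omega> (us @ vs[j := s *\<^sub>R a + t *\<^sub>R b]) = s * \<omega> (us @ vs[j := a]) + t * \<omega> (us @ vs[j := b])"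
      using alt_form_lin[OF \<omega> tuples_append[OF us *(1)], of "i + j" a b s t] us
      by (simp add: list_update_append tuplesD)
  next
    fix vs j l assume *: "vs \<in> tuples k V" "j < k" "l < k" "j \<noteq> l" "vs ! j = vs ! l"
    then show "\<omega> (us @ vs) = 0"
      using alt_form_alt[OF \<omega> tuples_append[OF us *(1)], of "i + j" "i + l"] us
      by (simp add: nth_append tuplesD)
  qed
qed

text \<open>Multilinearity and alternation are linear identities between values of the form, and
  these survive differentiation in the parameter.\<close>

lemma alt_forms_derivative:
  assumes F: "\<And>t::real. F t \<in> alt_forms r V"
    and G: "\<And>vs. ((\<lambda>t. F t vs) has_vector_derivative G vs) (at 0)"
  shows "G \<in> alt_forms r V"
proof (rule alt_formsI)
  fix vs assume "vs \<notin> tuples r V"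
  then have "F t vs = 0" for t using F alt_form_outside by blast
  then show "G vs = 0" using vector_derivative_unique_at[OF G[of vs], of 0] by simp
next
  fix vs j a b s t assume *: "vs \<in> tuples r V" "j < r" "a \<in> V" "b \<in> V"
  have "((\<lambda>\<tau>. F \<tau> (vs[j := s *\<^sub>R a + t *\<^sub>R b])) has_vector_derivative
      s * G (vs[j := a]) + t * G (vs[j := b])) (at 0)"
    unfolding alt_form_lin[OF F *]
    by (intro has_vector_derivative_add has_vector_derivative_mult_right G)
  then show "G (vs[j := s *\<^sub>R a + t *\<^sub>R b]) = s * G (vs[j := a]) + t * G (vs[j := b])"
    by (rule vector_derivative_unique_at[OF G])
next
  fix vs j k assume *: "vs \<in> tuples r V" "j < r" "k < r" "j \<noteq> k" "vs ! j = vs ! k"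
  then have "F t vs = 0" for t using F alt_form_alt by blast
  then show "G vs = 0" using vector_derivative_unique_at[OF G[of vs], of 0] by simp
qed

lemma alt_form_update_sum:
  assumes \<alpha>: "\<alpha> \<in> alt_forms r V" and V: "subspace V" and vs: "vs \<in> tuples r V" "j < r"
    and J: "finite J" "\<And>i. i \<in> J \<Longrightarrow> a i \<in> V"
  shows "\<alpha> (vs[j := \<Sum>i\<in>J. s i *\<^sub>R a i]) = (\<Sum>i\<in>J. s i * \<alpha> (vs[j := a i]))"
  using J
proof (induction J)
  case empty
  show ?case using alt_form_lin[OF \<alpha> vs, of 0 0 0 0] subspace_0[OF V] by simp
next
  case (insert i J)
  have "(\<Sum>i\<in>J. s i *\<^sub>R a i) \<in> V" using V insert by (simp add: subspace_sum subspace_scale)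
  then show ?case
    using insert alt_form_lin[OF \<alpha> vs, of "a i" "\<Sum>i\<in>J. s i *\<^sub>R a i" "s i" 1] by simp
qed

lemma alt_form_middle_lin:
  assumes "\<alpha> \<in> alt_forms r V" "us @ a # vs \<in> tuples r V" "b \<in> V"
  shows "\<alpha> (us @ (s *\<^sub>R a + t *\<^sub>R b) # vs) = s * \<alpha> (us @ a # vs) + t * \<alpha> (us @ b # vs)"
  using alt_form_lin[OF assms(1,2), of "length us" a b s t] assms by (auto simp: tuples_def)

text \<open>Polarisation: expand the vanishing value on two adjacent entries
  \<open>a + b\<close>.\<close>

lemma alt_form_swap:
  assumes \<alpha>: "\<alpha> \<in> alt_forms r V" and V: "subspace V" and vs: "us @ a # b # vs \<in> tuples r V"
  shows "\<alpha> (us @ b # a # vs) = - \<alpha> (us @ a # b # vs)"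
proof -
  have ab: "a \<in> V" "b \<in> V" "a + b \<in> V" using vs subspace_add[OF V] by (auto simp: tuples_def)
  have T: "us @ x # y # vs \<in> tuples r V" if "x \<in> V" "y \<in> V" for x y
    using vs that by (auto simp: tuples_def)
  have eq: "\<alpha> (us @ x # x # vs) = 0" if "x \<in> V" for x
    using alt_form_alt[OF \<alpha> T[OF that that], of "length us" "Suc (length us)"] T[OF that that]
    by (auto simp: tuples_def nth_append)
  have l1: "\<alpha> (us @ (a + b) # y # vs) = \<alpha> (us @ a # y # vs) + \<alpha> (us @ b # y # vs)" if "y \<in> V" for y
    using alt_form_middle_lin[OF \<alpha>, of us a "y # vs" b 1 1] T ab that by simp
  have l2: "\<alpha> (us @ x # (a + b) # vs) = \<alpha> (us @ x # a # vs) + \<alpha> (us @ x # b # vs)" if "x \<in> V" for x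
    using alt_form_middle_lin[OF \<alpha>, of "us @ [x]" a vs b 1 1] T ab that by simp
  show ?thesis
    using eq[OF ab(3)] l1[OF ab(3)] l2[OF ab(1)] l2[OF ab(2)] eq[OF ab(1)] eq[OF ab(2)] by simp
qed

lemma alt_form_to_front:
  assumes \<alpha>: "\<alpha> \<in> alt_forms r V" and V: "subspace V" and vs: "us @ a # vs \<in> tuples r V"
  shows "\<alpha> (us @ a # vs) = (- 1) ^ length us * \<alpha> (a # us @ vs)"
  using vs
proof (induction us arbitrary: vs rule: rev_induct)
  case (snoc b us)
  have "us @ a # b # vs \<in> tuples r V" using snoc.prems by (auto simp: tuples_def)
  with alt_form_swap[OF \<alpha> V this] snoc.IH[OF this] show ?case by simp
qed simp

section \<open>Multivectors as functionals on forms\<close>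

text \<open>A multivector is just a function on forms, so its linearity has to be proved: for fixed
  forms it is a linear condition on \<open>U\<close>, and decomposable multivectors are
  evaluations.\<close>

lemma ext_power_linear:
  assumes U: "U \<in> ext_power r V" and \<alpha>: "\<And>i. i \<in> J \<Longrightarrow> \<alpha> i \<in> alt_forms r V"
  shows "U (\<lambda>vs. \<Sum>i\<in>J. a i * \<alpha> i vs) = (\<Sum>i\<in>J. a i * U (\<alpha> i))"
  using U unfolding ext_power_def
proof (rule span_induct)
  show "subspace {U. U (\<lambda>vs. \<Sum>i\<in>J. a i * \<alpha> i vs) = (\<Sum>i\<in>J. a i * U (\<alpha> i))}"
    by (rule subspaceI)
      (auto simp: scaleR_fun_def sum.distrib sum_distrib_left algebra_simps)
  fix U assume "U \<in> wedge r V ` tuples r V"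
  then show "U (\<lambda>vs. \<Sum>i\<in>J. a i * \<alpha> i vs) = (\<Sum>i\<in>J. a i * U (\<alpha> i))"
    using alt_forms_sum[where \<alpha> = \<alpha> and J = J and a = a, OF \<alpha>] \<alpha> by (auto simp: wedge_def intro!: sum.cong)
qed

text \<open>Equality of multivectors is equality of functions, hence also requires agreement off
  \<open>alt_forms\<close>.\<close>

lemma ext_power_outside:
  assumes U: "U \<in> ext_power r V" and \<alpha>: "\<alpha> \<notin> alt_forms r V"
  shows "U \<alpha> = 0"
  using U unfolding ext_power_def
proof (rule span_induct)
  show "subspace {U. U \<alpha> = (0::real)}"
    by (rule subspaceI) (auto simp: scaleR_fun_def)
qed (use \<alpha> in \<open>auto simp: wedge_def\<close>)

lemma wedge_in_ext_power: "vs \<in> tuples r V \<Longrightarrow> wedge r V vs \<in> ext_power r V"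
  by (simp add: ext_power_def span_base)

lemma subspace_ext_power: "subspace (ext_power r V)"
  by (simp add: ext_power_def)

lemma ext_power_lin2:
  assumes U: "U \<in> ext_power r V" and "\<alpha> \<in> alt_forms r V" "\<beta> \<in> alt_forms r V"
  shows "U (\<lambda>vs. s * \<alpha> vs + t * \<beta> vs) = s * U \<alpha> + t * U \<beta>"
  using ext_power_linear[OF U, of "{True, False}" "\<lambda>b. if b then \<alpha> else \<beta>" "\<lambda>b. if b then s else t"] assms
  by simp

lemma ext_power_zero: "U \<in> ext_power r V \<Longrightarrow> U (\<lambda>_. 0) = 0"
  using ext_power_linear[of U r V "{}"] by simp

lemma alt_form_append_outside:
  assumes "\<omega> \<in> alt_forms (i + k) V" "vs \<in> tuples k V" "us \<notin> tuples i V"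
  shows "\<omega> (us @ vs) = 0"
  using alt_form_outside[OF assms(1)] tuples_append_iff(1)[OF assms(2)] assms(3) by blast

lemma wedge_prod_wedge:
  assumes \<omega>: "\<omega> \<in> alt_forms (i + k) V" and vs: "vs \<in> tuples k V"
  shows "wedge_prod (i + k) V u (wedge k V vs) \<omega> = u (\<lambda>us. \<omega> (us @ vs))"
proof -
  have "wedge k V vs (\<lambda>vs. \<omega> (us @ vs)) = \<omega> (us @ vs)" for us
    using alt_forms_append(2)[OF \<omega>, of us] alt_form_append_outside[OF \<omega> vs, of us]
    by (auto simp: wedge_def)
  then show ?thesis using \<omega> by (simp add: wedge_prod_def)
qed

lemma contracted_form_in:
  assumes \<omega>: "\<omega> \<in> alt_forms (i + k) V" and V: "subspace V" and u: "u \<in> ext_power i V"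
  shows "(\<lambda>vs. if vs \<in> tuples k V then u (\<lambda>us. \<omega> (us @ vs)) else 0) \<in> alt_forms k V"
proof (rule alt_formsI)
  fix vs j a b s t assume *: "vs \<in> tuples k V" "j < k" "a \<in> V" "b \<in> V"
  have t: "vs[j := a] \<in> tuples k V" "vs[j := b] \<in> tuples k V" "vs[j := s *\<^sub>R a + t *\<^sub>R b] \<in> tuples k V"
    using * V by (auto intro!: tuples_update subspace_add subspace_scale)
  have "(\<lambda>us. \<omega> (us @ vs[j := s *\<^sub>R a + t *\<^sub>R b])) = (\<lambda>us. s * \<omega> (us @ vs[j := a]) + t * \<omega> (us @ vs[j := b]))"
  proof
    fix us
    show "\<omega> (us @ vs[j := s *\<^sub>R a + t *\<^sub>R b]) = s * \<omega> (us @ vs[j := a]) + t * \<omega> (us @ vs[j := b])"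
    proof (cases "us \<in> tuples i V")
      case True
      then show ?thesis using alt_form_lin[OF alt_forms_append(2)[OF \<omega> True] *] by simp
    qed (simp add: alt_form_append_outside[OF \<omega> t(1)] alt_form_append_outside[OF \<omega> t(2)]
        alt_form_append_outside[OF \<omega> t(3)])
  qed
  then show "(if vs[j := s *\<^sub>R a + t *\<^sub>R b] \<in> tuples k V then u (\<lambda>us. \<omega> (us @ vs[j := s *\<^sub>R a + t *\<^sub>R b])) else 0) =
      s * (if vs[j := a] \<in> tuples k V then u (\<lambda>us. \<omega> (us @ vs[j := a])) else 0) +
      t * (if vs[j := b] \<in> tuples k V then u (\<lambda>us. \<omega> (us @ vs[j := b])) else 0)"
    using t ext_power_lin2[OF u alt_forms_append(1)[OF \<omega> t(1)] alt_forms_append(1)[OF \<omega> t(2)]] by simp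
next
  fix vs j l assume *: "vs \<in> tuples k V" "j < k" "l < k" "j \<noteq> l" "vs ! j = vs ! l"
  have "\<omega> (us @ vs) = 0" for us
    using alt_form_alt[OF alt_forms_append(2)[OF \<omega>, of us] *] alt_form_append_outside[OF \<omega> *(1), of us]
    by blast
  then show "(if vs \<in> tuples k V then u (\<lambda>us. \<omega> (us @ vs)) else 0) = 0"
    using ext_power_zero[OF u] by simp
qed simp

section \<open>Minors and the standard basis of alternating forms\<close>

text \<open>The Leibniz formula for the determinant formed by the columns \<open>B\<close> of the
  matrix with rows \<open>hs\<close>; it is \<open>coord_form\<close> in pure coordinates, without
  the restriction to tuples.\<close>

definition dxf :: "'n::{finite,linorder} set \<Rightarrow> (real, 'n) vec list \<Rightarrow> real" where
  "dxf B hs = (\<Sum>p | p permutes {..<card B}. of_int (sign p) *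
     (\<Prod>k<card B. (hs ! k) $ (sorted_list_of_set B ! p k)))"

abbreviation basis_tuple :: "'n::{finite,linorder} set \<Rightarrow> (real, 'n) vec list" where
  "basis_tuple B \<equiv> map (\<lambda>b. axis b 1) (sorted_list_of_set B)"

text \<open>Each summand contains exactly one factor from slot \<open>j\<close>. If two entries
  agree, composing with the transposition of their slots flips the sign and keeps the product, so
  the sum equals its own negative.\<close>

lemma dxf_in_alt_forms:
  "(\<lambda>hs. if hs \<in> tuples (card B) UNIV then dxf B hs else 0) \<in> alt_forms (card B) UNIV"
proof (rule alt_formsI)
  let ?b = "\<lambda>p k. sorted_list_of_set B ! p k"
  let ?n = "card B"
  fix hs :: "(real, 'a) vec list" and j a b s t
  assume *: "hs \<in> tuples ?n UNIV" "j < ?n"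
  have len: "length hs = ?n" using * by (simp add: tuples_def)
  have split: "(\<Prod>k<?n. hs[j := x] ! k $ ?b p k) = x $ ?b p j * (\<Prod>k\<in>{..<?n} - {j}. hs ! k $ ?b p k)"
    for p and x :: "(real, 'a) vec"
  proof -
    have "(\<Prod>k<?n. hs[j := x] ! k $ ?b p k)
        = hs[j := x] ! j $ ?b p j * (\<Prod>k\<in>{..<?n} - {j}. hs[j := x] ! k $ ?b p k)"
      by (rule prod.remove) (use * in auto)
    also have "(\<Prod>k\<in>{..<?n} - {j}. hs[j := x] ! k $ ?b p k) = (\<Prod>k\<in>{..<?n} - {j}. hs ! k $ ?b p k)"
      by (rule prod.cong) auto
    finally show ?thesis using * len by simp
  qed
  have "dxf B (hs[j := s *\<^sub>R a + t *\<^sub>R b]) = s * dxf B (hs[j := a]) + t * dxf B (hs[j := b])"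
    unfolding dxf_def split
    by (simp add: sum_distrib_left sum.distrib[symmetric] algebra_simps)
  then show "(if hs[j := s *\<^sub>R a + t *\<^sub>R b] \<in> tuples ?n UNIV then dxf B (hs[j := s *\<^sub>R a + t *\<^sub>R b]) else 0)
     = s * (if hs[j := a] \<in> tuples ?n UNIV then dxf B (hs[j := a]) else 0)
     + t * (if hs[j := b] \<in> tuples ?n UNIV then dxf B (hs[j := b]) else 0)"
    using * by (simp add: tuples_update)
next
  let ?b = "\<lambda>p k. sorted_list_of_set B ! p k"
  let ?n = "card B"
  fix hs :: "(real, 'a) vec list" and j k
  assume *: "hs \<in> tuples ?n UNIV" "j < ?n" "k < ?n" "j \<noteq> k" "hs ! j = hs ! k"
  let ?t = "Transposition.transpose j k"
  have t: "?t permutes {..<?n}" using * by (simp add: permutes_swap_id)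
  let ?f = "\<lambda>p. of_int (sign p) * (\<Prod>k<?n. hs ! k $ ?b p k)"
  have "?f (p \<circ> ?t) = - ?f p" if p: "p permutes {..<?n}" for p
  proof -
    have "sign (p \<circ> ?t) = - sign p"
      using p t * by (subst sign_compose) (auto simp: sign_swap_id intro: permutation_permutes[THEN iffD2])
    moreover have "(\<Prod>m<?n. hs ! m $ ?b (p \<circ> ?t) m) = (\<Prod>m<?n. hs ! m $ ?b p m)"
    proof -
      have "(\<Prod>m<?n. hs ! m $ ?b p m) = (\<Prod>m<?n. hs ! (?t m) $ ?b p (?t m))"
        using prod.permute[OF t, of "\<lambda>m. hs ! m $ ?b p m"] by (simp add: o_def)
      also have "\<dots> = (\<Prod>m<?n. hs ! m $ ?b (p \<circ> ?t) m)"
        by (rule prod.cong) (use * in \<open>auto simp: Transposition.transpose_def\<close>)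
      finally show ?thesis by simp
    qed
    ultimately show ?thesis by simp
  qed
  then have "(\<Sum>p | p permutes {..<?n}. ?f (p \<circ> ?t)) = (\<Sum>p | p permutes {..<?n}. - ?f p)"
    by (intro sum.cong) auto
  moreover have "(\<Sum>p | p permutes {..<?n}. ?f (p \<circ> ?t)) = (\<Sum>p | p permutes {..<?n}. ?f p)"
    by (rule sum_permutations_compose_right[OF t, symmetric])
  ultimately have "dxf B hs = 0" unfolding dxf_def by (simp add: sum_negf)
  then show "(if hs \<in> tuples ?n UNIV then dxf B hs else 0) = 0" by simp
qed simp

lemma dxf_pullback:
  assumes V: "subspace V"
    and lin: "\<And>a b s t. a \<in> V \<Longrightarrow> b \<in> V \<Longrightarrow> L (s *\<^sub>R a + t *\<^sub>R b) = s *\<^sub>R L a + t *\<^sub>R L b"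
    and r: "card B = r"
  shows "(\<lambda>vs. if vs \<in> tuples r V then dxf B (map L vs) else 0) \<in> alt_forms r V"
proof -
  have "(\<lambda>vs. if vs \<in> tuples r V then dxf B (map L vs) else 0) =
    (\<lambda>vs. if vs \<in> tuples r V
       then (\<lambda>hs. if hs \<in> tuples (card B) UNIV then dxf B hs else 0) (map L vs) else 0)"
    by (auto simp: fun_eq_iff tuples_def r)
  also have "\<dots> \<in> alt_forms r V"
    using alt_forms_pullback[OF dxf_in_alt_forms V _ lin, of B] unfolding r by simp
  finally show ?thesis .
qed

text \<open>A permutation with nonzero summand matches the sorted list of \<open>B'\<close> with
  that of \<open>B\<close>; this forces \<open>B = B'\<close> and, since the list is distinct, the
  identity.\<close>

lemma dxf_basis_tuple:
  assumes "card B = card B'"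
  shows "dxf B (basis_tuple B') = (if B = B' then 1 else 0)"
proof -
  let ?n = "card B"
  let ?f = "\<lambda>p. of_int (sign p) * (\<Prod>k<?n. basis_tuple B' ! k $ (sorted_list_of_set B ! p k))"
  have prod: "?f p = 0 \<or> (B = B' \<and> p = id)" if p: "p permutes {..<?n}" for p
  proof (rule disjCI)
    assume "\<not> (B = B' \<and> p = id)"
    have "\<exists>k<?n. sorted_list_of_set B' ! k \<noteq> sorted_list_of_set B ! p k"
    proof (rule ccontr)
      assume "\<not> ?thesis"
      then have eq: "sorted_list_of_set B' ! k = sorted_list_of_set B ! p k" if "k < ?n" for k
        using that by blast
      have pk: "p k < ?n" if "k < ?n" for k using p that permutes_in_image by fastforce
      have "set (sorted_list_of_set B') \<subseteq> set (sorted_list_of_set B)"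
      proof
        fix b assume "b \<in> set (sorted_list_of_set B')"
        then obtain k where "k < ?n" "b = sorted_list_of_set B' ! k"
          unfolding in_set_conv_nth using assms by auto
        then show "b \<in> set (sorted_list_of_set B)"
          using eq pk nth_mem[of "p k" "sorted_list_of_set B"] by simp
      qed
      then have "B' = B" using assms by (simp add: card_subset_eq)
      moreover have "p k = k" for k
      proof (cases "k < ?n")
        case True
        then show ?thesis
          using eq[OF True] pk[OF True] unfolding \<open>B' = B\<close>
          by (simp add: nth_eq_iff_index_eq)
      next
        case False then show ?thesis using p by (simp add: permutes_def)
      qed
      ultimately show False using \<open>\<not> (B = B' \<and> p = id)\<close> by auto
    qed
    then obtain k where k: "k < ?n" "sorted_list_of_set B' ! k \<noteq> sorted_list_of_set B ! p k" by blast
    then have "(basis_tuple B' ! k :: (real, 'a) vec) $ (sorted_list_of_set B ! p k) = 0"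
      using assms by (auto simp: axis_def)
    then have "(\<Prod>k<?n. basis_tuple B' ! k $ (sorted_list_of_set B ! p k) :: real) = 0"
      using k(1) by (intro prod_zero) auto
    then show "?f p = 0" by simp
  qed
  show ?thesis
  proof (cases "B = B'")
    case True
    have "dxf B (basis_tuple B') = (\<Sum>p\<in>{id}. ?f p)"
      unfolding dxf_def
      by (rule sum.mono_neutral_right) (use prod in \<open>auto simp: permutes_id finite_permutations\<close>)
    also have "\<dots> = 1" using True by (simp add: axis_def)
    finally show ?thesis using True by simp
  next
    case False
    then show ?thesis unfolding dxf_def using prod by (simp add: sum.neutral)
  qed
qed

text \<open>Product rule in every summand; after exchanging the sums, the terms in which slot
  \<open>j\<close> is differentiated form one minor.\<close>

lemma dxf_has_vector_derivative:
  fixes hs :: "real \<Rightarrow> (real, 'n::{finite,linorder}) vec list"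
  assumes hs: "\<And>k. k < card B \<Longrightarrow> ((\<lambda>t. hs t ! k) has_vector_derivative hs' ! k) (at 0)"
    and len: "length (hs 0) = card B"
  shows "((\<lambda>t. dxf B (hs t)) has_vector_derivative (\<Sum>j<card B. dxf B ((hs 0)[j := hs' ! j]))) (at 0)"
proof -
  let ?b = "\<lambda>p k. sorted_list_of_set B ! p k"
  let ?n = "card B"
  have comp: "((\<lambda>t. hs t ! k $ b) has_derivative (\<lambda>y. y * hs' ! k $ b)) (at 0)" if "k < ?n" for k b
    using bounded_linear.has_vector_derivative[OF bounded_linear_vec_nth hs[OF that], of b]
    by (simp add: has_vector_derivative_def)
  have trm: "((\<lambda>t. \<Prod>k<?n. hs t ! k $ ?b p k) has_vector_derivative
      (\<Sum>j<?n. \<Prod>k<?n. (hs 0)[j := hs' ! j] ! k $ ?b p k)) (at 0)" for p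
  proof -
    have "(\<Prod>k<?n. (hs 0)[j := hs' ! j] ! k $ ?b p k)
        = hs' ! j $ ?b p j * (\<Prod>k\<in>{..<?n} - {j}. hs 0 ! k $ ?b p k)" if j: "j < ?n" for j
    proof -
      have "(\<Prod>k<?n. (hs 0)[j := hs' ! j] ! k $ ?b p k) = (hs 0)[j := hs' ! j] ! j $ ?b p j *
          (\<Prod>k\<in>{..<?n} - {j}. (hs 0)[j := hs' ! j] ! k $ ?b p k)"
        by (rule prod.remove) (use j in auto)
      also have "(\<Prod>k\<in>{..<?n} - {j}. (hs 0)[j := hs' ! j] ! k $ ?b p k)
          = (\<Prod>k\<in>{..<?n} - {j}. hs 0 ! k $ ?b p k)"
        by (rule prod.cong) auto
      finally show ?thesis using j len by simp
    qed
    then have "(\<Sum>j<?n. \<Prod>k<?n. (hs 0)[j := hs' ! j] ! k $ ?b p k)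
      = (\<Sum>j<?n. hs' ! j $ ?b p j * (\<Prod>k\<in>{..<?n} - {j}. hs 0 ! k $ ?b p k))"
      by (intro sum.cong) auto
    moreover have "((\<lambda>t. \<Prod>k<?n. hs t ! k $ ?b p k) has_derivative
        (\<lambda>y. \<Sum>j<?n. (y * hs' ! j $ ?b p j) * (\<Prod>k\<in>{..<?n} - {j}. hs 0 ! k $ ?b p k))) (at 0)"
      by (rule has_derivative_prod) (use comp in auto)
    ultimately show ?thesis
      by (simp add: has_vector_derivative_def sum_distrib_left mult.assoc)
  qed
  have "((\<lambda>t. dxf B (hs t)) has_vector_derivative
      (\<Sum>p | p permutes {..<?n}. of_int (sign p) *
        (\<Sum>j<?n. \<Prod>k<?n. (hs 0)[j := hs' ! j] ! k $ ?b p k))) (at 0)"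
    unfolding dxf_def by (intro has_vector_derivative_sum has_vector_derivative_mult_right trm)
  also have "(\<Sum>p | p permutes {..<?n}. of_int (sign p) *
        (\<Sum>j<?n. \<Prod>k<?n. (hs 0)[j := hs' ! j] ! k $ ?b p k))
      = (\<Sum>j<?n. dxf B ((hs 0)[j := hs' ! j]))"
    unfolding dxf_def sum_distrib_left by (rule sum.swap)
  finally show ?thesis .
qed

text \<open>The head of \<open>ys\<close> is moved leftwards, by adjacent swaps, to the end of the
  prefix \<open>us\<close>, which holds the entries already in place; the rest follows by induction.
  \<open>M\<close> confines the swap rule to lists with the given entries.\<close>

lemma adjacent_swaps:
  assumes swap: "\<And>us a b vs. mset (us @ a # b # vs) = M \<Longrightarrow> Q (us @ a # b # vs) \<Longrightarrow> Q (us @ b # a # vs)"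
    and "mset (us @ xs) = M" "mset xs = mset ys" "Q (us @ xs)"
  shows "Q (us @ ys)"
  using assms(2-4)
proof (induction ys arbitrary: us xs)
  case (Cons y ys)
  then have "y \<in> set xs" by (metis list.set_intros(1) set_mset_mset)
  then obtain x1 x2 where xs: "xs = x1 @ y # x2" by (meson split_list)
  have "Q (us @ y # x1 @ x2)"
    using Cons.prems(1,3) unfolding xs
  proof (induction x1 arbitrary: x2 rule: rev_induct)
    case (snoc a x1)
    have "Q ((us @ x1) @ y # a # x2)"
      by (rule swap) (use snoc.prems in auto)
    with snoc.IH[of "a # x2"] snoc.prems show ?case by (simp add: add_mset_commute)
  qed simp
  with Cons.IH[of "us @ [y]" "x1 @ x2"] Cons.prems show ?case by (simp add: xs)
qed simp

lemma subspace_coord_space: "subspace (coord_space I)"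
  by (rule subspaceI) (auto simp: coord_space_def)

lemma axis_in_coord_space: "b \<in> I \<Longrightarrow> axis b 1 \<in> coord_space I"
  by (auto simp: coord_space_def axis_def)

lemma basis_tuple_in: "B \<subseteq> I \<Longrightarrow> card B = r \<Longrightarrow> basis_tuple B \<in> tuples r (coord_space I)"
  by (auto simp: tuples_def intro: axis_in_coord_space)

lemma coord_space_expand: "h \<in> coord_space I \<Longrightarrow> h = (\<Sum>b\<in>I. (h $ b) *\<^sub>R axis b 1)"
  by (auto simp: vec_eq_iff coord_space_def axis_def if_distrib cong: if_cong)

text \<open>Adjacent swaps lead from increasing basis tuples to all tuples of distinct basis
  vectors, repeated ones vanish by alternation, and multilinearity fills the slots with arbitrary
  vectors.\<close>

lemma alt_form_zeroI:
  assumes \<gamma>: "\<gamma> \<in> alt_forms r (coord_space I)"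
    and 0: "\<And>B. B \<subseteq> I \<Longrightarrow> card B = r \<Longrightarrow> \<gamma> (basis_tuple B) = 0"
  shows "\<gamma> hs = 0"
proof -
  let ?S = "coord_space I"
  have 1: "\<gamma> (map (\<lambda>b. axis b 1) bs) = 0" if bs: "set bs \<subseteq> I" "length bs = r" for bs
  proof (cases "distinct bs")
    case True
    let ?ys = "sorted_list_of_set (set bs)"
    have m: "mset ?ys = mset bs" using True set_eq_iff_mset_eq_distinct[of ?ys bs] by simp
    have "\<gamma> (map (\<lambda>b. axis b 1) ([] @ bs)) = 0"
    proof (rule adjacent_swaps[where xs = ?ys and M = "mset bs"])
      fix us a b vs assume M: "mset (us @ a # b # vs) = mset bs"
        and z: "\<gamma> (map (\<lambda>b. axis b 1) (us @ a # b # vs)) = 0"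
      have "set (us @ a # b # vs) = set bs" "length (us @ a # b # vs) = length bs"
        using M mset_eq_setD mset_eq_length by blast+
      then have "map (\<lambda>b. axis b 1) (us @ a # b # vs) \<in> tuples r ?S"
        using bs by (auto simp: tuples_def intro!: axis_in_coord_space)
      with alt_form_swap[OF \<gamma> subspace_coord_space] z
      show "\<gamma> (map (\<lambda>b. axis b 1) (us @ b # a # vs)) = 0" by simp
    next
      show "\<gamma> (map (\<lambda>b. axis b 1) ([] @ ?ys)) = 0"
        using 0[of "set bs"] bs True by (simp add: distinct_card)
    qed (use m in auto)
    then show ?thesis by simp
  next
    case False
    then obtain j k where "j < r" "k < r" "j \<noteq> k" "bs ! j = bs ! k"
      using bs by (auto simp: distinct_conv_nth)
    moreover have "map (\<lambda>b. axis b 1) bs \<in> tuples r ?S"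
      using bs by (auto simp: tuples_def intro!: axis_in_coord_space)
    ultimately show ?thesis using alt_form_alt[OF \<gamma>, of _ j k] bs by simp
  qed
  \<comment> \<open>Induction on the number \<open>k\<close> of leading slots that may hold
    arbitrary vectors; from slot \<open>k\<close> on there are basis vectors.\<close>
  have "\<forall>hs\<in>tuples r ?S. (\<forall>j. k \<le> j \<longrightarrow> j < r \<longrightarrow> (\<exists>b\<in>I. hs ! j = axis b 1)) \<longrightarrow> \<gamma> hs = 0"
    if "k \<le> r" for k
    using that
  proof (induction k)
    case 0
    show ?case
    proof (intro ballI impI)
      fix hs :: "(real, 'a) vec list"
      assume hs: "hs \<in> tuples r ?S" "\<forall>j. 0 \<le> j \<longrightarrow> j < r \<longrightarrow> (\<exists>b\<in>I. hs ! j = axis b 1)"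
      then have "\<forall>j. \<exists>b. j < r \<longrightarrow> b \<in> I \<and> hs ! j = axis b 1" by blast
      then obtain f where f: "\<And>j. j < r \<Longrightarrow> f j \<in> I \<and> hs ! j = axis (f j) 1"
        using choice[of "\<lambda>j b. j < r \<longrightarrow> b \<in> I \<and> hs ! j = axis b 1"] by blast
      have "hs = map (\<lambda>b. axis b 1) (map f [0..<r])"
        using f hs by (auto simp: list_eq_iff_nth_eq tuples_def)
      then show "\<gamma> hs = 0" using 1[of "map f [0..<r]"] f by (metis atLeastLessThan_iff
          image_subset_iff length_map length_upt minus_nat.diff_0 set_map set_upt)
    qed
  next
    case (Suc k)
    show ?case
    proof (intro ballI impI)
      fix hs :: "(real, 'a) vec list"
      assume hs: "hs \<in> tuples r ?S" "\<forall>j. Suc k \<le> j \<longrightarrow> j < r \<longrightarrow> (\<exists>b\<in>I. hs ! j = axis b 1)"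
      have k: "k < r" using Suc.prems by simp
      have "\<gamma> (hs[k := \<Sum>b\<in>I. (hs ! k $ b) *\<^sub>R axis b 1]) = (\<Sum>b\<in>I. hs ! k $ b * \<gamma> (hs[k := axis b 1]))"
        by (rule alt_form_update_sum[OF \<gamma> subspace_coord_space hs(1) k])
          (auto intro: axis_in_coord_space)
      also have "\<dots> = 0"
      proof (rule sum.neutral, rule ballI)
        fix b assume b: "b \<in> I"
        have "hs[k := axis b 1] \<in> tuples r ?S" using hs b by (simp add: tuples_update axis_in_coord_space)
        moreover have "\<forall>j. k \<le> j \<longrightarrow> j < r \<longrightarrow> (\<exists>b'\<in>I. hs[k := axis b 1] ! j = axis b' 1)"
        proof (intro allI impI)
          fix j assume j: "k \<le> j" "j < r"
          show "\<exists>b'\<in>I. hs[k := axis b 1] ! j = axis b' 1"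
            using hs(2) b j tuplesD(1)[OF hs(1)] by (cases "j = k") auto
        qed
        ultimately have "\<gamma> (hs[k := axis b 1]) = 0" using Suc by simp
        then show "hs ! k $ b * \<gamma> (hs[k := axis b 1]) = 0" by simp
      qed
      also have "hs[k := \<Sum>b\<in>I. (hs ! k $ b) *\<^sub>R axis b 1] = hs"
        using coord_space_expand[OF tuples_nth[OF hs(1) k]] by (metis list_update_id)
      finally show "\<gamma> hs = 0" .
    qed
  qed
  from this[of r] show ?thesis using alt_form_outside[OF \<gamma>] by (cases "hs \<in> tuples r ?S") auto
qed

definition index_sets :: "'n set \<Rightarrow> nat \<Rightarrow> 'n set set" where
  "index_sets I r = {B. B \<subseteq> I \<and> card B = r}"

text \<open>The difference of the two sides is a form vanishing on every
  \<open>basis_tuple B\<close>, by \<open>dxf_basis_tuple\<close>.\<close>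

lemma alt_form_expand:
  assumes \<alpha>: "\<alpha> \<in> alt_forms r (coord_space I)" and hs: "hs \<in> tuples r (coord_space I)"
  shows "\<alpha> hs = (\<Sum>B\<in>index_sets I r. \<alpha> (basis_tuple B) * dxf B hs)"
proof -
  let ?S = "coord_space I"
  let ?d = "\<lambda>B hs. if hs \<in> tuples r ?S then dxf B hs else 0"
  let ?\<beta> = "\<lambda>hs. \<Sum>B\<in>index_sets I r. \<alpha> (basis_tuple B) * ?d B hs"
  have "?\<beta> \<in> alt_forms r ?S"
  proof (rule alt_forms_sum)
    fix B assume "B \<in> index_sets I r"
    then show "?d B \<in> alt_forms r ?S"
      using dxf_pullback[where L = "\<lambda>h. h" and V = ?S and B = B and r = r, OF subspace_coord_space]
      unfolding list.map_ident by (simp add: index_sets_def)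
  qed
  then have "(\<lambda>hs. \<alpha> hs - ?\<beta> hs) \<in> alt_forms r ?S" by (rule alt_forms_diff[OF \<alpha>])
  then have "\<alpha> hs - ?\<beta> hs = 0"
  proof (rule alt_form_zeroI)
    fix B assume B: "B \<subseteq> I" "card B = r"
    have "?\<beta> (basis_tuple B) = (\<Sum>B'\<in>index_sets I r. if B' = B then \<alpha> (basis_tuple B) else 0)"
    proof (rule sum.cong[OF refl])
      fix B' assume "B' \<in> index_sets I r"
      then have "?d B' (basis_tuple B) = (if B' = B then 1 else 0)"
        using dxf_basis_tuple[of B' B] basis_tuple_in[OF B] B by (simp add: index_sets_def)
      then show "\<alpha> (basis_tuple B') * ?d B' (basis_tuple B) = (if B' = B then \<alpha> (basis_tuple B) else 0)"
        by simp
    qed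
    also have "\<dots> = \<alpha> (basis_tuple B)" using B by (simp add: index_sets_def)
    finally show "\<alpha> (basis_tuple B) - ?\<beta> (basis_tuple B) = 0" by simp
  qed
  then show ?thesis using hs by simp
qed

section \<open>Tangent and exterior bundles of a manifold\<close>

lemma sum_fun_apply: "(\<Sum>i\<in>J. g i) x = (\<Sum>i\<in>J. g i x)"
  by (induction J rule: infinite_finite_induct) auto

lemma vec_expand: "(v :: (real, 'm::finite) vec) = (\<Sum>B\<in>UNIV. (v $ B) *\<^sub>R axis B 1)"
  by (simp add: vec_eq_iff axis_def if_distrib cong: if_cong)

lemma hvd_vec:
  fixes f :: "real \<Rightarrow> (real, 'm::finite) vec"
  assumes "\<And>B. ((\<lambda>t. f t $ B) has_vector_derivative d $ B) (at x)"
  shows "(f has_vector_derivative d) (at x)"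
proof -
  have "((\<lambda>t. \<Sum>B\<in>UNIV. (f t $ B) *\<^sub>R axis B (1::real)) has_vector_derivative
      (\<Sum>B\<in>UNIV. (d $ B) *\<^sub>R axis B 1)) (at x)"
    by (intro has_vector_derivative_sum bounded_linear.has_vector_derivative[OF bounded_linear_scaleR_left] assms)
  then show ?thesis by (simp only: vec_expand[symmetric])
qed

lemma has_cderiv_vec:
  fixes g :: "'m::finite \<Rightarrow> 'a \<Rightarrow> real"
  assumes "\<And>B. has_cderiv c (g B) (D B) x"
  shows "has_cderiv c (\<lambda>y. \<chi> B. g B y) (\<lambda>h. \<chi> B. D B h) x"
  unfolding has_cderiv_def
proof (intro conjI allI impI)
  show "linear (\<lambda>h. \<chi> B. D B h)"
    using assms by (intro linearI) (auto simp: has_cderiv_def vec_eq_iff linear_add linear_scale)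
  fix \<gamma> h assume "curve_in c \<gamma> x h"
  from has_cderivD[OF assms this]
  show "((\<lambda>t. \<chi> B. g B (\<gamma> t)) has_vector_derivative (\<chi> B. D B h)) (at 0)"
    by (intro hvd_vec) simp
qed

lemma has_cderiv_dxf:
  assumes hs: "\<And>k. k < card B \<Longrightarrow> has_cderiv c (\<lambda>y. hs y ! k) (D k) x"
    and len: "length (hs x) = card B"
  shows "has_cderiv c (\<lambda>y. dxf B (hs y)) (\<lambda>h. \<Sum>j<card B. dxf B ((hs x)[j := D j h])) x"
  unfolding has_cderiv_def
proof (intro conjI allI impI)
  have tup: "hs x \<in> tuples (card B) UNIV" using len by (simp add: tuples_def)
  have lin: "dxf B ((hs x)[j := s *\<^sub>R a + t *\<^sub>R b]) = s * dxf B ((hs x)[j := a]) + t * dxf B ((hs x)[j := b])"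
    if "j < card B" for j a b s t
    using alt_form_lin[OF dxf_in_alt_forms tup that, of a b s t] tup by (simp add: tuples_update)
  have D: "linear (D j)" if "j < card B" for j using hs[OF that] by (simp add: has_cderiv_def)
  show "linear (\<lambda>h. \<Sum>j<card B. dxf B ((hs x)[j := D j h]))"
  proof (rule linearI)
    fix a b
    have "dxf B ((hs x)[j := D j (a + b)]) = dxf B ((hs x)[j := D j a]) + dxf B ((hs x)[j := D j b])"
      if "j < card B" for j
      using lin[OF that, of 1 "D j a" 1 "D j b"] by (simp add: linear_add[OF D[OF that]])
    then show "(\<Sum>j<card B. dxf B ((hs x)[j := D j (a + b)])) =
        (\<Sum>j<card B. dxf B ((hs x)[j := D j a])) + (\<Sum>j<card B. dxf B ((hs x)[j := D j b]))"
      by (simp add: sum.distrib[symmetric])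
  next
    fix s a
    have "dxf B ((hs x)[j := D j (s *\<^sub>R a)]) = s * dxf B ((hs x)[j := D j a])"
      if "j < card B" for j
      using lin[OF that, of s "D j a" 0 0] by (simp add: linear_scale[OF D[OF that]])
    then show "(\<Sum>j<card B. dxf B ((hs x)[j := D j (s *\<^sub>R a)])) = s *\<^sub>R (\<Sum>j<card B. dxf B ((hs x)[j := D j a]))"
      by (simp add: sum_distrib_left)
  qed
  fix \<gamma> h assume \<gamma>: "curve_in c \<gamma> x h"
  then have x: "\<gamma> 0 = x" by (simp add: curve_in_def)
  have "((\<lambda>t. dxf B (hs (\<gamma> t))) has_vector_derivative
      (\<Sum>j<card B. dxf B ((hs (\<gamma> 0))[j := map (\<lambda>k. D k h) [0..<card B] ! j]))) (at 0)"
    by (rule dxf_has_vector_derivative) (use has_cderivD[OF hs \<gamma>] len x in auto)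
  then show "((\<lambda>t. dxf B (hs (\<gamma> t))) has_vector_derivative (\<Sum>j<card B. dxf B ((hs x)[j := D j h]))) (at 0)"
    by (simp add: x)
qed

lemma (in curve_atlas) curve_in_change:
  assumes c: "c \<in> charts_at A x" "c' \<in> charts_at A x" and J: "has_cderiv c (snd c') J x"
    and \<gamma>: "curve_in c \<gamma> x h"
  shows "curve_in c' \<gamma> x (J h)"
  using domain_nhd[OF c \<gamma>] has_cderivD[OF J \<gamma>] \<gamma> by (simp add: curve_in_def)

lemma (in curve_atlas) has_cderiv_change:
  assumes c: "c \<in> charts_at A x" "c' \<in> charts_at A x" and J: "has_cderiv c (snd c') J x"
    and g: "has_cderiv c' g D x"
  shows "has_cderiv c g (\<lambda>h. D (J h)) x"
  unfolding has_cderiv_def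
proof (intro conjI allI impI)
  show "linear (\<lambda>h. D (J h))"
    using linear_compose[of J D] J g by (simp add: has_cderiv_def comp_def)
  show "((\<lambda>t. g (\<gamma> t)) has_vector_derivative D (J h)) (at 0)" if "curve_in c \<gamma> x h" for \<gamma> h
    by (rule has_cderivD[OF g curve_in_change[OF c J that]])
qed

lemma (in curve_atlas) coord_vec_sum:
  assumes c: "c \<in> charts_at A x" and a: "finite J" "\<And>i. i \<in> J \<Longrightarrow> a i \<in> S"
  shows "coord_vec A c x (\<Sum>i\<in>J. s i *\<^sub>R a i) = (\<Sum>i\<in>J. s i *\<^sub>R coord_vec A c x (a i))"
  using a
proof (induction J)
  case empty
  then show ?case using coord_vec_lin[OF c subspace_0[OF subspace] subspace_0[OF subspace], of 0 0] by simp
next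
  case (insert i J)
  have "(\<Sum>i\<in>J. s i *\<^sub>R a i) \<in> S" using insert subspace by (simp add: subspace_sum subspace_scale)
  with insert coord_vec_lin[OF c, of "a i" _ "s i" 1] show ?case by simp
qed

locale manifold =
  fixes X :: "'a topology" and I :: "'n::{finite,linorder} set" and A :: "('a, 'n) natlas"
  assumes M: "smooth_manifold X (coord_space I) A"

sublocale manifold \<subseteq> curve_atlas "coord_space I" A
  by (rule smooth_manifold_curve_atlas[OF M])

context manifold begin

abbreviation "S \<equiv> coord_space I"
abbreviation "J r \<equiv> index_sets I r"

lemma transition_derivatives:
  assumes c: "c \<in> charts_at A x" "c' \<in> charts_at A x" and h: "h \<in> S"
  shows "\<exists>D. has_cderiv c (\<lambda>y. coord_vec A c y h c') D x"
  by (rule coord_vec_has_cderiv[OF M c]) (use h in blast)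

text \<open>The direction of differentiation is read in \<open>c\<close>, but the vector field
  belongs to \<open>c'\<close>: differentiate in \<open>c'\<close> and change the chart by the chain
  rule. Components of forms transform with this inverse Jacobian.\<close>

lemma inverse_transition_derivatives:
  assumes c: "c \<in> charts_at A x" "c' \<in> charts_at A x" and h: "h \<in> S"
  shows "\<exists>D. has_cderiv c (\<lambda>y. coord_vec A c' y h c) D x"
proof -
  obtain D where D: "has_cderiv c' (\<lambda>y. coord_vec A c' y h c) D x"
    using transition_derivatives[OF c(2,1) h] by blast
  obtain L where L: "has_cderiv c (snd c') L x" using transition[OF c] by blast
  show ?thesis using has_cderiv_change[OF c L D] by blast
qed

lemma tangent_chart_eq: "c \<in> A \<Longrightarrow> tangent_chart A c = bundle_chart (tangent_space A) (\<lambda>c x v. v c) c"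
  by (auto simp: tangent_chart_def bundle_chart_def tangent_bundle_iff)

lemma tangent_atlas_eq: "tangent_atlas A = bundle_chart (tangent_space A) (\<lambda>c x v. v c) ` A"
  unfolding tangent_atlas_def by (rule image_cong[OF refl tangent_chart_eq])

lemma coords_change:
  assumes c: "c \<in> charts_at A x" and v: "v \<in> tangent_space A x"
  shows "v c' = (\<Sum>b\<in>I. (v c $ b) *\<^sub>R coord_vec A c x (axis b 1) c')"
proof -
  have "v = coord_vec A c x (\<Sum>b\<in>I. (v c $ b) *\<^sub>R axis b 1)"
    using coord_space_expand[OF coords_in_S[OF c v]] coord_vec_coords[OF c v] by metis
  also have "\<dots> = (\<Sum>b\<in>I. (v c $ b) *\<^sub>R coord_vec A c x (axis b 1))"
    by (rule coord_vec_sum[OF c]) (auto intro: axis_in_coord_space)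
  finally show ?thesis using sum_fun_apply by (metis (no_types, lifting) scaleR_fun_def sum.cong)
qed

lemma tangent_curve_atlas: "curve_atlas (S \<times> S) (tangent_atlas A)"
  unfolding tangent_atlas_eq
proof (rule bundle_curve_atlas[OF curve_atlas_axioms subspace bij_coords])
  fix c c' x assume c: "c \<in> charts_at A x" "c' \<in> charts_at A x"
  \<comment> \<open>The columns of the Jacobian of the transition map, zero at indices outside
    \<open>I\<close>.\<close>
  define G where "G b y = (if b \<in> I then coord_vec A c y (axis b 1) c' else 0)" for b y
  have "v c' = (\<Sum>b\<in>UNIV. (v c $ b) *\<^sub>R G b y)" 
    if "y \<in> fst c \<inter> fst c'" "v \<in> tangent_space A y" for y v
  proof -
    have "c \<in> charts_at A y" using that c by (auto simp: charts_at_def)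
    from coords_change[OF this that(2), of c'] show ?thesis
      by (simp add: G_def if_distrib sum.If_cases cong: if_cong)
  qed
  moreover have "\<exists>D. has_cderiv c (G b) D x" for b
  proof (cases "b \<in> I")
    case True
    then show ?thesis
      using transition_derivatives[OF c axis_in_coord_space[OF True]] unfolding G_def by simp
  next
    case False
    then show ?thesis unfolding G_def using has_cderiv_const[of c 0 x] by auto
  qed
  ultimately show "\<exists>G. (\<forall>y\<in>fst c \<inter> fst c'. \<forall>v\<in>tangent_space A y. v c' = (\<Sum>b\<in>UNIV. (v c $ b) *\<^sub>R G b y)) \<and>
      (\<forall>b. \<exists>D. has_cderiv c (G b) D x)" by blast
qed

section \<open>Frames and components of forms and multivectors\<close>

text \<open>The coordinate basis vectors at \<open>x\<close> with indices in \<open>B\<close>, in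
  increasing order: forms evaluated on them give the components in \<open>coext_atlas\<close>, and
  their wedges form a basis of the multivectors.\<close>

definition frame :: "('a, (real, 'n) vec) chart \<Rightarrow> 'a \<Rightarrow> 'n set \<Rightarrow> ('a, 'n) nfib list" where
  "frame c x B = map (coord_vec A c x) (basis_tuple B)"

lemma frame_in: "c \<in> charts_at A x \<Longrightarrow> B \<in> J r \<Longrightarrow> frame c x B \<in> tuples r (tangent_space A x)"
  unfolding frame_def by (rule tuples_map[OF basis_tuple_in coord_vec_in]) (auto simp: index_sets_def)

lemma coords_frame:
  assumes "c \<in> charts_at A x" "B \<in> J r"
  shows "map (\<lambda>v. v c) (frame c x B) = basis_tuple B"
proof -
  have "set (sorted_list_of_set B) \<subseteq> I" using assms by (simp add: index_sets_def)
  then show ?thesis unfolding frame_def using assms by (auto simp: subset_iff axis_in_coord_space)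
qed

lemma coord_form_eq:
  assumes "B \<in> J r"
  shows "coord_form A c x B = (\<lambda>vs. if vs \<in> tuples r (tangent_space A x) then dxf B (map (\<lambda>v. v c) vs) else 0)"
proof -
  have r: "card B = r" using assms by (simp add: index_sets_def)
  show ?thesis
    unfolding coord_form_def dxf_def r
    by (auto simp: fun_eq_iff tuples_def intro!: sum.cong prod.cong)
qed

lemma coord_form_in:
  assumes "c \<in> charts_at A x" "B \<in> J r"
  shows "coord_form A c x B \<in> alt_forms r (tangent_space A x)"
  unfolding coord_form_eq[OF assms(2)]
  by (rule dxf_pullback[OF subspace_tangent_space[OF assms(1)]])
    (use assms in \<open>auto simp: index_sets_def scaleR_fun_def\<close>)

lemma coord_form_frame:
  assumes "c \<in> charts_at A x" "B \<in> J r" "C \<in> J r"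
  shows "coord_form A c x B (frame c x C) = (if B = C then 1 else 0)"
  unfolding coord_form_eq[OF assms(2)] coords_frame[OF assms(1,3)]
  using frame_in[OF assms(1,3)] assms(2,3) by (simp add: index_sets_def dxf_basis_tuple)

lemma form_expand:
  assumes c: "c \<in> charts_at A x" and \<alpha>: "\<alpha> \<in> alt_forms r (tangent_space A x)"
    and vs: "vs \<in> tuples r (tangent_space A x)"
  shows "\<alpha> vs = (\<Sum>B\<in>J r. \<alpha> (frame c x B) * dxf B (map (\<lambda>v. v c) vs))"
proof -
  let ?\<beta> = "\<lambda>hs. if hs \<in> tuples r S then \<alpha> (map (coord_vec A c x) hs) else 0"
  have \<beta>: "?\<beta> \<in> alt_forms r S"
    by (rule alt_forms_pullback[OF \<alpha> subspace coord_vec_in[OF c] coord_vec_lin[OF c]])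
  have hs: "map (\<lambda>v. v c) vs \<in> tuples r S"
    using vs by (rule tuples_map) (rule coords_in_S[OF c])
  have "map (coord_vec A c x) (map (\<lambda>v. v c) vs) = vs"
    using vs by (auto simp: tuples_def subset_iff c intro!: map_idI)
  then have "\<alpha> vs = ?\<beta> (map (\<lambda>v. v c) vs)" using hs by simp
  also have "\<dots> = (\<Sum>B\<in>J r. ?\<beta> (basis_tuple B) * dxf B (map (\<lambda>v. v c) vs))"
    by (rule alt_form_expand[OF \<beta> hs])
  also have "\<dots> = (\<Sum>B\<in>J r. \<alpha> (frame c x B) * dxf B (map (\<lambda>v. v c) vs))"
    by (rule sum.cong) (auto simp: basis_tuple_in index_sets_def frame_def)
  finally show ?thesis .
qed

lemma form_expand_fun:
  assumes c: "c \<in> charts_at A x" and \<alpha>: "\<alpha> \<in> alt_forms r (tangent_space A x)"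
  shows "\<alpha> = (\<lambda>vs. \<Sum>B\<in>J r. \<alpha> (frame c x B) * coord_form A c x B vs)"
proof
  fix vs
  show "\<alpha> vs = (\<Sum>B\<in>J r. \<alpha> (frame c x B) * coord_form A c x B vs)"
  proof (cases "vs \<in> tuples r (tangent_space A x)")
    case True
    then show ?thesis using form_expand[OF c \<alpha> True] by (simp add: coord_form_eq)
  qed (simp add: coord_form_eq alt_form_outside[OF \<alpha>])
qed

text \<open>The canonical pairing in components. It turns the pairing of moving multivectors and
  forms into a finite sum of products of real functions.\<close>

lemma mvec_expand:
  assumes c: "c \<in> charts_at A x" and \<alpha>: "\<alpha> \<in> alt_forms r (tangent_space A x)"
    and u: "u \<in> ext_power r (tangent_space A x)"
  shows "u \<alpha> = (\<Sum>B\<in>J r. \<alpha> (frame c x B) * u (coord_form A c x B))"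
  by (subst form_expand_fun[OF c \<alpha>]) (rule ext_power_linear[OF u coord_form_in[OF c]])

definition mvec_coord :: "nat \<Rightarrow> ('a, (real, 'n) vec) chart \<Rightarrow> 'a \<Rightarrow> ('a, 'n) nfib mvec \<Rightarrow> (real, 'n set) vec" where
  "mvec_coord r c x u = (\<chi> B. if B \<in> J r then u (coord_form A c x B) else 0)"

definition form_coord :: "nat \<Rightarrow> ('a, (real, 'n) vec) chart \<Rightarrow> 'a \<Rightarrow> ('a, 'n) nfib form \<Rightarrow> (real, 'n set) vec" where
  "form_coord r c x \<alpha> = (\<chi> B. if B \<in> J r then \<alpha> (frame c x B) else 0)"

abbreviation "ext_chart r \<equiv> bundle_chart (\<lambda>x. ext_power r (tangent_space A x)) (mvec_coord r)"
abbreviation "coext_chart r \<equiv> bundle_chart (\<lambda>x. alt_forms r (tangent_space A x)) (form_coord r)"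

lemma ext_atlas_eq: "ext_atlas A I r = ext_chart r ` A"
  unfolding ext_atlas_def
proof (rule image_cong[OF refl])
  fix c assume "c \<in> A"
  then have "{w \<in> ext_bundle A r. fst w \<in> fst c}
      = {w. fst w \<in> fst c \<and> snd w \<in> ext_power r (tangent_space A (fst w))}"
    unfolding ext_bundle_def points_def by auto
  then show "({w \<in> ext_bundle A r. fst w \<in> fst c}, \<lambda>(x, u).
      (snd c x, \<chi> B. if B \<subseteq> I \<and> card B = r then u (coord_form A c x B) else 0)) = ext_chart r c"
    by (simp add: bundle_chart_def mvec_coord_def index_sets_def)
qed

lemma coext_atlas_eq: "coext_atlas A I r = coext_chart r ` A"
  unfolding coext_atlas_def
proof (rule image_cong[OF refl])
  fix c assume "c \<in> A"
  then have "{w \<in> coext_bundle A r. fst w \<in> fst c}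
      = {w. fst w \<in> fst c \<and> snd w \<in> alt_forms r (tangent_space A (fst w))}"
    unfolding coext_bundle_def points_def by auto
  then show "({w \<in> coext_bundle A r. fst w \<in> fst c}, \<lambda>(x, \<alpha>).
      (snd c x, \<chi> B. if B \<subseteq> I \<and> card B = r
        then \<alpha> (map (\<lambda>b. coord_vec A c x (axis b 1)) (sorted_list_of_set B)) else 0)) = coext_chart r c"
    unfolding bundle_chart_def form_coord_def frame_def map_map comp_def by (simp add: index_sets_def)
qed

lemma bij_mvec_coord:
  assumes c: "c \<in> charts_at A x"
  shows "bij_betw (mvec_coord r c x) (ext_power r (tangent_space A x)) (coord_space (J r))"
proof (rule bij_betwI')
  fix u u' assume u: "u \<in> ext_power r (tangent_space A x)" "u' \<in> ext_power r (tangent_space A x)"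
  show "mvec_coord r c x u = mvec_coord r c x u' \<longleftrightarrow> u = u'"
  proof
    assume "mvec_coord r c x u = mvec_coord r c x u'"
    then have *: "u (coord_form A c x B) = u' (coord_form A c x B)" if "B \<in> J r" for B
      using that by (simp add: mvec_coord_def vec_eq_iff) metis
    show "u = u'"
    proof
      fix \<alpha> show "u \<alpha> = u' \<alpha>"
      proof (cases "\<alpha> \<in> alt_forms r (tangent_space A x)")
        case True
        show ?thesis unfolding mvec_expand[OF c True u(1)] mvec_expand[OF c True u(2)] using * by simp
      qed (simp add: ext_power_outside[OF u(1)] ext_power_outside[OF u(2)])
    qed
  qed simp
next
  fix u assume "u \<in> ext_power r (tangent_space A x)"
  show "mvec_coord r c x u \<in> coord_space (J r)" by (simp add: mvec_coord_def coord_space_def)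
next
  fix f assume f: "f \<in> coord_space (J r)"
  \<comment> \<open>By \<open>coord_form_frame\<close> the wedges of the frames are dual to the
    coordinate forms, so this combination has the prescribed components.\<close>
  let ?u = "\<Sum>C\<in>J r. (f $ C) *\<^sub>R wedge r (tangent_space A x) (frame c x C)"
  have "?u \<in> ext_power r (tangent_space A x)"
    by (intro subspace_sum subspace_scale subspace_ext_power wedge_in_ext_power frame_in[OF c])
  moreover have "?u (coord_form A c x B) = f $ B" if "B \<in> J r" for B
  proof -
    have "?u (coord_form A c x B) = (\<Sum>C\<in>J r. f $ C * coord_form A c x B (frame c x C))"
      using coord_form_in[OF c that] by (simp add: sum_fun_apply scaleR_fun_def wedge_def)
    also have "\<dots> = (\<Sum>C\<in>J r. if B = C then f $ C else 0)"
      by (rule sum.cong) (simp_all add: coord_form_frame[OF c that])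
    finally show ?thesis using that by simp
  qed
  then have "mvec_coord r c x ?u = f" using f by (auto simp: mvec_coord_def vec_eq_iff coord_space_def)
  ultimately show "\<exists>u\<in>ext_power r (tangent_space A x). f = mvec_coord r c x u"
    by (intro bexI[of _ ?u]) simp_all
qed

lemma bij_form_coord:
  assumes c: "c \<in> charts_at A x"
  shows "bij_betw (form_coord r c x) (alt_forms r (tangent_space A x)) (coord_space (J r))"
proof (rule bij_betwI')
  fix \<alpha> \<beta> assume \<alpha>\<beta>: "\<alpha> \<in> alt_forms r (tangent_space A x)" "\<beta> \<in> alt_forms r (tangent_space A x)"
  show "form_coord r c x \<alpha> = form_coord r c x \<beta> \<longleftrightarrow> \<alpha> = \<beta>"
  proof
    assume "form_coord r c x \<alpha> = form_coord r c x \<beta>"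
    then have "\<alpha> (frame c x B) = \<beta> (frame c x B)" if "B \<in> J r" for B
      using that by (simp add: form_coord_def vec_eq_iff) metis
    then show "\<alpha> = \<beta>"
      by (subst form_expand_fun[OF c \<alpha>\<beta>(1)], subst form_expand_fun[OF c \<alpha>\<beta>(2)]) auto
  qed simp
next
  fix \<alpha> assume "\<alpha> \<in> alt_forms r (tangent_space A x)"
  show "form_coord r c x \<alpha> \<in> coord_space (J r)" by (simp add: form_coord_def coord_space_def)
next
  fix f assume f: "f \<in> coord_space (J r)"
  let ?\<alpha> = "\<lambda>vs. \<Sum>C\<in>J r. f $ C * coord_form A c x C vs"
  have "?\<alpha> \<in> alt_forms r (tangent_space A x)"
    by (rule alt_forms_sum[OF coord_form_in[OF c]])
  moreover have "?\<alpha> (frame c x B) = f $ B" if "B \<in> J r" for B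
  proof -
    have "?\<alpha> (frame c x B) = (\<Sum>C\<in>J r. if C = B then f $ C else 0)"
      by (rule sum.cong) (simp_all add: coord_form_frame[OF c _ that])
    then show ?thesis using that by simp
  qed
  then have "form_coord r c x ?\<alpha> = f" using f by (auto simp: form_coord_def vec_eq_iff coord_space_def)
  ultimately show "\<exists>\<alpha>\<in>alt_forms r (tangent_space A x). f = form_coord r c x \<alpha>"
    by (intro bexI[of _ ?\<alpha>]) simp_all
qed

lemma basis_tuple_nth_in: "B \<in> J r \<Longrightarrow> k < r \<Longrightarrow> basis_tuple B ! k \<in> S"
  by (rule tuples_nth[OF basis_tuple_in]) (auto simp: index_sets_def)

text \<open>\<open>a\<close> and \<open>b\<close> express how the columns and rows of the minor
  depend on the output index: for multivectors \<open>a\<close> varies and \<open>b\<close> is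
  fixed, for forms conversely. Minors of a differentiable matrix are differentiable by
  \<open>has_cderiv_dxf\<close>.\<close>

lemma minors_has_cderiv:
  assumes g: "\<And>h. h \<in> S \<Longrightarrow> \<exists>D. has_cderiv c (\<lambda>y. g y h) D x"
  shows "\<exists>D. has_cderiv c (\<lambda>y. \<chi> B. if a B \<in> J r \<and> b B \<in> J r
    then dxf (a B) (map (g y) (basis_tuple (b B))) else 0) D x"
proof -
  have "\<exists>D. has_cderiv c (\<lambda>y. if a B \<in> J r \<and> b B \<in> J r
    then dxf (a B) (map (g y) (basis_tuple (b B))) else 0) D x" for B
  proof (cases "a B \<in> J r \<and> b B \<in> J r")
    case True
    then have r: "card (a B) = r" "card (b B) = r" by (auto simp: index_sets_def)
    have "\<exists>D. has_cderiv c (\<lambda>y. map (g y) (basis_tuple (b B)) ! k) D x" if "k < card (a B)" for k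
      using g[of "basis_tuple (b B) ! k"] basis_tuple_nth_in[of "b B" r k] True that r by auto
    then obtain D where
      "\<And>k. k < card (a B) \<Longrightarrow> has_cderiv c (\<lambda>y. map (g y) (basis_tuple (b B)) ! k) (D k) x"
      by metis
    then have "has_cderiv c (\<lambda>y. dxf (a B) (map (g y) (basis_tuple (b B))))
        (\<lambda>h. \<Sum>j<card (a B). dxf (a B) ((map (g x) (basis_tuple (b B)))[j := D j h])) x"
      by (rule has_cderiv_dxf) (use r in auto)
    then have "\<exists>D. has_cderiv c (\<lambda>y. dxf (a B) (map (g y) (basis_tuple (b B)))) D x" by blast
    then show ?thesis using True by (simp del: map_map)
  next
    case False
    then show ?thesis using has_cderiv_const[of c 0 x] by auto
  qed
  then obtain D where "\<And>B. has_cderiv c (\<lambda>y. if a B \<in> J r \<and> b B \<in> J r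
    then dxf (a B) (map (g y) (basis_tuple (b B))) else 0) (D B) x" by metis
  then have "has_cderiv c (\<lambda>y. \<chi> B. if a B \<in> J r \<and> b B \<in> J r
    then dxf (a B) (map (g y) (basis_tuple (b B))) else 0) (\<lambda>h. \<chi> B. D B h) x"
    by (rule has_cderiv_vec)
  then show ?thesis by blast
qed

text \<open>Components of multivectors change by the minors of the Jacobian, and these are
  differentiable because the transition maps are twice differentiable.\<close>

lemma ext_curve_atlas: "curve_atlas (S \<times> coord_space (J r)) (ext_atlas A I r)"
  unfolding ext_atlas_eq
proof (rule bundle_curve_atlas[OF curve_atlas_axioms subspace_coord_space bij_mvec_coord])
  fix c c' x assume c: "c \<in> charts_at A x" "c' \<in> charts_at A x"
  define g where "g C B y = (if B \<in> J r \<and> C \<in> J r then dxf B (map (\<lambda>h. coord_vec A c y h c') (basis_tuple C)) else 0)"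
    for C B y
  have "mvec_coord r c' y u = (\<Sum>C\<in>UNIV. (mvec_coord r c y u $ C) *\<^sub>R (\<chi> B. g C B y))" 
    if y: "y \<in> fst c \<inter> fst c'" and u: "u \<in> ext_power r (tangent_space A y)" for y u
  proof -
    have cy: "c \<in> charts_at A y" "c' \<in> charts_at A y" using y c by (auto simp: charts_at_def)
    have "mvec_coord r c' y u $ B = (\<Sum>C\<in>UNIV. mvec_coord r c y u $ C * g C B y)" for B
    proof (cases "B \<in> J r")
      case True
      have "u (coord_form A c' y B) = (\<Sum>C\<in>J r. coord_form A c' y B (frame c y C) * u (coord_form A c y C))"
        by (rule mvec_expand[OF cy(1) coord_form_in[OF cy(2) True] u])
      also have "\<dots> = (\<Sum>C\<in>J r. mvec_coord r c y u $ C * g C B y)"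
        using True frame_in[OF cy(1)]
        by (intro sum.cong) (auto simp: g_def mvec_coord_def coord_form_eq frame_def comp_def)
      also have "\<dots> = (\<Sum>C\<in>UNIV. mvec_coord r c y u $ C * g C B y)"
        by (rule sum.mono_neutral_left) (auto simp: g_def)
      finally show ?thesis using True by (simp add: mvec_coord_def)
    qed (simp add: mvec_coord_def g_def)
    then show ?thesis by (simp add: vec_eq_iff)
  qed
  moreover have "\<exists>D. has_cderiv c (\<lambda>y. \<chi> B. g C B y) D x" for C
    using minors_has_cderiv[of c "\<lambda>y h. coord_vec A c y h c'" x "\<lambda>B. B" r "\<lambda>_. C", OF transition_derivatives[OF c]]
    unfolding g_def .
  ultimately show "\<exists>G. (\<forall>y\<in>fst c \<inter> fst c'. \<forall>u\<in>ext_power r (tangent_space A y).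
        mvec_coord r c' y u = (\<Sum>b\<in>UNIV. (mvec_coord r c y u $ b) *\<^sub>R G b y)) \<and>
      (\<forall>b. \<exists>D. has_cderiv c (G b) D x)"
    by (intro exI[of _ "\<lambda>C y. \<chi> B. g C B y"]) blast
qed

text \<open>As for multivectors, with the minors of the inverse Jacobian.\<close>

lemma coext_curve_atlas: "curve_atlas (S \<times> coord_space (J r)) (coext_atlas A I r)"
  unfolding coext_atlas_eq
proof (rule bundle_curve_atlas[OF curve_atlas_axioms subspace_coord_space bij_form_coord])
  fix c c' x assume c: "c \<in> charts_at A x" "c' \<in> charts_at A x"
  define g where "g C B y = (if C \<in> J r \<and> B \<in> J r then dxf C (map (\<lambda>h. coord_vec A c' y h c) (basis_tuple B)) else 0)"
    for C B y
  have "form_coord r c' y \<alpha> = (\<Sum>C\<in>UNIV. (form_coord r c y \<alpha> $ C) *\<^sub>R (\<chi> B. g C B y))" 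
    if y: "y \<in> fst c \<inter> fst c'" and \<alpha>: "\<alpha> \<in> alt_forms r (tangent_space A y)" for y \<alpha>
  proof -
    have cy: "c \<in> charts_at A y" "c' \<in> charts_at A y" using y c by (auto simp: charts_at_def)
    have "form_coord r c' y \<alpha> $ B = (\<Sum>C\<in>UNIV. form_coord r c y \<alpha> $ C * g C B y)" for B
    proof (cases "B \<in> J r")
      case True
      have "\<alpha> (frame c' y B) = (\<Sum>C\<in>J r. \<alpha> (frame c y C) * dxf C (map (\<lambda>v. v c) (frame c' y B)))"
        by (rule form_expand[OF cy(1) \<alpha> frame_in[OF cy(2) True]])
      also have "\<dots> = (\<Sum>C\<in>J r. form_coord r c y \<alpha> $ C * g C B y)"
        using True by (intro sum.cong) (auto simp: g_def form_coord_def frame_def comp_def)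
      also have "\<dots> = (\<Sum>C\<in>UNIV. form_coord r c y \<alpha> $ C * g C B y)"
        by (rule sum.mono_neutral_left) (auto simp: g_def)
      finally show ?thesis using True by (simp add: form_coord_def)
    qed (simp add: form_coord_def g_def)
    then show ?thesis by (simp add: vec_eq_iff)
  qed
  moreover have "\<exists>D. has_cderiv c (\<lambda>y. \<chi> B. g C B y) D x" for C
    using minors_has_cderiv[of c "\<lambda>y h. coord_vec A c' y h c" x "\<lambda>_. C" r "\<lambda>B. B", OF inverse_transition_derivatives[OF c]]
    unfolding g_def .
  ultimately show "\<exists>G. (\<forall>y\<in>fst c \<inter> fst c'. \<forall>\<alpha>\<in>alt_forms r (tangent_space A y).
        form_coord r c' y \<alpha> = (\<Sum>b\<in>UNIV. (form_coord r c y \<alpha> $ b) *\<^sub>R G b y)) \<and>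
      (\<forall>b. \<exists>D. has_cderiv c (G b) D x)"
    by (intro exI[of _ "\<lambda>C y. \<chi> B. g C B y"]) blast
qed

sublocale TM: curve_atlas "S \<times> S" "tangent_atlas A"
  by (rule tangent_curve_atlas)

sublocale TB: bundle_atlas S A "tangent_space A" "\<lambda>c x v. v c" S
  by (intro bundle_atlas.intro bundle_atlas_axioms.intro curve_atlas_axioms
      tangent_curve_atlas[unfolded tangent_atlas_eq] bij_coords)

sublocale EB: bundle_atlas S A "\<lambda>x. ext_power k (tangent_space A x)" "mvec_coord k" "coord_space (J k)" for k
  by (intro bundle_atlas.intro bundle_atlas_axioms.intro curve_atlas_axioms ext_curve_atlas[unfolded ext_atlas_eq]
      bij_mvec_coord)

sublocale CB: bundle_atlas S A "\<lambda>x. alt_forms k (tangent_space A x)" "form_coord k" "coord_space (J k)" for k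
  by (intro bundle_atlas.intro bundle_atlas_axioms.intro curve_atlas_axioms coext_curve_atlas[unfolded coext_atlas_eq]
      bij_form_coord)

end

section \<open>The tangent lift of a form in coordinates\<close>

abbreviation omit :: "nat \<Rightarrow> 'b list \<Rightarrow> 'b list" where
  "omit j vs \<equiv> take j vs @ drop (Suc j) vs"

lemma omit_nth: "j < length vs \<Longrightarrow> m < length vs - 1 \<Longrightarrow> omit j vs ! m = (if m < j then vs ! m else vs ! Suc m)"
  by (auto simp: nth_append min_def)

lemma omit_omit: "j \<le> m \<Longrightarrow> Suc m < length vs \<Longrightarrow> omit m (omit j vs) = omit j (omit (Suc m) vs)"
  by (auto simp: list_eq_iff_nth_eq nth_append min_def)

lemma dxf_to_front:
  assumes "length hs = card B" "m < card B"
  shows "dxf B (hs[m := a]) = (- 1) ^ m * dxf B (a # omit m hs)"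
proof -
  have eq: "hs[m := a] = take m hs @ a # drop (Suc m) hs"
    using assms by (simp add: upd_conv_take_nth_drop)
  have tup: "take m hs @ a # drop (Suc m) hs \<in> tuples (card B) UNIV"
    "a # omit m hs \<in> tuples (card B) UNIV"
    using assms by (auto simp: tuples_def)
  show ?thesis
    using alt_form_to_front[OF dxf_in_alt_forms subspace_UNIV tup(1)] tup assms unfolding eq by simp
qed

lemma dxf_update_zero:
  assumes "length hs = card B" "m < card B"
  shows "dxf B (hs[m := 0]) = 0"
  using alt_form_lin[OF dxf_in_alt_forms, of hs B m 0 0 0 0] assms
  by (simp add: tuples_def)

text \<open>The terms \<open>(j, m)\<close> with \<open>m < j\<close> cancel against the terms \<open>(m, j - 1)\<close>.\<close>

lemma alternating_sum_symmetric:
  fixes T :: "'v \<Rightarrow> 'v \<Rightarrow> (real, 'n::{finite,linorder}) vec" and P :: "'v \<Rightarrow> (real, 'n) vec"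
  assumes B: "card B = r" and ws: "length ws = Suc r"
    and T: "\<And>a b. a \<in> set ws \<Longrightarrow> b \<in> set ws \<Longrightarrow> T a b = T b a"
  shows "(\<Sum>j\<le>r. (- 1) ^ j * (\<Sum>m<r. dxf B ((map P (omit j ws))[m := T (omit j ws ! m) (ws ! j)]))) = 0"
proof -
  define h where "h = (\<lambda>(j, m). (- 1) ^ j * dxf B ((map P (omit j ws))[m := T (omit j ws ! m) (ws ! j)]))"
  let ?P1 = "{(j, m). m < j \<and> j \<le> r}" and ?P2 = "{(j, m). j \<le> m \<and> m < r}"
  \<comment> \<open>Moving the entry with \<open>T\<close> to the front costs (-1)^m. Two entries of
    \<open>ws\<close> can be removed in either order (\<open>omit_omit\<close>), and the two terms
    obtained differ by one sign.\<close>
  have h: "h (j, m) = (- 1) ^ (j + m) * dxf B (T (omit j ws ! m) (ws ! j) # map P (omit m (omit j ws)))"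
    if "j \<le> r" "m < r" for j m
  proof -
    have "length (map P (omit j ws)) = card B" using that ws B by simp
    from dxf_to_front[OF this, of m] show ?thesis
      using that B by (simp add: h_def power_add take_map drop_map)
  qed
  have "(\<Sum>x\<in>?P1. h x) = (\<Sum>x\<in>?P2. - h x)"
  proof (rule sum.reindex_bij_witness[of _ "\<lambda>(j, m). (Suc m, j)" "\<lambda>(j, m). (m, j - 1)"])
    fix x assume "x \<in> ?P1"
    then obtain j m where x: "x = (Suc j, m)" "m \<le> j" "Suc j \<le> r"
      by (cases x, case_tac a) auto
    show "- h (case x of (j, m) \<Rightarrow> (m, j - 1)) = h x"
      using x ws h[of "Suc j" m] h[of m j] T[of "ws ! m" "ws ! Suc j"] omit_omit[of m j ws]
      by (simp add: omit_nth add.commute)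
  qed auto
  then have "(\<Sum>x\<in>?P1. h x) + (\<Sum>x\<in>?P2. h x) = 0" by (simp add: sum_negf)
  moreover have "(\<Sum>x\<in>{..r} \<times> {..<r}. h x) = (\<Sum>x\<in>?P1. h x) + (\<Sum>x\<in>?P2. h x)"
  proof -
    have eq: "{..r} \<times> {..<r} = ?P1 \<union> ?P2" by auto
    have "finite (?P1 \<union> ?P2)" unfolding eq[symmetric] by simp
    then show ?thesis unfolding eq by (intro sum.union_disjoint) auto
  qed
  ultimately show ?thesis
    by (simp add: h_def sum.cartesian_product[symmetric] sum_distrib_left)
qed

section \<open>Differentiating a form; the exterior derivative in a chart\<close>

locale manifold_form = manifold X I A for X :: "'a topology" and I :: "'n::{finite,linorder} set"
    and A :: "('a, 'n) natlas" +
  fixes \<mu> :: "'a \<Rightarrow> ('a, 'n) nfib form" and r :: nat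
  assumes \<mu>: "diff_form (coord_space I) A r \<mu>"
begin

lemma \<mu>_in: "x \<in> points A \<Longrightarrow> \<mu> x \<in> alt_forms r (tangent_space A x)"
  using \<mu> by (simp add: diff_form_def)

lemma \<mu>_in_chart: "c \<in> charts_at A x \<Longrightarrow> \<mu> x \<in> alt_forms r (tangent_space A x)"
  by (rule \<mu>_in) (auto simp: points_charts_at)

lemma \<mu>_has_cderiv:
  assumes c: "c \<in> charts_at A x" and hs: "hs \<in> tuples r S"
  shows "\<exists>D. has_cderiv c (\<lambda>y. \<mu> y (map (coord_vec A c y) hs)) D x"
proof -
  have x: "c \<in> A" "x \<in> fst c" using c by (auto simp: charts_at_def)
  let ?f = "\<lambda>p. \<mu> (chart_inv c p) (map (coord_vec A c (chart_inv c p)) hs)"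
  have "smooth_on S (snd c ` fst c) ?f" using \<mu> x(1) hs unfolding diff_form_def by blast
  then have "Ck_on (Suc 0) S (snd c ` fst c) ?f" unfolding smooth_on_def by blast
  then obtain f' where f': "\<forall>p\<in>snd c ` fst c. (?f has_derivative f' p) (at p within snd c ` fst c)"
    unfolding Ck_on.simps(2)[of 0] by blast
  have "has_cderiv c (\<lambda>y. \<mu> y (map (coord_vec A c y) hs)) (f' (snd c x)) x"
  proof (rule has_cderiv_frechet)
    show "(?f has_derivative f' (snd c x)) (at (snd c x) within snd c ` fst c)" using f' x by blast
    fix \<gamma> h assume "curve_in c \<gamma> x h"
    then have "\<forall>\<^sub>F t in nhds 0. \<gamma> t \<in> fst c" by (simp add: curve_in_def)
    then show "\<forall>\<^sub>F t in nhds 0. snd c (\<gamma> t) \<in> snd c ` fst c \<and>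
        \<mu> (\<gamma> t) (map (coord_vec A c (\<gamma> t)) hs) = ?f (snd c (\<gamma> t))"
      by eventually_elim (use x in simp)
  qed
  then show ?thesis by blast
qed

text \<open>The derivative at \<open>x\<close> of the component of \<mu> with index
  \<open>B\<close>. \<open>has_cderiv\<close> determines it only on the model space, where all
  velocities lie; hence the choice.\<close>

definition d\<mu> :: "('a, (real, 'n) vec) chart \<Rightarrow> 'a \<Rightarrow> 'n set \<Rightarrow> (real, 'n) vec \<Rightarrow> real" where
  "d\<mu> c x B = (SOME D. has_cderiv c (\<lambda>y. \<mu> y (frame c y B)) D x)"

lemma d\<mu>: "c \<in> charts_at A x \<Longrightarrow> B \<in> J r \<Longrightarrow> has_cderiv c (\<lambda>y. \<mu> y (frame c y B)) (d\<mu> c x B) x"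
  unfolding d\<mu>_def frame_def
  by (rule someI_ex[OF \<mu>_has_cderiv]) (auto intro: basis_tuple_in simp: index_sets_def)

lemma \<mu>_coords:
  assumes c: "c \<in> charts_at A x" and hs: "hs \<in> tuples r S"
  shows "\<mu> x (map (coord_vec A c x) hs) = (\<Sum>B\<in>J r. \<mu> x (frame c x B) * dxf B hs)"
proof -
  have "map (\<lambda>v. v c) (map (coord_vec A c x) hs) = hs"
    using hs c by (auto simp: tuples_def subset_iff intro!: map_idI)
  with form_expand[OF c \<mu>_in_chart[OF c] tuples_map[OF hs coord_vec_in[OF c]]] show ?thesis by simp
qed

text \<open>Product rule for the expansion of \<mu> in components: one summand comes from the motion
  of the base point, the other from that of the arguments. It serves the exterior derivative, its
  independence of the chart and the tangent lift alike.\<close>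

lemma \<mu>_along_curve:
  assumes c: "c \<in> charts_at A x" and \<gamma>: "curve_in c \<gamma> x k"
    and hs: "\<forall>\<^sub>F t in nhds 0. hs t \<in> tuples r S"
    and hs': "\<And>j. j < r \<Longrightarrow> ((\<lambda>t. hs t ! j) has_vector_derivative hs' ! j) (at 0)"
  shows "((\<lambda>t. \<mu> (\<gamma> t) (map (coord_vec A c (\<gamma> t)) (hs t))) has_vector_derivative
    (\<Sum>B\<in>J r. d\<mu> c x B k * dxf B (hs 0) + \<mu> x (frame c x B) * (\<Sum>j<r. dxf B ((hs 0)[j := hs' ! j])))) (at 0)"
proof -
  have x: "\<gamma> 0 = x" "c \<in> A" using \<gamma> c by (auto simp: curve_in_def charts_at_def)
  have "\<forall>\<^sub>F t in nhds 0. \<gamma> t \<in> fst c" using \<gamma> by (simp add: curve_in_def)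
  then have ev: "\<forall>\<^sub>F t in nhds 0. (\<Sum>B\<in>J r. \<mu> (\<gamma> t) (frame c (\<gamma> t) B) * dxf B (hs t))
      = \<mu> (\<gamma> t) (map (coord_vec A c (\<gamma> t)) (hs t))"
    using hs
  proof eventually_elim
    case (elim t)
    then have "c \<in> charts_at A (\<gamma> t)" using x by (simp add: charts_at_def)
    from \<mu>_coords[OF this elim(2)] show ?case by simp
  qed
  have "length (hs 0) = r" using eventually_nhds_x_imp_x[OF hs] by (simp add: tuples_def)
  then have *: "((\<lambda>t. dxf B (hs t)) has_vector_derivative (\<Sum>j<card B. dxf B ((hs 0)[j := hs' ! j]))) (at 0)"
    if "card B = r" for B
    using hs' that by (intro dxf_has_vector_derivative) auto
  have "((\<lambda>t. \<mu> (\<gamma> t) (frame c (\<gamma> t) B) * dxf B (hs t)) has_vector_derivative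
      d\<mu> c x B k * dxf B (hs 0) + \<mu> x (frame c x B) * (\<Sum>j<r. dxf B ((hs 0)[j := hs' ! j]))) (at 0)"
    if B: "B \<in> J r" for B
  proof -
    have r: "card B = r" using B by (simp add: index_sets_def)
    show ?thesis
      using has_vector_derivative_mult[OF has_cderivD[OF d\<mu>[OF c B] \<gamma>] *[OF r]]
      unfolding x(1) r by (simp add: add.commute)
  qed
  then have "((\<lambda>t. \<Sum>B\<in>J r. \<mu> (\<gamma> t) (frame c (\<gamma> t) B) * dxf B (hs t)) has_vector_derivative
    (\<Sum>B\<in>J r. d\<mu> c x B k * dxf B (hs 0) + \<mu> x (frame c x B) * (\<Sum>j<r. dxf B ((hs 0)[j := hs' ! j])))) (at 0)"
    by (rule has_vector_derivative_sum)
  then show ?thesis by (simp only: hvd_cong[OF ev])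
qed

lemma \<mu>_along_curve_const:
  assumes c: "c \<in> charts_at A x" and \<gamma>: "curve_in c \<gamma> x k" and hs: "hs \<in> tuples r S"
  shows "((\<lambda>t. \<mu> (\<gamma> t) (map (coord_vec A c (\<gamma> t)) hs)) has_vector_derivative
    (\<Sum>B\<in>J r. d\<mu> c x B k * dxf B hs)) (at 0)"
proof -
  have "dxf B (hs[j := 0]) = 0" if "B \<in> J r" "j < r" for B j
    using dxf_update_zero[of hs B j] that hs by (simp add: index_sets_def tuples_def)
  then show ?thesis
    using \<mu>_along_curve[OF c \<gamma>, of "\<lambda>_. hs" "replicate r 0"] hs by simp
qed

text \<open>The formula of \<open>ext_deriv\<close> in a prescribed chart with the derivatives
  carried out; \<open>ext_deriv\<close> itself uses an unspecified chart at the point.\<close>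

definition ext_deriv_coord :: "('a, (real, 'n) vec) chart \<Rightarrow> 'a \<Rightarrow> ('a, 'n) nfib list \<Rightarrow> real" where
  "ext_deriv_coord c x vs = (\<Sum>j\<le>r. (- 1) ^ j *
     (\<Sum>B\<in>J r. d\<mu> c x B ((vs ! j) c) * dxf B (map (\<lambda>v. v c) (omit j vs))))"

lemma tuples_omit: "vs \<in> tuples (Suc m) V \<Longrightarrow> j \<le> m \<Longrightarrow> omit j vs \<in> tuples m V"
  by (auto simp: tuples_def dest: in_set_takeD in_set_dropD)

text \<open>The derivative of the transition map contributes the second derivatives \<open>T h k\<close>, whose alternating sum
  vanishes by symmetry.\<close>

lemma ext_deriv_coord_change:
  assumes c: "c \<in> charts_at A x" "c' \<in> charts_at A x" and vs: "vs \<in> tuples (Suc r) (tangent_space A x)"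
  shows "ext_deriv_coord c x vs = ext_deriv_coord c' x vs"
proof -
  obtain L where L: "has_cderiv c (snd c') L x" using transition[OF c] by blast
  obtain T where T: "\<And>h. h \<in> S \<Longrightarrow> has_cderiv c (\<lambda>y. coord_vec A c y h c') (T h) x"
    and sym: "\<And>h k. h \<in> S \<Longrightarrow> k \<in> S \<Longrightarrow> T h k = T k h"
    by (rule coord_vec_has_cderiv[OF M c]) (rule that)
  let ?m = "\<lambda>B. \<mu> x (frame c' x B)"
  \<comment> \<open>One function of time is differentiated in both charts. Arguments with constant
    components \<open>hs\<close> in \<open>c\<close> have moving components in \<open>c'\<close>,
    whose derivatives \<open>T h k\<close> produce the additional sum.\<close>
  have *: "(\<Sum>B\<in>J r. d\<mu> c x B k * dxf B hs) =
      (\<Sum>B\<in>J r. d\<mu> c' x B (L k) * dxf B (map L hs) + ?m B * (\<Sum>j<r. dxf B ((map L hs)[j := T (hs ! j) k])))"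
    if k: "k \<in> S" and hs: "hs \<in> tuples r S" for k hs
  proof -
    obtain \<gamma> where \<gamma>: "curve_in c \<gamma> x k" using curve_in_line(1)[OF c(1) k] by blast
    then have x: "\<gamma> 0 = x" by (simp add: curve_in_def)
    have \<gamma>': "curve_in c' \<gamma> x (L k)" by (rule curve_in_change[OF c L \<gamma>])
    let ?hs = "\<lambda>t. map (\<lambda>h. coord_vec A c (\<gamma> t) h c') hs"
    have Lh: "?hs 0 = map L hs"
      using hs by (auto simp: x coord_vec_apply[OF c L] tuples_def)
    have at: "\<forall>\<^sub>F t in nhds 0. c \<in> charts_at A (\<gamma> t) \<and> c' \<in> charts_at A (\<gamma> t)"
      using domain_nhd[OF c \<gamma>] \<gamma>[unfolded curve_in_def, THEN conjunct2, THEN conjunct1] c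
      by (auto simp: charts_at_def elim: eventually_elim2)
    then have hs_in: "\<forall>\<^sub>F t in nhds 0. ?hs t \<in> tuples r S"
    proof eventually_elim
      case (elim t)
      then show ?case by (auto intro!: tuples_map[OF hs] coords_in_S[of c'] coord_vec_in[of c])
    qed
    have der: "((\<lambda>t. ?hs t ! j) has_vector_derivative map (\<lambda>h. T h k) hs ! j) (at 0)" if "j < r" for j
      using has_cderivD[OF T[OF tuples_nth[OF hs that]] \<gamma>] that tuplesD(1)[OF hs] by simp
    have eq: "\<forall>\<^sub>F t in nhds 0. \<mu> (\<gamma> t) (map (coord_vec A c' (\<gamma> t)) (?hs t)) = \<mu> (\<gamma> t) (map (coord_vec A c (\<gamma> t)) hs)"
      using at
    proof eventually_elim
      case (elim t)
      then have "map (coord_vec A c' (\<gamma> t)) (?hs t) = map (coord_vec A c (\<gamma> t)) hs"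
        using hs by (auto simp: tuples_def subset_iff coord_vec_in)
      then show ?case by (rule arg_cong)
    qed
    have "(\<Sum>j<r. dxf B ((map L hs)[j := map (\<lambda>h. T h k) hs ! j])) = (\<Sum>j<r. dxf B ((map L hs)[j := T (hs ! j) k]))" for B
      by (rule sum.cong) (use hs in \<open>auto simp: tuples_def\<close>)
    then show ?thesis
      using vector_derivative_unique_at[OF \<mu>_along_curve_const[OF c(1) \<gamma> hs]
          \<mu>_along_curve[OF c(2) \<gamma>' hs_in der, unfolded hvd_cong[OF eq]]] unfolding Lh by simp
  qed
  let ?ws = "map (\<lambda>v. v c) vs"
  have vs': "vs ! j \<in> tangent_space A x" if "j \<le> r" for j using tuples_nth[OF vs] that by simp
  have Lv: "L (v c) = v c'" if "v \<in> tangent_space A x" for v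
    using coord_vec_apply[OF c L coords_in_S[OF c(1) that]] coord_vec_coords[OF c(1) that] by simp
  have "ext_deriv_coord c x vs = (\<Sum>j\<le>r. (- 1) ^ j * (\<Sum>B\<in>J r.
      d\<mu> c' x B ((vs ! j) c') * dxf B (map (\<lambda>v. v c') (omit j vs)) +
      ?m B * (\<Sum>m<r. dxf B ((map L (omit j ?ws))[m := T (omit j ?ws ! m) (?ws ! j)]))))"
    unfolding ext_deriv_coord_def
  proof (rule sum.cong[OF refl], rule arg_cong2[OF refl, of _ _ "(*)"])
    fix j assume j: "j \<in> {..r}"
    have om: "omit j vs \<in> tuples r (tangent_space A x)" using tuples_omit[OF vs] j by simp
    have vj: "vs ! j \<in> tangent_space A x" using vs'[of j] j by simp
    have omS: "map (\<lambda>v. v c) (omit j vs) \<in> tuples r S"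
      by (rule tuples_map[OF om]) (rule coords_in_S[OF c(1)])
    have 1: "map L (map (\<lambda>v. v c) (omit j vs)) = map (\<lambda>v. v c') (omit j vs)"
      unfolding map_map comp_def using Lv tuplesD(2)[OF om] by (intro map_cong refl) blast
    have 2: "map (\<lambda>v. v c) (omit j vs) = omit j ?ws" by (simp add: take_map drop_map)
    have 3: "?ws ! j = (vs ! j) c" using j vs by (simp add: tuples_def)
    show "(\<Sum>B\<in>J r. d\<mu> c x B ((vs ! j) c) * dxf B (map (\<lambda>v. v c) (omit j vs))) = (\<Sum>B\<in>J r.
      d\<mu> c' x B ((vs ! j) c') * dxf B (map (\<lambda>v. v c') (omit j vs)) +
      ?m B * (\<Sum>m<r. dxf B ((map L (omit j ?ws))[m := T (omit j ?ws ! m) (?ws ! j)])))"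
      using *[OF coords_in_S[OF c(1) vj] omS] unfolding 3 2[symmetric] 1 Lv[OF vj] by simp
  qed
  \<comment> \<open>The additional sums are collected for each \<open>B\<close>, because their
    alternating sum over \<open>j\<close> vanishes for each \<open>B\<close> separately.\<close>
  also have "\<dots> = ext_deriv_coord c' x vs + (\<Sum>B\<in>J r. ?m B *
      (\<Sum>j\<le>r. (- 1) ^ j * (\<Sum>m<r. dxf B ((map L (omit j ?ws))[m := T (omit j ?ws ! m) (?ws ! j)]))))"
  proof -
    have "(\<Sum>j\<le>r. (- 1) ^ j * (\<Sum>B\<in>J r. f j B + ?m B * g j B)) =
      (\<Sum>j\<le>r. (- 1) ^ j * (\<Sum>B\<in>J r. f j B)) + (\<Sum>B\<in>J r. ?m B * (\<Sum>j\<le>r. (- 1) ^ j * g j B))"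
      for f g :: "nat \<Rightarrow> 'n set \<Rightarrow> real"
    proof -
      have "(\<Sum>B\<in>J r. ?m B * (\<Sum>j\<le>r. (- 1) ^ j * g j B)) = (\<Sum>j\<le>r. (- 1) ^ j * (\<Sum>B\<in>J r. ?m B * g j B))"
        unfolding sum_distrib_left by (subst sum.swap) (simp add: ac_simps)
      then show ?thesis by (simp add: sum.distrib distrib_left)
    qed
    then show ?thesis unfolding ext_deriv_coord_def .
  qed
  also have "(\<Sum>B\<in>J r. ?m B * (\<Sum>j\<le>r. (- 1) ^ j *
      (\<Sum>m<r. dxf B ((map L (omit j ?ws))[m := T (omit j ?ws ! m) (?ws ! j)])))) = 0"
  proof (rule sum.neutral, rule ballI)
    fix B assume B: "B \<in> J r"
    have "(\<Sum>j\<le>r. (- 1) ^ j * (\<Sum>m<r. dxf B ((map L (omit j ?ws))[m := T (omit j ?ws ! m) (?ws ! j)]))) = 0"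
      by (rule alternating_sum_symmetric)
        (use B vs sym coords_in_S[OF c(1)] in \<open>auto simp: index_sets_def tuples_def subset_iff\<close>)
    then show "?m B * (\<Sum>j\<le>r. (- 1) ^ j *
      (\<Sum>m<r. dxf B ((map L (omit j ?ws))[m := T (omit j ?ws ! m) (?ws ! j)]))) = 0" by simp
  qed
  finally show ?thesis by simp
qed

lemma ext_deriv_eq:
  assumes c: "c \<in> charts_at A x" and vs: "vs \<in> tuples (Suc r) (tangent_space A x)"
  shows "ext_deriv A r \<mu> x vs = ext_deriv_coord c x vs"
proof -
  define c' where "c' = (SOME c. c \<in> charts_at A x)"
  have c': "c' \<in> charts_at A x" unfolding c'_def using c by (rule someI)
  have "ext_deriv A r \<mu> x vs = ext_deriv_coord c' x vs"
    using vs unfolding ext_deriv_def ext_deriv_coord_def Let_def c'_def[symmetric]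
  proof (simp only: if_True, intro sum.cong refl arg_cong2[where f = "(*)"])
    fix j assume j: "j \<in> {..r}"
    then have vj: "vs ! j \<in> tangent_space A x" using tuples_nth[OF vs] by simp
    have om: "map (\<lambda>v. v c') (omit j vs) \<in> tuples r S"
      using tuples_omit[OF vs] j coords_in_S[OF c'] by (intro tuples_map) auto
    have "((\<lambda>t. let y = chart_inv c' (snd c' x + t *\<^sub>R (vs ! j) c')
        in \<mu> y (map (\<lambda>v. coord_vec A c' y (v c')) (omit j vs))) has_vector_derivative
      (\<Sum>B\<in>J r. d\<mu> c' x B ((vs ! j) c') * dxf B (map (\<lambda>v. v c') (omit j vs)))) (at 0)"
      using \<mu>_along_curve_const[OF c' curve_in_line(1)[OF c' coords_in_S[OF c' vj]] om]
      by (simp add: Let_def comp_def)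
    then show "deriv (\<lambda>t. \<mu> (chart_inv c' (snd c' x + t *\<^sub>R (vs ! j) c'))
        (map (\<lambda>v. coord_vec A c' (chart_inv c' (snd c' x + t *\<^sub>R (vs ! j) c')) (v c')) (omit j vs))) 0 =
      (\<Sum>B\<in>J r. d\<mu> c' x B ((vs ! j) c') * dxf B (map (\<lambda>v. v c') (omit j vs)))"
      by (intro DERIV_imp_deriv) (simp add: has_real_derivative_iff_has_vector_derivative Let_def)
  qed
  then show ?thesis using ext_deriv_coord_change[OF c c' vs] by simp
qed

end

section \<open>The second tangent bundle and the interior product with the velocity\<close>

context manifold begin

abbreviation TC :: "('a, (real, 'n) vec) chart \<Rightarrow> (('a, 'n) nvec, (real, 'n) vec \<times> (real, 'n) vec) chart" where
  "TC \<equiv> tangent_chart A"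

abbreviation TTS :: "('a, 'n) nvec \<Rightarrow> ('a, 'n) nnfib set" where
  "TTS \<equiv> tangent_space (tangent_atlas A)"

lemma charts_at_TM:
  "C \<in> charts_at (tangent_atlas A) (x, q) \<longleftrightarrow> (\<exists>c\<in>charts_at A x. C = TC c) \<and> q \<in> tangent_space A x"
proof -
  have "(x, q) \<in> fst (TC c) \<longleftrightarrow> q \<in> tangent_space A x \<and> x \<in> fst c" for c
    by (simp add: tangent_chart_def tangent_bundle_iff)
  then show ?thesis unfolding charts_at_def tangent_atlas_def by blast
qed

lemma TC_at: "c \<in> charts_at A x \<Longrightarrow> q \<in> tangent_space A x \<Longrightarrow> TC c \<in> charts_at (tangent_atlas A) (x, q)"
  by (auto simp: charts_at_TM)

lemma TM_points: "v \<in> TTS (x, q) \<Longrightarrow> q \<in> tangent_space A x"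
  using TM.tangent_space_points[of v "(x, q)"] TM.points_charts_at by (auto simp: charts_at_TM)

lemma curve_in_TC:
  assumes "c \<in> A"
  shows "curve_in (TC c) \<gamma> w k \<longleftrightarrow>
    \<gamma> 0 = w \<and> (\<forall>\<^sub>F t in nhds 0. snd (\<gamma> t) \<in> tangent_space A (fst (\<gamma> t))) \<and>
    curve_in c (\<lambda>t. fst (\<gamma> t)) (fst w) (fst k) \<and>
    ((\<lambda>t. snd (\<gamma> t) c) has_vector_derivative snd k) (at 0)"
  unfolding tangent_chart_eq[OF assms] by (rule curve_in_bundle_chart)

text \<open>\<open>hor\<close> is the coordinate \<delta>x of a vector tangent to the tangent
  bundle, equally its base velocity, and \<open>ver\<close> is the \<delta> of the velocity
  coordinate.\<close>

definition hor :: "('a, (real, 'n) vec) chart \<Rightarrow> ('a, 'n) nnfib \<Rightarrow> (real, 'n) vec" where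
  "hor c v = fst (v (TC c))"

definition ver :: "('a, (real, 'n) vec) chart \<Rightarrow> ('a, 'n) nnfib \<Rightarrow> (real, 'n) vec" where
  "ver c v = snd (v (TC c))"

lemma hor_ver_in:
  assumes "c \<in> charts_at A x" "v \<in> TTS (x, q)"
  shows "hor c v \<in> S" "ver c v \<in> S"
  using TM.coords_in_S[OF TC_at[OF assms(1) TM_points[OF assms(2)]] assms(2)]
  by (auto simp: hor_def ver_def mem_Times_iff)

lemma hor_ver_lin:
  "hor c (s *\<^sub>R a + t *\<^sub>R b) = s *\<^sub>R hor c a + t *\<^sub>R hor c b"
  "ver c (s *\<^sub>R a + t *\<^sub>R b) = s *\<^sub>R ver c a + t *\<^sub>R ver c b"
  by (simp_all add: hor_def ver_def scaleR_fun_def)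

lemma hor_ver_coord_vec:
  assumes "c \<in> charts_at A x" "q \<in> tangent_space A x" "h \<in> S" "k \<in> S"
  shows "hor c (coord_vec (tangent_atlas A) (TC c) (x, q) (h, k)) = h"
    "ver c (coord_vec (tangent_atlas A) (TC c) (x, q) (h, k)) = k"
  using TM.coord_vec_self[OF TC_at[OF assms(1,2)], of "(h, k)"] assms by (auto simp: hor_def ver_def)

lemma subspace_TTS: "c \<in> charts_at A x \<Longrightarrow> q \<in> tangent_space A x \<Longrightarrow> subspace (TTS (x, q))"
  by (rule TM.subspace_tangent_space[OF TC_at])

lemma tangent_map_proj:
  assumes c: "c \<in> charts_at A x" and v: "v \<in> TTS (x, q)"
  shows "tangent_map (tangent_atlas A) A fst ((x, q), v) = (x, coord_vec A c x (hor c v))"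
  using TB.tangent_map_projection[OF c v[unfolded tangent_atlas_eq]] c
  unfolding tangent_atlas_eq[symmetric] by (simp add: hor_def charts_at_def tangent_chart_eq)


lemma pullback_proj:
  assumes c: "c \<in> charts_at A x" and vs: "vs \<in> tuples m (TTS (x, q))"
  shows "v_T A m \<nu> (x, q) vs = \<nu> x (map (\<lambda>v. coord_vec A c x (hor c v)) vs)"
proof -
  have "map (\<lambda>v. snd (tangent_map (tangent_atlas A) A fst ((x, q), v))) vs = map (\<lambda>v. coord_vec A c x (hor c v)) vs"
    using vs tangent_map_proj[OF c] by (auto simp: tuples_def)
  from arg_cong[OF this, of "\<nu> x"] show ?thesis using vs by (simp add: v_T_def pullback_form_def)
qed

text \<open>The field has components (q, 0) in a chart selected at each base point; an arbitrary
  selection will do, since \<open>second_order\<close> is a pointwise condition.\<close>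

lemma ex_second_order: "\<exists>\<Gamma>. second_order A \<Gamma>"
proof -
  define ch where "ch x = (SOME c. c \<in> charts_at A x)" for x
  define \<Gamma> where "\<Gamma> = (\<lambda>w. (w, coord_vec (tangent_atlas A) (TC (ch (fst w))) w (snd w (ch (fst w)), 0)))"
  have "second_order A \<Gamma>"
    unfolding second_order_def
  proof
    fix w assume "w \<in> tangent_bundle A"
    then obtain x q where w: "w = (x, q)" and q: "q \<in> tangent_space A x"
      by (cases w) (auto simp: tangent_bundle_iff)
    have "charts_at A x \<noteq> {}" using tangent_space_points[OF q] points_charts_at by simp
    then have c: "ch x \<in> charts_at A x" unfolding ch_def by (simp add: some_in_eq)
    have h: "q (ch x) \<in> S" "0 \<in> S" using coords_in_S[OF c q] subspace by (auto simp: subspace_0)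
    let ?v = "coord_vec (tangent_atlas A) (TC (ch x)) (x, q) (q (ch x), 0)"
    have v: "?v \<in> TTS (x, q)"
      by (rule TM.coord_vec_in[OF TC_at[OF c q]]) (use h in simp)
    show "\<Gamma> w \<in> tangent_bundle (tangent_atlas A) \<and> fst (\<Gamma> w) = w \<and>
        tangent_map (tangent_atlas A) A fst (\<Gamma> w) = w"
      using v tangent_map_proj[OF c v] hor_ver_coord_vec[OF c q h] c q
      by (simp add: \<Gamma>_def w tangent_bundle_iff)
  qed
  then show ?thesis by blast
qed

text \<open>The pulled back form sees horizontal components only, and every second order field has
  \<open>q\<close> as its horizontal component; so the field chosen in \<open>i_T\<close> disappears
  from the formula.\<close>

lemma i_T_eq:
  assumes c: "c \<in> charts_at A x" and q: "q \<in> tangent_space A x" and vs: "vs \<in> tuples m (TTS (x, q))"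
  shows "i_T A (Suc m) \<nu> (x, q) vs = \<nu> x (q # map (\<lambda>v. coord_vec A c x (hor c v)) vs)"
proof -
  define \<Gamma> where "\<Gamma> = (SOME \<Gamma>. second_order A \<Gamma>)"
  have "second_order A \<Gamma>" unfolding \<Gamma>_def using ex_second_order by (rule someI_ex)
  then have "\<Gamma> (x, q) \<in> tangent_bundle (tangent_atlas A) \<and> fst (\<Gamma> (x, q)) = (x, q) \<and>
      tangent_map (tangent_atlas A) A fst (\<Gamma> (x, q)) = (x, q)"
    using q by (auto simp: second_order_def tangent_bundle_iff)
  then obtain g where g: "\<Gamma> (x, q) = ((x, q), g)" "g \<in> TTS (x, q)"
    "tangent_map (tangent_atlas A) A fst ((x, q), g) = (x, q)"
    by (metis eq_fst_iff tangent_bundle_iff)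
  have q': "coord_vec A c x (hor c g) = q" using tangent_map_proj[OF c g(2)] g(3) by simp
  have "i_T A (Suc m) \<nu> (x, q) vs = v_T A (Suc m) \<nu> (x, q) (g # vs)"
    using vs by (simp add: i_T_def \<Gamma>_def[symmetric] interior_prod_def g(1))
  also have "\<dots> = \<nu> x (q # map (\<lambda>v. coord_vec A c x (hor c v)) vs)"
    using pullback_proj[OF c, of "g # vs" "Suc m" q \<nu>] vs g q' by simp
  finally show ?thesis .
qed

lemma i_T_outside: "vs \<notin> tuples m (TTS (x, q)) \<Longrightarrow> i_T A (Suc m) \<nu> (x, q) vs = 0"
  by (simp add: i_T_def interior_prod_def)

end

section \<open>The tangent lift in coordinates\<close>

context manifold_form begin

text \<open>The derivative at \<open>t = 0\<close> of \<open>\<mu>\<close> along a curve with velocity \<open>q\<close>, on the vectors with components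
  \<open>hor c v + t *\<^sub>R ver c v\<close>.\<close>

definition lift_coord :: "('a, (real, 'n) vec) chart \<Rightarrow> 'a \<Rightarrow> ('a, 'n) nfib \<Rightarrow> ('a, 'n) nnfib list \<Rightarrow> real" where
  "lift_coord c x q vs = (\<Sum>B\<in>J r. d\<mu> c x B (q c) * dxf B (map (hor c) vs) +
     \<mu> x (frame c x B) * (\<Sum>j<r. dxf B ((map (hor c) vs)[j := ver c (vs ! j)])))"

text \<open>The exterior derivative is evaluated on \<open>q\<close> followed by the horizontal
  parts. The term omitting \<open>q\<close> differentiates along \<open>q\<close>; in the others
  \<open>q\<close> stays in front and the index is shifted by one, whence the minus sign.\<close>

lemma i_T_ext_deriv:
  assumes c: "c \<in> charts_at A x" and q: "q \<in> tangent_space A x" and vs: "vs \<in> tuples r (TTS (x, q))"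
  shows "i_T A (Suc r) (ext_deriv A r \<mu>) (x, q) vs =
    (\<Sum>B\<in>J r. d\<mu> c x B (q c) * dxf B (map (hor c) vs)) -
    (\<Sum>j<r. (- 1) ^ j * (\<Sum>B\<in>J r. d\<mu> c x B (hor c (vs ! j)) * dxf B (q c # omit j (map (hor c) vs))))"
proof -
  let ?us = "q # map (\<lambda>v. coord_vec A c x (hor c v)) vs"
  have hvs: "v \<in> set vs \<Longrightarrow> hor c v \<in> S" for v using hor_ver_in(1)[OF c] tuplesD(2)[OF vs] by blast
  have us: "?us \<in> tuples (Suc r) (tangent_space A x)"
    using q hvs vs coord_vec_in[OF c] by (auto simp: tuples_def)
  have m: "map (\<lambda>v. v c) (map (\<lambda>v. coord_vec A c x (hor c v)) vs) = map (hor c) vs"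
    using hvs c by auto
  have "i_T A (Suc r) (ext_deriv A r \<mu>) (x, q) vs = ext_deriv_coord c x ?us"
    unfolding i_T_eq[OF c q vs] by (rule ext_deriv_eq[OF c us])
  also have "\<dots> = (\<Sum>B\<in>J r. d\<mu> c x B (q c) * dxf B (map (hor c) vs)) +
    (\<Sum>j<r. (- 1) ^ Suc j * (\<Sum>B\<in>J r. d\<mu> c x B (hor c (vs ! j)) * dxf B (q c # omit j (map (hor c) vs))))"
    unfolding ext_deriv_coord_def sum.atMost_shift
  proof (rule arg_cong2[where f = "(+)"], goal_cases)
    case 1
    show "(- 1) ^ 0 * (\<Sum>B\<in>J r. d\<mu> c x B ((?us ! 0) c) * dxf B (map (\<lambda>v. v c) (omit 0 ?us))) =
      (\<Sum>B\<in>J r. d\<mu> c x B (q c) * dxf B (map (hor c) vs))"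
      using arg_cong[OF m, of "dxf _"] by simp
  next
    case 2
    show ?case
    proof (rule sum.cong[OF refl])
      fix j assume j: "j \<in> {..<r}"
      then have "(?us ! Suc j) c = hor c (vs ! j)" using vs hvs c by (simp add: tuples_def)
      moreover have "map (\<lambda>v. v c) (omit (Suc j) ?us) = q c # omit j (map (hor c) vs)"
        using arg_cong[OF m, of "take j"] arg_cong[OF m, of "drop (Suc j)"] by (simp add: take_map drop_map)
      ultimately show "(- 1) ^ Suc j * (\<Sum>B\<in>J r. d\<mu> c x B ((?us ! Suc j) c) * dxf B (map (\<lambda>v. v c) (omit (Suc j) ?us))) =
        (- 1) ^ Suc j * (\<Sum>B\<in>J r. d\<mu> c x B (hor c (vs ! j)) * dxf B (q c # omit j (map (hor c) vs)))"
        by simp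
    qed
  qed
  finally show ?thesis by (simp add: sum_negf)
qed

text \<open>Along the coordinate line in direction \<open>vs ! j\<close> the base point moves with
  \<open>hor\<close>, the velocity, which \<open>i_T\<close> inserts in front, moves with
  \<open>ver\<close>, and the other arguments keep their components.\<close>

lemma deriv_i_T:
  assumes c: "c \<in> charts_at A x" and q: "q \<in> tangent_space A x" and r: "r = Suc m"
    and vs: "vs \<in> tuples r (TTS (x, q))" and j: "j < r"
  shows "deriv (\<lambda>t. let y = chart_inv (TC c) (snd (TC c) (x, q) + t *\<^sub>R (vs ! j) (TC c))
      in i_T A r \<mu> y (map (\<lambda>v. coord_vec (tangent_atlas A) (TC c) y (v (TC c))) (omit j vs))) 0 =
    (\<Sum>B\<in>J r. d\<mu> c x B (hor c (vs ! j)) * dxf B (q c # omit j (map (hor c) vs)) +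
      \<mu> x (frame c x B) * dxf B (ver c (vs ! j) # omit j (map (hor c) vs)))" (is "_ = ?R")
proof -
  have cA: "c \<in> A" using c by (simp add: charts_at_def)
  have C: "TC c \<in> charts_at (tangent_atlas A) (x, q)" by (rule TC_at[OF c q])
  have vj: "vs ! j \<in> TTS (x, q)" using tuples_nth[OF vs j] .
  define \<gamma> where "\<gamma> = (\<lambda>t. chart_inv (TC c) (snd (TC c) (x, q) + t *\<^sub>R (vs ! j) (TC c)))"
  have \<gamma>: "curve_in (TC c) \<gamma> (x, q) ((vs ! j) (TC c))"
    unfolding \<gamma>_def by (rule TM.curve_in_line(1)[OF C TM.coords_in_S[OF C vj]])
  then have \<gamma>0: "\<gamma> 0 = (x, q)" and \<gamma>_ev: "\<forall>\<^sub>F t in nhds 0. snd (\<gamma> t) \<in> tangent_space A (fst (\<gamma> t))"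
    and \<gamma>_base: "curve_in c (\<lambda>t. fst (\<gamma> t)) x (hor c (vs ! j))"
    and \<gamma>_der: "((\<lambda>t. snd (\<gamma> t) c) has_vector_derivative ver c (vs ! j)) (at 0)"
    unfolding curve_in_TC[OF cA] by (auto simp: hor_def ver_def)
  have at: "\<forall>\<^sub>F t in nhds 0. c \<in> charts_at A (fst (\<gamma> t)) \<and> snd (\<gamma> t) \<in> tangent_space A (fst (\<gamma> t))"
    using \<gamma>_ev \<gamma>_base[unfolded curve_in_def, THEN conjunct2, THEN conjunct1] cA
    by (auto simp: charts_at_def elim: eventually_elim2)
  let ?hs = "\<lambda>t. snd (\<gamma> t) c # omit j (map (hor c) vs)"
  \<comment> \<open>Only slot 0 moves, so the terms of the product rule for the other slots contain
    a zero vector and vanish.\<close>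
  let ?hs' = "ver c (vs ! j) # replicate m 0"
  have len: "length vs = Suc m" using vs r by (simp add: tuples_def)
  have om: "omit j vs \<in> tuples m (TTS (x, q))" using tuples_omit[of vs m] vs j r by simp
  have omS: "omit j (map (hor c) vs) \<in> tuples m S"
    using tuples_map[OF om hor_ver_in(1)[OF c]] by (simp add: take_map drop_map)
  have hs_in: "\<forall>\<^sub>F t in nhds 0. ?hs t \<in> tuples r S"
    using at
  proof eventually_elim
    case (elim t)
    then show ?case using coords_in_S[of c "fst (\<gamma> t)" "snd (\<gamma> t)"] omS by (simp add: r)
  qed
  have hs_der: "((\<lambda>t. ?hs t ! k) has_vector_derivative ?hs' ! k) (at 0)" if "k < r" for k
    using that \<gamma>_der by (cases k) (simp_all add: r)
  have eq: "\<forall>\<^sub>F t in nhds 0. \<mu> (fst (\<gamma> t)) (map (coord_vec A c (fst (\<gamma> t))) (?hs t)) =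
     i_T A r \<mu> (\<gamma> t) (map (\<lambda>v. coord_vec (tangent_atlas A) (TC c) (\<gamma> t) (v (TC c))) (omit j vs))"
    using at
  proof eventually_elim
    case (elim t)
    define y p where "y = fst (\<gamma> t)" and "p = snd (\<gamma> t)"
    have yp: "\<gamma> t = (y, p)" by (simp add: y_def p_def)
    have c': "c \<in> charts_at A y" "p \<in> tangent_space A y" using elim by (auto simp: yp)
    let ?f = "\<lambda>v. coord_vec (tangent_atlas A) (TC c) (y, p) (v (TC c))"
    have f: "?f v \<in> TTS (y, p)" "hor c (?f v) = hor c v" if "v \<in> TTS (x, q)" for v
      using TM.coord_vec_in[OF TC_at[OF c'], of "v (TC c)"] TM.coords_in_S[OF C that]
        TM.coord_vec_self[OF TC_at[OF c'], of "v (TC c)"] by (auto simp: hor_def)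
    have "map ?f (omit j vs) \<in> tuples m (TTS (y, p))" using tuples_map[OF om f(1)] .
    from i_T_eq[OF c' this, of \<mu>]
    have "i_T A r \<mu> (y, p) (map ?f (omit j vs)) = \<mu> y (p # map (\<lambda>v. coord_vec A c y (hor c v)) (map ?f (omit j vs)))"
      by (simp only: r)
    also have "map (\<lambda>v. coord_vec A c y (hor c v)) (map ?f (omit j vs)) = map (coord_vec A c y) (map (hor c) (omit j vs))"
      using f(2) om by (auto simp: tuples_def subset_iff)
    finally show ?case using coord_vec_coords[OF c'] by (simp add: yp take_map drop_map)
  qed
  have "((\<lambda>t. i_T A r \<mu> (\<gamma> t) (map (\<lambda>v. coord_vec (tangent_atlas A) (TC c) (\<gamma> t) (v (TC c))) (omit j vs)))
      has_vector_derivative (\<Sum>B\<in>J r. d\<mu> c x B (hor c (vs ! j)) * dxf B (?hs 0) +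
        \<mu> x (frame c x B) * (\<Sum>k<r. dxf B ((?hs 0)[k := ?hs' ! k])))) (at 0)"
    using \<mu>_along_curve[OF c \<gamma>_base hs_in hs_der, unfolded hvd_cong[OF eq]] .
  moreover have "(\<Sum>k<r. dxf B ((?hs 0)[k := ?hs' ! k])) = dxf B (ver c (vs ! j) # omit j (map (hor c) vs))"
    if B: "B \<in> J r" for B
  proof -
    have "dxf B ((?hs 0)[Suc k := ?hs' ! Suc k]) = 0" if "k < m" for k
      using dxf_update_zero[of "?hs 0" B "Suc k"] that B omS by (simp add: index_sets_def r tuples_def)
    then show ?thesis unfolding r sum.lessThan_Suc_shift by simp
  qed
  ultimately have "((\<lambda>t. i_T A r \<mu> (\<gamma> t) (map (\<lambda>v. coord_vec (tangent_atlas A) (TC c) (\<gamma> t) (v (TC c))) (omit j vs)))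
      has_vector_derivative ?R) (at 0)"
    by (simp add: \<gamma>0)
  then show ?thesis
    unfolding \<gamma>_def Let_def by (intro DERIV_imp_deriv) (simp add: has_real_derivative_iff_has_vector_derivative)
qed

text \<open>The terms with \<open>q c\<close> in front cancel between the two summands of
  \<open>d_T\<close>, and those with \<open>ver\<close> return from the front to slot
  \<open>j\<close>, absorbing the sign. The chart is the one that \<open>ext_deriv\<close> selects
  in the tangent atlas; by \<open>charts_at_TM\<close> it is some \<open>TC c\<close>.\<close>

lemma d_T_eq:
  assumes q: "q \<in> tangent_space A x"
  shows "\<exists>c\<in>charts_at A x. \<forall>vs. d_T A r \<mu> (x, q) vs = (if vs \<in> tuples r (TTS (x, q)) then lift_coord c x q vs else 0)"
proof -
  define C where "C = (SOME C. C \<in> charts_at (tangent_atlas A) (x, q))"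
  obtain c\<^sub>0 where "c\<^sub>0 \<in> charts_at A x" using tangent_space_points[OF q] points_charts_at by auto
  then have "C \<in> charts_at (tangent_atlas A) (x, q)"
    unfolding C_def using TC_at[OF _ q] by (intro someI[of "\<lambda>C. C \<in> charts_at (tangent_atlas A) (x, q)"])
  then obtain c where c: "c \<in> charts_at A x" "C = TC c" by (auto simp: charts_at_TM)
  have "d_T A r \<mu> (x, q) vs = (if vs \<in> tuples r (TTS (x, q)) then lift_coord c x q vs else 0)" for vs
  proof (cases "vs \<in> tuples r (TTS (x, q))")
    case True
    \<comment> \<open>For \<open>r = 0\<close> the sum on the right is empty, in accordance with the
      case distinction in \<open>d_T\<close>.\<close>
    have first: "(if r = 0 then 0 else ext_deriv (tangent_atlas A) (r - 1) (i_T A r \<mu>)) (x, q) vs =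
      (\<Sum>j<r. (- 1) ^ j * (\<Sum>B\<in>J r. d\<mu> c x B (hor c (vs ! j)) * dxf B (q c # omit j (map (hor c) vs)) +
        \<mu> x (frame c x B) * dxf B (ver c (vs ! j) # omit j (map (hor c) vs))))"
    proof (cases r)
      case (Suc m)
      have "ext_deriv (tangent_atlas A) m (i_T A r \<mu>) (x, q) vs = (\<Sum>j\<le>m. (- 1) ^ j *
        deriv (\<lambda>t. let y = chart_inv (TC c) (snd (TC c) (x, q) + t *\<^sub>R (vs ! j) (TC c))
          in i_T A r \<mu> y (map (\<lambda>v. coord_vec (tangent_atlas A) (TC c) y (v (TC c))) (omit j vs))) 0)"
        using True unfolding ext_deriv_def Let_def C_def[symmetric] c(2) by (simp add: Suc)
      also have "\<dots> = (\<Sum>j\<le>m. (- 1) ^ j * (\<Sum>B\<in>J r. d\<mu> c x B (hor c (vs ! j)) * dxf B (q c # omit j (map (hor c) vs)) +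
        \<mu> x (frame c x B) * dxf B (ver c (vs ! j) # omit j (map (hor c) vs))))"
        by (intro sum.cong refl arg_cong2[where f = "(*)"] deriv_i_T[OF c(1) q Suc True]) (simp add: Suc)
      finally show ?thesis by (simp add: Suc lessThan_Suc_atMost)
    qed simp
    have "(\<Sum>j<r. (- 1) ^ j * dxf B (ver c (vs ! j) # omit j (map (hor c) vs))) =
        (\<Sum>j<r. dxf B ((map (hor c) vs)[j := ver c (vs ! j)]))" if B: "B \<in> J r" for B
    proof (rule sum.cong[OF refl])
      fix j assume "j \<in> {..<r}"
      then show "(- 1) ^ j * dxf B (ver c (vs ! j) # omit j (map (hor c) vs)) = dxf B ((map (hor c) vs)[j := ver c (vs ! j)])"
        using dxf_to_front[of "map (hor c) vs" B j "ver c (vs ! j)"] True B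
        by (simp add: index_sets_def tuples_def take_map drop_map)
    qed
    then have "(\<Sum>B\<in>J r. \<mu> x (frame c x B) * (\<Sum>j<r. dxf B ((map (hor c) vs)[j := ver c (vs ! j)]))) =
      (\<Sum>B\<in>J r. \<Sum>j<r. (- 1) ^ j * (\<mu> x (frame c x B) * dxf B (ver c (vs ! j) # omit j (map (hor c) vs))))"
      by (simp add: sum_distrib_left[symmetric] mult.left_commute[of "(- 1) ^ _"])
    also have "\<dots> = (\<Sum>j<r. (- 1) ^ j * (\<Sum>B\<in>J r. \<mu> x (frame c x B) * dxf B (ver c (vs ! j) # omit j (map (hor c) vs))))"
      by (subst sum.swap) (simp add: sum_distrib_left)
    finally show ?thesis
      using first i_T_ext_deriv[OF c(1) q True] True
      by (simp add: d_T_def lift_coord_def sum.distrib distrib_left)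
  next
    case False
    then show ?thesis by (auto simp: d_T_def i_T_outside ext_deriv_def)
  qed
  then show ?thesis using c by blast
qed

end

context manifold begin

section \<open>The flip and its exterior powers\<close>

text \<open>Differentiating the change of velocities adds to the vertical part the second derivative
  \<open>T\<close> of the transition map, applied to \<open>q c\<close> and the horizontal part. Its
  symmetry makes the exchange of these two consistent in all charts.\<close>

lemma TT_transition:
  assumes c: "c \<in> charts_at A x" "c' \<in> charts_at A x"
  obtains L T where
    "\<And>q. q \<in> tangent_space A x \<Longrightarrow> q c' = L (q c)"
    "\<And>q v. v \<in> TTS (x, q) \<Longrightarrow> hor c' v = L (hor c v)"
    "\<And>q v. v \<in> TTS (x, q) \<Longrightarrow> ver c' v = L (ver c v) + T (q c) (hor c v)"
    "\<And>h k. h \<in> S \<Longrightarrow> k \<in> S \<Longrightarrow> T h k = T k h"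
proof -
  have cA: "c \<in> A" "c' \<in> A" using c by (auto simp: charts_at_def)
  obtain L where L: "has_cderiv c (snd c') L x" using transition[OF c] by blast
  obtain T where T: "\<And>h. h \<in> S \<Longrightarrow> has_cderiv c (\<lambda>y. coord_vec A c y h c') (T h) x"
    and sym: "\<And>h k. h \<in> S \<Longrightarrow> k \<in> S \<Longrightarrow> T h k = T k h"
    by (rule coord_vec_has_cderiv[OF M c]) (rule that)
  have linL: "linear L" using L by (simp add: has_cderiv_def)
  have linT: "linear (T h)" if "h \<in> S" for h using T[OF that] by (simp add: has_cderiv_def)
  have Lh: "coord_vec A c x h c' = L h" if "h \<in> S" for h by (rule coord_vec_apply[OF c L that])
  have exp: "F h = (\<Sum>b\<in>I. (h $ b) *\<^sub>R F (axis b 1))" if "h \<in> S" "linear F"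
    for h and F :: "(real, 'n) vec \<Rightarrow> (real, 'n) vec"
  proof -
    have "F h = F (\<Sum>b\<in>I. (h $ b) *\<^sub>R axis b 1)" using coord_space_expand[OF that(1)] by (rule arg_cong)
    also have "\<dots> = (\<Sum>b\<in>I. (h $ b) *\<^sub>R F (axis b 1))"
      using that(2) by (simp add: linear_sum linear_scale)
    finally show ?thesis .
  qed
  have main: "hor c' v = L (hor c v) \<and> ver c' v = L (ver c v) + T (q c) (hor c v)" if v: "v \<in> TTS (x, q)" for q v
  proof -
    note q = TM_points[OF v]
    have qS: "q c \<in> S" by (rule coords_in_S[OF c(1) q])
    note hS = hor_ver_in[OF c(1) v]
    obtain \<gamma> where \<gamma>: "curve_at0 (tangent_atlas A) \<gamma>" "velocity (tangent_atlas A) \<gamma> = ((x, q), v)"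
      using TM.tangent_spaceE[OF v] by blast
    have C: "curve_in (TC c) \<gamma> (x, q) (v (TC c))" and C': "curve_in (TC c') \<gamma> (x, q) (v (TC c'))"
      using TM.curve_at0_curve_in[OF \<gamma>] TC_at[OF c(1) q] TC_at[OF c(2) q] by auto
    have base: "curve_in c (\<lambda>t. fst (\<gamma> t)) x (hor c v)" "curve_in c' (\<lambda>t. fst (\<gamma> t)) x (hor c' v)"
      and \<gamma>0: "\<gamma> 0 = (x, q)" and ev: "\<forall>\<^sub>F t in nhds 0. snd (\<gamma> t) \<in> tangent_space A (fst (\<gamma> t))"
      and der: "((\<lambda>t. snd (\<gamma> t) c) has_vector_derivative ver c v) (at 0)"
        "((\<lambda>t. snd (\<gamma> t) c') has_vector_derivative ver c' v) (at 0)"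
      using C C' unfolding curve_in_TC[OF cA(1)] curve_in_TC[OF cA(2)] by (auto simp: hor_def ver_def)
    have h: "hor c' v = L (hor c v)"
      using vector_derivative_unique_at[OF has_cderivD[OF L base(1)]] base(2) by (auto simp: curve_in_def)
    have "\<forall>\<^sub>F t in nhds 0. fst (\<gamma> t) \<in> fst c" using base(1) by (simp add: curve_in_def)
    then have eq: "\<forall>\<^sub>F t in nhds 0. (\<Sum>b\<in>I. (snd (\<gamma> t) c $ b) *\<^sub>R coord_vec A c (fst (\<gamma> t)) (axis b 1) c') = snd (\<gamma> t) c'"
      using ev
    proof eventually_elim
      case (elim t)
      then have "c \<in> charts_at A (fst (\<gamma> t))" using cA by (simp add: charts_at_def)
      from coords_change[OF this elim(2), of c'] show ?case by simp
    qed
    have "((\<lambda>t. \<Sum>b\<in>I. (snd (\<gamma> t) c $ b) *\<^sub>R coord_vec A c (fst (\<gamma> t)) (axis b 1) c') has_vector_derivative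
      (\<Sum>b\<in>I. (snd (\<gamma> 0) c $ b) *\<^sub>R T (axis b 1) (hor c v) + (ver c v $ b) *\<^sub>R coord_vec A c (fst (\<gamma> 0)) (axis b 1) c')) (at 0)"
      by (intro has_vector_derivative_sum has_vector_derivative_scaleR has_cderivD[OF T base(1)])
        (use bounded_linear.has_vector_derivative[OF bounded_linear_vec_nth der(1)]
          in \<open>auto simp: has_real_derivative_iff_has_vector_derivative axis_in_coord_space\<close>)
    then have "ver c' v = (\<Sum>b\<in>I. (q c $ b) *\<^sub>R T (axis b 1) (hor c v) + (ver c v $ b) *\<^sub>R coord_vec A c x (axis b 1) c')"
      unfolding hvd_cong[OF eq] \<gamma>0 fst_conv snd_conv by (rule vector_derivative_unique_at[OF der(2)])
    \<comment> \<open>\<open>T\<close> is known to be linear in its second argument, being a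
      derivative; symmetry moves the basis vectors there, so that the sum over the basis can be
      carried out.\<close>
    also have "\<dots> = (\<Sum>b\<in>I. (q c $ b) *\<^sub>R T (hor c v) (axis b 1)) + (\<Sum>b\<in>I. (ver c v $ b) *\<^sub>R L (axis b 1))"
      unfolding sum.distrib[symmetric]
      by (intro sum.cong) (auto simp: sym[OF _ hS(1)] axis_in_coord_space Lh)
    also have "\<dots> = T (hor c v) (q c) + L (ver c v)"
      using exp[OF qS linT[OF hS(1)]] exp[OF hS(2) linL] by simp
    finally show ?thesis using h sym[OF qS hS(1)] by simp
  qed
  show thesis
    by (rule that[of L T]) (use main sym Lh coords_in_S[OF c(1)] coord_vec_coords[OF c(1)] in \<open>auto, metis\<close>)
qed

lemma TT_coords_eq: "TT_coords A c (w, v) = ((snd c (fst w), snd w c), v (TC c))"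
  by (simp add: TT_coords_def tangent_chart_def case_prod_beta)

text \<open>\<open>kappa\<close> is described by a condition in all charts at once. The vector with
  flipped coordinates in \<open>c\<close> satisfies it in every other chart by
  \<open>TT_transition\<close>, and it is unique because one chart determines a vector.\<close>

lemma kappa_eq:
  assumes c: "c \<in> charts_at A x" and v: "v \<in> TTS (x, q)"
  shows "kappa A ((x, q), v) = ((x, coord_vec A c x (hor c v)),
    coord_vec (tangent_atlas A) (TC c) (x, coord_vec A c x (hor c v)) (q c, ver c v))" (is "_ = ((x, ?q), ?v)")
proof -
  note q = TM_points[OF v]
  have S: "hor c v \<in> S" "ver c v \<in> S" "q c \<in> S"
    using hor_ver_in[OF c v] coords_in_S[OF c q] by auto
  have q': "?q \<in> tangent_space A x" by (rule coord_vec_in[OF c S(1)])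
  have v': "?v \<in> TTS (x, ?q)"
    by (rule TM.coord_vec_in[OF TC_at[OF c q']]) (use S in simp)
  note hv = hor_ver_coord_vec[OF c q' S(3,2)]
  let ?P = "\<lambda>y. y \<in> tangent_bundle (tangent_atlas A) \<and> fst (fst y) = fst (fst ((x, q), v)) \<and>
     (\<forall>c\<in>charts_at A (fst (fst ((x, q), v))). \<forall>x1 x' dx dx'.
        TT_coords A c ((x, q), v) = ((x1, x'), (dx, dx')) \<longrightarrow> TT_coords A c y = ((x1, dx), (x', dx')))"
  have "?P ((x, ?q), ?v)"
  proof (intro conjI ballI allI impI)
    show "((x, ?q), ?v) \<in> tangent_bundle (tangent_atlas A)" using v' by (simp add: tangent_bundle_iff)
    fix c' x1 x' dx dx' assume "c' \<in> charts_at A (fst (fst ((x, q), v)))"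
      and *: "TT_coords A c' ((x, q), v) = ((x1, x'), (dx, dx'))"
    then have c': "c' \<in> charts_at A x" by simp
    obtain L T where LT: "\<And>q. q \<in> tangent_space A x \<Longrightarrow> q c' = L (q c)"
      "\<And>q v. v \<in> TTS (x, q) \<Longrightarrow> hor c' v = L (hor c v)"
      "\<And>q v. v \<in> TTS (x, q) \<Longrightarrow> ver c' v = L (ver c v) + T (q c) (hor c v)"
      "\<And>h k. h \<in> S \<Longrightarrow> k \<in> S \<Longrightarrow> T h k = T k h"
      by (rule TT_transition[OF c c']) (rule that)
    have "?q c' = hor c' v" using LT(1)[OF q'] LT(2)[OF v] c S by simp
    moreover have "hor c' ?v = q c'" using LT(2)[OF v'] LT(1)[OF q] hv by simp
    moreover have "ver c' ?v = ver c' v" using LT(3)[OF v'] LT(3)[OF v] hv LT(4)[OF S(1,3)] c S by simp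
    ultimately show "TT_coords A c' ((x, ?q), ?v) = ((x1, dx), (x', dx'))"
      using * by (auto simp: TT_coords_eq hor_def ver_def prod_eq_iff)
  qed simp
  moreover have "y = ((x, ?q), ?v)" if y: "?P y" for y
  proof -
    obtain q1 v1 where y1: "y = ((x, q1), v1)" using y by (cases y, case_tac a) auto
    have v1: "v1 \<in> TTS (x, q1)" using y by (simp add: y1 tangent_bundle_iff)
    have "TT_coords A c ((x, q), v) = ((snd c x, q c), (hor c v, ver c v))"
      by (simp add: TT_coords_eq hor_def ver_def)
    then have "TT_coords A c y = ((snd c x, hor c v), (q c, ver c v))" using y c by simp
    then have eq: "q1 c = hor c v" "v1 (TC c) = (q c, ver c v)" by (auto simp: y1 TT_coords_eq)
    have "q1 = ?q" using coord_vec_coords[OF c TM_points[OF v1]] eq(1) by simp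
    moreover have "v1 = coord_vec (tangent_atlas A) (TC c) (x, q1) (q c, ver c v)"
      using TM.coord_vec_coords[OF TC_at[OF c TM_points[OF v1]] v1] eq(2) by simp
    ultimately show ?thesis by (simp add: y1)
  qed
  ultimately show ?thesis unfolding kappa_def by (rule the_equality)
qed


section \<open>Exterior powers of the flip in coordinates\<close>

lemma mvec_coord_lin: "mvec_coord r c x (s *\<^sub>R u + t *\<^sub>R u') = s *\<^sub>R mvec_coord r c x u + t *\<^sub>R mvec_coord r c x u'"
  by (simp add: mvec_coord_def vec_eq_iff scaleR_fun_def)

abbreviation "ext_coords r \<equiv> bundle_coords A (\<lambda>x. ext_power r (tangent_space A x)) (mvec_coord r)"

lemmas ext_coords_curveI = EB.coords_curveI[folded ext_atlas_eq]
  and ext_coords_curveD = EB.coords_curveD[folded ext_atlas_eq]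
  and ext_coords_curve = EB.coords_curve[folded ext_atlas_eq]
  and ext_coords_base = EB.coords_base[folded ext_atlas_eq]
  and ext_coords_of = EB.coords_of[folded ext_atlas_eq]

lemma ext_coords_in: "ext_coords r c x u h d z \<Longrightarrow> z \<in> tangent_bundle (ext_atlas A I r)"
  by (simp add: bundle_coords_def ext_atlas_eq)

text \<open>Two curves over the same coordinate line of the base form an admissible pair, so the
  chosen pair is admissible too; as long as its base points agree, the components of the fibrewise
  sum are the sums of the components.\<close>

lemma T_add_coords:
  assumes c: "c \<in> charts_at A x" and z: "ext_coords r c x u h d z" "ext_coords r c x u' h d' z'"
  shows "ext_coords r c x (u + u') h (d + d') (T_add A I r z z')"
proof -
  let ?E = "ext_atlas A I r"
  define P where "P = (\<lambda>\<gamma>s. list_all2 (\<lambda>\<gamma> w. curve_at0 ?E \<gamma> \<and> velocity ?E \<gamma> = w) \<gamma>s [z, z'] \<and>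
      (\<forall>\<^sub>F t in nhds 0. \<forall>\<gamma>\<in>set \<gamma>s. \<forall>\<delta>\<in>set \<gamma>s. fst (\<gamma> t) = fst (\<delta> t)))"
  obtain \<gamma>1 where 1: "curve_at0 ?E \<gamma>1" "velocity ?E \<gamma>1 = z"
    "\<forall>\<^sub>F t in nhds 0. fst (\<gamma>1 t) = chart_inv c (snd c x + t *\<^sub>R h)" using ext_coords_curve[OF c z(1)] by blast
  obtain \<gamma>2 where 2: "curve_at0 ?E \<gamma>2" "velocity ?E \<gamma>2 = z'"
    "\<forall>\<^sub>F t in nhds 0. fst (\<gamma>2 t) = chart_inv c (snd c x + t *\<^sub>R h)" using ext_coords_curve[OF c z(2)] by blast
  have "P [\<gamma>1, \<gamma>2]" unfolding P_def using 1 2 by (auto elim: eventually_elim2)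
  then have "P (SOME \<gamma>s. P \<gamma>s)" by (rule someI)
  then obtain \<gamma>s where some': "(SOME \<gamma>s. P \<gamma>s) = \<gamma>s" and \<gamma>s: "P \<gamma>s" by blast
  then obtain \<gamma> \<delta> where \<gamma>\<delta>: "\<gamma>s = [\<gamma>, \<delta>]" and \<gamma>: "curve_at0 ?E \<gamma>" "velocity ?E \<gamma> = z"
    and \<delta>: "curve_at0 ?E \<delta>" "velocity ?E \<delta> = z'"
    unfolding P_def by (auto simp: list_all2_Cons2)
  have base: "\<forall>\<^sub>F t in nhds 0. fst (\<gamma> t) = fst (\<delta> t)"
    using \<gamma>s[unfolded P_def, THEN conjunct2]
    by (rule eventually_mono) (drule bspec[of _ _ \<gamma>], simp add: \<gamma>\<delta>, drule bspec[of _ _ \<delta>], simp_all add: \<gamma>\<delta>)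
  note some = some'[unfolded \<gamma>\<delta>]
  let ?\<eta> = "\<lambda>t. (fst (\<gamma> t), snd (\<gamma> t) + snd (\<delta> t))"
  have T: "T_add A I r z z' = velocity ?E ?\<eta>"
    unfolding T_add_def tangent_map_fibred_def P_def[symmetric] some by simp
  have g: "\<gamma> 0 = fst z" "\<forall>\<^sub>F t in nhds 0. snd (\<gamma> t) \<in> ext_power r (tangent_space A (fst (\<gamma> t)))"
    "curve_in c (\<lambda>t. fst (\<gamma> t)) (fst (fst z)) h"
    "((\<lambda>t. mvec_coord r c (fst (\<gamma> t)) (snd (\<gamma> t))) has_vector_derivative d) (at 0)"
    using ext_coords_curveD[OF c z(1) \<gamma>] unfolding curve_in_bundle_chart by auto
  have g': "\<delta> 0 = fst z'" "\<forall>\<^sub>F t in nhds 0. snd (\<delta> t) \<in> ext_power r (tangent_space A (fst (\<delta> t)))"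
    "((\<lambda>t. mvec_coord r c (fst (\<delta> t)) (snd (\<delta> t))) has_vector_derivative d') (at 0)"
    using ext_coords_curveD[OF c z(2) \<delta>] unfolding curve_in_bundle_chart by auto
  have add: "mvec_coord r c y (a + b) = mvec_coord r c y a + mvec_coord r c y b" for y a b
    using mvec_coord_lin[of r c y 1 a 1 b] by simp
  have zx: "fst (fst z) = x" "mvec_coord r c x (snd (fst z)) = u" "mvec_coord r c x (snd (fst z')) = u'"
    using z by (auto simp: bundle_coords_def)
  have "curve_in (ext_chart r c) ?\<eta> (x, snd (fst z) + snd (fst z')) (h, d + d')"
    unfolding curve_in_bundle_chart
  proof (intro conjI)
    show "?\<eta> 0 = (x, snd (fst z) + snd (fst z'))" using g(1) g'(1) zx by simp
    show "\<forall>\<^sub>F t in nhds 0. snd (?\<eta> t) \<in> ext_power r (tangent_space A (fst (?\<eta> t)))"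
      using g(2) g'(2) base by eventually_elim (simp add: subspace_add[OF subspace_ext_power])
    show "curve_in c (\<lambda>t. fst (?\<eta> t)) (fst (x, snd (fst z) + snd (fst z'))) (fst (h, d + d'))"
      using g(3) zx by simp
    have "\<forall>\<^sub>F t in nhds 0. mvec_coord r c (fst (\<gamma> t)) (snd (\<gamma> t)) + mvec_coord r c (fst (\<delta> t)) (snd (\<delta> t)) =
        mvec_coord r c (fst (?\<eta> t)) (snd (?\<eta> t))"
      using base by eventually_elim (simp add: add)
    from hvd_cong[OF this] has_vector_derivative_add[OF g(4) g'(3)]
    show "((\<lambda>t. mvec_coord r c (fst (?\<eta> t)) (snd (?\<eta> t))) has_vector_derivative snd (h, d + d')) (at 0)"
      by simp
  qed
  from ext_coords_curveI[OF c this] show ?thesis unfolding T by (simp add: add zx)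
qed

lemma T_scale_coords:
  assumes c: "c \<in> charts_at A x" and z: "ext_coords r c x u h d z"
  shows "ext_coords r c x (a *\<^sub>R u) h (a *\<^sub>R d) (T_scale A I r a z)"
proof -
  let ?E = "ext_atlas A I r"
  let ?\<eta> = "\<lambda>\<gamma> t. (fst (\<gamma> t), a *\<^sub>R snd (\<gamma> t))"
  obtain \<gamma> where \<gamma>: "curve_at0 ?E \<gamma>" "velocity ?E \<gamma> = z" and T: "T_scale A I r a z = velocity ?E (?\<eta> \<gamma>)"
    using EB.total.tangent_map_curve[folded ext_atlas_eq, OF ext_coords_in[OF z], of ?E "\<lambda>p. (fst p, a *\<^sub>R snd p)"]
    by (auto simp: T_scale_def comp_def)
  let ?\<eta> = "?\<eta> \<gamma>"
  have g: "\<gamma> 0 = fst z" "\<forall>\<^sub>F t in nhds 0. snd (\<gamma> t) \<in> ext_power r (tangent_space A (fst (\<gamma> t)))"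
    "curve_in c (\<lambda>t. fst (\<gamma> t)) (fst (fst z)) h"
    "((\<lambda>t. mvec_coord r c (fst (\<gamma> t)) (snd (\<gamma> t))) has_vector_derivative d) (at 0)"
    using ext_coords_curveD[OF c z \<gamma>] unfolding curve_in_bundle_chart by auto
  have scale: "mvec_coord r c y (a *\<^sub>R b) = a *\<^sub>R mvec_coord r c y b" for y b
    using mvec_coord_lin[of r c y a b 0 0] by simp
  have zx: "fst (fst z) = x" "mvec_coord r c x (snd (fst z)) = u"
    using z by (auto simp: bundle_coords_def)
  have "curve_in (ext_chart r c) ?\<eta> (x, a *\<^sub>R snd (fst z)) (h, a *\<^sub>R d)"
    unfolding curve_in_bundle_chart
  proof (intro conjI)
    show "?\<eta> 0 = (x, a *\<^sub>R snd (fst z))" using g(1) zx by simp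
    show "\<forall>\<^sub>F t in nhds 0. snd (?\<eta> t) \<in> ext_power r (tangent_space A (fst (?\<eta> t)))"
      using g(2) by eventually_elim (simp add: subspace_scale[OF subspace_ext_power])
    show "curve_in c (\<lambda>t. fst (?\<eta> t)) (fst (x, a *\<^sub>R snd (fst z))) (fst (h, a *\<^sub>R d))"
      using g(3) zx by simp
    show "((\<lambda>t. mvec_coord r c (fst (?\<eta> t)) (snd (?\<eta> t))) has_vector_derivative snd (h, a *\<^sub>R d)) (at 0)"
      using bounded_linear.has_vector_derivative[OF bounded_linear_scaleR_right g(4)] by (simp add: scale)
  qed
  from ext_coords_curveI[OF c this] show ?thesis unfolding T by (simp add: scale zx)
qed

text \<open>\<open>hform\<close> is the form \<open>dx\<^sup>B\<close> pulled back to the second tangent space, and \<open>vform\<close> is the derivative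
  at \<open>t = 0\<close> of its values when \<open>hor c v\<close> is replaced by \<open>hor c v + t *\<^sub>R ver c v\<close>, cf. \<open>dxf_flow\<close>.\<close>

definition hform :: "nat \<Rightarrow> ('a, (real, 'n) vec) chart \<Rightarrow> ('a, 'n) nvec \<Rightarrow> 'n set \<Rightarrow> ('a, 'n) nnfib form" where
  "hform r c w B = (\<lambda>vs. if vs \<in> tuples r (TTS w) then dxf B (map (hor c) vs) else 0)"

definition vform :: "nat \<Rightarrow> ('a, (real, 'n) vec) chart \<Rightarrow> ('a, 'n) nvec \<Rightarrow> 'n set \<Rightarrow> ('a, 'n) nnfib form" where
  "vform r c w B = (\<lambda>vs. if vs \<in> tuples r (TTS w)
     then \<Sum>j<r. dxf B ((map (hor c) vs)[j := ver c (vs ! j)]) else 0)"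

lemma dxf_flow:
  assumes "length vs = card B"
  shows "((\<lambda>t. dxf B (map (\<lambda>v. hor c v + t *\<^sub>R ver c v) vs)) has_vector_derivative
    (\<Sum>j<card B. dxf B ((map (hor c) vs)[j := ver c (vs ! j)]))) (at 0)"
proof -
  have "((\<lambda>t. dxf B (map (\<lambda>v. hor c v + t *\<^sub>R ver c v) vs)) has_vector_derivative
    (\<Sum>j<card B. dxf B ((map (\<lambda>v. hor c v + 0 *\<^sub>R ver c v) vs)[j := map (ver c) vs ! j]))) (at 0)"
    by (rule dxf_has_vector_derivative) (use assms in \<open>auto intro!: derivative_eq_intros\<close>)
  moreover have "(\<Sum>j<card B. dxf B ((map (\<lambda>v. hor c v + 0 *\<^sub>R ver c v) vs)[j := map (ver c) vs ! j])) =
      (\<Sum>j<card B. dxf B ((map (hor c) vs)[j := ver c (vs ! j)]))"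
    by (rule sum.cong) (use assms in auto)
  ultimately show ?thesis by simp
qed

lemma hform_in:
  assumes "c \<in> charts_at A x" "q \<in> tangent_space A x" "B \<in> J r"
  shows "hform r c (x, q) B \<in> alt_forms r (TTS (x, q))"
  unfolding hform_def
  by (rule dxf_pullback[OF subspace_TTS[OF assms(1,2)]]) (use assms in \<open>auto simp: hor_ver_lin index_sets_def\<close>)

text \<open>Alternation does not hold term by term in the sum over slots. \<open>vform\<close>
  inherits it as the derivative of the pullbacks of dx^B by the linear maps
  \<open>hor + t ver\<close>.\<close>

lemma vform_in:
  assumes "c \<in> charts_at A x" "q \<in> tangent_space A x" "B \<in> J r"
  shows "vform r c (x, q) B \<in> alt_forms r (TTS (x, q))"
proof (rule alt_forms_derivative)
  let ?F = "\<lambda>t vs. if vs \<in> tuples r (TTS (x, q)) then dxf B (map (\<lambda>v. hor c v + t *\<^sub>R ver c v) vs) else 0"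
  show "?F t \<in> alt_forms r (TTS (x, q))" for t
    by (rule dxf_pullback[OF subspace_TTS[OF assms(1,2)]])
      (use assms in \<open>auto simp: hor_ver_lin index_sets_def algebra_simps\<close>)
  show "((\<lambda>t. ?F t vs) has_vector_derivative vform r c (x, q) B vs) (at 0)" for vs
  proof (cases "vs \<in> tuples r (TTS (x, q))")
    case True
    then show ?thesis
      using dxf_flow[of vs B c] assms by (simp add: vform_def index_sets_def tuplesD(1))
  qed (simp add: vform_def)
qed

text \<open>By \<open>kappa_pow_coords\<close>, \<open>hcoord\<close> is the position and
  \<open>vcoord\<close> the velocity of the image of \<open>U\<close> under \<kappa>^r, in fibre
  coordinates.\<close>

definition hcoord :: "nat \<Rightarrow> ('a, (real, 'n) vec) chart \<Rightarrow> ('a, 'n) nvec \<Rightarrow> ('a, 'n) nnfib mvec \<Rightarrow> (real, 'n set) vec" where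
  "hcoord r c w U = (\<chi> B. if B \<in> J r then U (hform r c w B) else 0)"

definition vcoord :: "nat \<Rightarrow> ('a, (real, 'n) vec) chart \<Rightarrow> ('a, 'n) nvec \<Rightarrow> ('a, 'n) nnfib mvec \<Rightarrow> (real, 'n set) vec" where
  "vcoord r c w U = (\<chi> B. if B \<in> J r then U (vform r c w B) else 0)"

lemma hcoord_add: "hcoord r c w (U + U') = hcoord r c w U + hcoord r c w U'"
  and vcoord_add: "vcoord r c w (U + U') = vcoord r c w U + vcoord r c w U'"
  and hcoord_scale: "hcoord r c w (a *\<^sub>R U) = a *\<^sub>R hcoord r c w U"
  and vcoord_scale: "vcoord r c w (a *\<^sub>R U) = a *\<^sub>R vcoord r c w U"
  and hcoord_in: "hcoord r c w U \<in> coord_space (J r)"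
  and vcoord_in: "vcoord r c w U \<in> coord_space (J r)"
  by (simp_all add: hcoord_def vcoord_def vec_eq_iff scaleR_fun_def coord_space_def)

text \<open>After the flip all vectors at \<open>(x, q)\<close> have base velocity \<open>q\<close>,
  while their horizontal parts have become positions. So they all have representatives over one base
  curve.\<close>

lemma kappa_curve:
  assumes c: "c \<in> charts_at A x" and v: "v \<in> TTS (x, q)"
  shows "\<exists>\<gamma>. curve_at0 (tangent_atlas A) \<gamma> \<and> velocity (tangent_atlas A) \<gamma> = kappa A ((x, q), v) \<and>
    (\<forall>\<^sub>F t in nhds 0. fst (\<gamma> t) = chart_inv c (snd c x + t *\<^sub>R q c))"
    and "\<lbrakk>curve_at0 (tangent_atlas A) \<gamma>; velocity (tangent_atlas A) \<gamma> = kappa A ((x, q), v)\<rbrakk>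
      \<Longrightarrow> curve_in (TC c) \<gamma> (x, coord_vec A c x (hor c v)) (q c, ver c v)"
proof -
  let ?q = "coord_vec A c x (hor c v)" and ?T = "tangent_atlas A"
  note q = TM_points[OF v]
  have cA: "c \<in> A" using c by (simp add: charts_at_def)
  have q': "?q \<in> tangent_space A x" using coord_vec_in[OF c] hor_ver_in[OF c v] by blast
  have k: "(q c, ver c v) \<in> S \<times> S" using hor_ver_in[OF c v] coords_in_S[OF c q] by simp
  note C = TC_at[OF c q']
  have co: "bundle_coords A (tangent_space A) (\<lambda>c x v. v c) c x (hor c v) (q c) (ver c v) (kappa A ((x, q), v))"
    unfolding bundle_coords_def tangent_atlas_eq[symmetric] tangent_chart_eq[OF cA, symmetric] kappa_eq[OF c v]
    using TM.coord_vec_in[OF C k] TM.coord_vec_self[OF C k] coord_vec_self[OF c hor_ver_in(1)[OF c v]]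
    by (simp add: tangent_bundle_iff)
  show "curve_in (TC c) \<gamma> (x, ?q) (q c, ver c v)"
    if "curve_at0 ?T \<gamma>" "velocity ?T \<gamma> = kappa A ((x, q), v)"
    using TB.coords_curveD[OF c co, folded tangent_atlas_eq tangent_chart_eq[OF cA], OF that]
    by (simp add: kappa_eq[OF c v])
  show "\<exists>\<gamma>. curve_at0 ?T \<gamma> \<and> velocity ?T \<gamma> = kappa A ((x, q), v) \<and>
    (\<forall>\<^sub>F t in nhds 0. fst (\<gamma> t) = chart_inv c (snd c x + t *\<^sub>R q c))"
    using TB.coords_curve[OF c co, folded tangent_atlas_eq] .
qed

text \<open>The components of the wedge of the chosen curves are minors of coordinates that start at
  \<open>hor\<close> and have derivative \<open>ver\<close>; position and velocity are thus the
  values of \<open>hform\<close> and \<open>vform\<close> on \<open>vs\<close>. The degree is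
  positive because the base point is read off the head of the list.\<close>

lemma T_wedge_coords:
  assumes c: "c \<in> charts_at A x" and q: "q \<in> tangent_space A x" and vs: "vs \<in> tuples r (TTS (x, q))"
    and r: "r \<noteq> 0"
  shows "ext_coords r c x (hcoord r c (x, q) (wedge r (TTS (x, q)) vs)) (q c)
    (vcoord r c (x, q) (wedge r (TTS (x, q)) vs)) (T_wedge A I r (map (\<lambda>v. kappa A ((x, q), v)) vs))"
proof -
  let ?E = "ext_atlas A I r" and ?T = "tangent_atlas A"
  have cA: "c \<in> A" using c by (simp add: charts_at_def)
  have len: "length vs = r" using vs by (simp add: tuples_def)
  let ?ks = "map (\<lambda>v. kappa A ((x, q), v)) vs"
  define P where "P = (\<lambda>\<gamma>s. list_all2 (\<lambda>\<gamma> w. curve_at0 ?T \<gamma> \<and> velocity ?T \<gamma> = w) \<gamma>s ?ks \<and>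
      (\<forall>\<^sub>F t in nhds 0. \<forall>\<gamma>\<in>set \<gamma>s. \<forall>\<delta>\<in>set \<gamma>s. fst (\<gamma> t) = fst (\<delta> t)))"
  have "\<forall>v\<in>TTS (x, q). \<exists>\<gamma>. curve_at0 ?T \<gamma> \<and> velocity ?T \<gamma> = kappa A ((x, q), v) \<and>
    (\<forall>\<^sub>F t in nhds 0. fst (\<gamma> t) = chart_inv c (snd c x + t *\<^sub>R q c))"
    using kappa_curve(1)[OF c] by blast
  from bchoice[OF this] obtain g where g: "\<And>v. v \<in> TTS (x, q) \<Longrightarrow> curve_at0 ?T (g v)"
    "\<And>v. v \<in> TTS (x, q) \<Longrightarrow> velocity ?T (g v) = kappa A ((x, q), v)"
    "\<And>v. v \<in> TTS (x, q) \<Longrightarrow> \<forall>\<^sub>F t in nhds 0. fst (g v t) = chart_inv c (snd c x + t *\<^sub>R q c)"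
    by blast
  have "P (map g vs)"
    unfolding P_def
  proof
    show "list_all2 (\<lambda>\<gamma> w. curve_at0 ?T \<gamma> \<and> velocity ?T \<gamma> = w) (map g vs) ?ks"
      using g(1,2) tuples_nth[OF vs] len by (auto simp: list_all2_conv_all_nth)
    have "\<forall>\<^sub>F t in nhds 0. \<forall>v\<in>set vs. fst (g v t) = chart_inv c (snd c x + t *\<^sub>R q c)"
      by (rule eventually_ball_finite) (use g(3) tuplesD(2)[OF vs] in auto)
    then show "\<forall>\<^sub>F t in nhds 0. \<forall>\<gamma>\<in>set (map g vs). \<forall>\<delta>\<in>set (map g vs). fst (\<gamma> t) = fst (\<delta> t)"
      by eventually_elim simp
  qed
  then have "P (SOME \<gamma>s. P \<gamma>s)" by (rule someI)
  then obtain \<gamma>s where some: "(SOME \<gamma>s. P \<gamma>s) = \<gamma>s" and \<gamma>s: "P \<gamma>s" by blast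
  have len': "length \<gamma>s = r" using \<gamma>s len by (auto simp: P_def list_all2_conv_all_nth)
  have C: "curve_in (TC c) (\<gamma>s ! j) (x, coord_vec A c x (hor c (vs ! j))) (q c, ver c (vs ! j))" if "j < r" for j
    using \<gamma>s that len len' by (intro kappa_curve(2)[OF c tuples_nth[OF vs that]])
      (auto simp: P_def list_all2_conv_all_nth)
  have \<gamma>: "(\<gamma>s ! j) 0 = (x, coord_vec A c x (hor c (vs ! j)))"
    "\<forall>\<^sub>F t in nhds 0. snd ((\<gamma>s ! j) t) \<in> tangent_space A (fst ((\<gamma>s ! j) t))"
    "curve_in c (\<lambda>t. fst ((\<gamma>s ! j) t)) x (q c)"
    "((\<lambda>t. snd ((\<gamma>s ! j) t) c) has_vector_derivative ver c (vs ! j)) (at 0)" if "j < r" for j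
    using C[OF that] unfolding curve_in_TC[OF cA] by auto
  \<comment> \<open>The common base curve; all chosen curves lie over it near time 0.\<close>
  define b where "b t = fst ((\<gamma>s ! 0) t)" for t
  have b: "curve_in c b x (q c)" unfolding b_def using \<gamma>(3)[of 0] r by simp
  have b_eq: "\<forall>\<^sub>F t in nhds 0. \<forall>\<gamma>\<in>set \<gamma>s. fst (\<gamma> t) = b t"
  proof -
    have "\<gamma>s ! 0 \<in> set \<gamma>s" using len' r by simp
    then show ?thesis
      using \<gamma>s[unfolded P_def, THEN conjunct2] unfolding b_def by (auto elim!: eventually_mono)
  qed
  have tup: "\<forall>\<^sub>F t in nhds 0. map snd (map (\<lambda>\<gamma>. \<gamma> t) \<gamma>s) \<in> tuples r (tangent_space A (b t))"
  proof -
    have "\<forall>\<^sub>F t in nhds 0. \<forall>j\<in>{..<r}. snd ((\<gamma>s ! j) t) \<in> tangent_space A (fst ((\<gamma>s ! j) t))"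
      by (rule eventually_ball_finite) (use \<gamma>(2) in auto)
    then show ?thesis using b_eq
    proof eventually_elim
      case (elim t)
      have "snd (\<gamma> t) \<in> tangent_space A (b t)" if "\<gamma> \<in> set \<gamma>s" for \<gamma>
      proof -
        obtain j where "j < r" "\<gamma> = \<gamma>s ! j" using \<open>\<gamma> \<in> set \<gamma>s\<close> len' by (auto simp: in_set_conv_nth)
        then show ?thesis using bspec[OF elim(1), of j] bspec[OF elim(2) that] by simp
      qed
      then show ?case using len' by (auto simp: tuples_def)
    qed
  qed
  let ?\<eta> = "\<lambda>t. (b t, wedge r (tangent_space A (b t)) (map snd (map (\<lambda>\<gamma>. \<gamma> t) \<gamma>s)))"
  have "T_wedge A I r ?ks = velocity ?E (\<lambda>t. (\<lambda>ps. (fst (hd ps), wedge r (tangent_space A (fst (hd ps))) (map snd ps)))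
      (map (\<lambda>\<gamma>. \<gamma> t) \<gamma>s))"
    unfolding T_wedge_def tangent_map_fibred_def P_def[symmetric] some Let_def ..
  moreover have "fst (hd (map (\<lambda>\<gamma>. \<gamma> t) \<gamma>s)) = b t" for t
    using len' r by (cases \<gamma>s) (auto simp: b_def)
  ultimately have T: "T_wedge A I r ?ks = velocity ?E ?\<eta>" by simp
  have hs0: "map (\<lambda>\<gamma>. snd (\<gamma> 0) c) \<gamma>s = map (hor c) vs"
    using \<gamma>(1) len len' c hor_ver_in(1)[OF c tuples_nth[OF vs]] by (auto simp: list_eq_iff_nth_eq)
  have mc: "\<forall>\<^sub>F t in nhds 0. (\<chi> B. if B \<in> J r then dxf B (map (\<lambda>\<gamma>. snd (\<gamma> t) c) \<gamma>s) else 0) =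
      mvec_coord r c (b t) (wedge r (tangent_space A (b t)) (map snd (map (\<lambda>\<gamma>. \<gamma> t) \<gamma>s)))"
  proof -
    have "\<forall>\<^sub>F t in nhds 0. b t \<in> fst c" using b by (simp add: curve_in_def)
    then show ?thesis using tup
    proof eventually_elim
      case (elim t)
      then have "c \<in> charts_at A (b t)" using cA by (simp add: charts_at_def)
      then show ?case using elim(2) coord_form_in
        by (auto simp: mvec_coord_def vec_eq_iff wedge_def coord_form_eq comp_def)
    qed
  qed
  have W: "wedge r (TTS (x, q)) vs (hform r c (x, q) B) = dxf B (map (hor c) vs)"
    "wedge r (TTS (x, q)) vs (vform r c (x, q) B) = (\<Sum>j<r. dxf B ((map (hor c) vs)[j := ver c (vs ! j)]))"
    if "B \<in> J r" for B
    using hform_in[OF c q that] vform_in[OF c q that] vs by (auto simp: wedge_def hform_def vform_def)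
  have "curve_in (ext_chart r c) ?\<eta> (?\<eta> 0) (q c, vcoord r c (x, q) (wedge r (TTS (x, q)) vs))"
    unfolding curve_in_bundle_chart
  proof (intro conjI)
    show "\<forall>\<^sub>F t in nhds 0. snd (?\<eta> t) \<in> ext_power r (tangent_space A (fst (?\<eta> t)))"
      using tup by eventually_elim (simp add: wedge_in_ext_power)
    show "curve_in c (\<lambda>t. fst (?\<eta> t)) (fst (?\<eta> 0)) (fst (q c, vcoord r c (x, q) (wedge r (TTS (x, q)) vs)))"
      using b by (simp add: curve_in_def)
    have "((\<lambda>t. dxf B (map (\<lambda>\<gamma>. snd (\<gamma> t) c) \<gamma>s)) has_vector_derivative
        (\<Sum>j<r. dxf B ((map (hor c) vs)[j := ver c (vs ! j)]))) (at 0)" if B: "B \<in> J r" for B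
    proof -
      have rB: "card B = r" using B by (simp add: index_sets_def)
      have "((\<lambda>t. dxf B (map (\<lambda>\<gamma>. snd (\<gamma> t) c) \<gamma>s)) has_vector_derivative
        (\<Sum>j<card B. dxf B ((map (\<lambda>\<gamma>. snd (\<gamma> 0) c) \<gamma>s)[j := map (ver c) vs ! j]))) (at 0)"
        by (rule dxf_has_vector_derivative) (use \<gamma>(4) len len' rB in auto)
      moreover have "(\<Sum>j<card B. dxf B ((map (\<lambda>\<gamma>. snd (\<gamma> 0) c) \<gamma>s)[j := map (ver c) vs ! j])) =
          (\<Sum>j<r. dxf B ((map (hor c) vs)[j := ver c (vs ! j)]))"
        unfolding hs0 rB by (rule sum.cong) (use len in auto)
      ultimately show ?thesis by simp
    qed
    then have "((\<lambda>t. \<chi> B. if B \<in> J r then dxf B (map (\<lambda>\<gamma>. snd (\<gamma> t) c) \<gamma>s) else 0) has_vector_derivative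
        vcoord r c (x, q) (wedge r (TTS (x, q)) vs)) (at 0)"
      by (intro hvd_vec) (auto simp: vcoord_def W)
    then show "((\<lambda>t. mvec_coord r c (fst (?\<eta> t)) (snd (?\<eta> t))) has_vector_derivative
        snd (q c, vcoord r c (x, q) (wedge r (TTS (x, q)) vs))) (at 0)"
      by (simp add: hvd_cong[OF mc])
  qed simp
  moreover have b0: "b 0 = x" using b by (simp add: curve_in_def)
  ultimately have "ext_coords r c x (mvec_coord r c x (snd (?\<eta> 0))) (q c)
      (vcoord r c (x, q) (wedge r (TTS (x, q)) vs)) (velocity ?E ?\<eta>)"
    by (intro ext_coords_curveI[OF c]) simp
  moreover have "mvec_coord r c (b 0) (snd (?\<eta> 0)) = hcoord r c (x, q) (wedge r (TTS (x, q)) vs)"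
    using eventually_nhds_x_imp_x[OF mc, symmetric] unfolding hs0 hcoord_def snd_conv by (simp add: W vec_eq_iff)
  ultimately show ?thesis unfolding T by (simp only: b0)
qed


text \<open>The coordinates are right on decomposable multivectors and are preserved by
  \<open>T_add\<close> and \<open>T_scale\<close>, hence right on the span. Whichever morphism
  \<open>kappa_pow\<close> chooses, its values are therefore known.\<close>

lemma is_kappa_pow_coords:
  assumes K: "is_kappa_pow A I r K" and r: "r \<noteq> 0"
    and c: "c \<in> charts_at A x" and q: "q \<in> tangent_space A x" and U: "U \<in> ext_power r (TTS (x, q))"
  shows "ext_coords r c x (hcoord r c (x, q) U) (q c) (vcoord r c (x, q) U) (K ((x, q), U))"
proof -
  let ?V = "TTS (x, q)"
  have "(x, q) \<in> tangent_bundle A" using q by (simp add: tangent_bundle_iff)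
  note K1 = K[unfolded is_kappa_pow_def Let_def, rule_format, OF this]
  \<comment> \<open>Membership is part of the predicate because the properties of \<open>K\<close>
    are available on \<open>ext_power\<close> only.\<close>
  define P where "P U \<longleftrightarrow> U \<in> ext_power r ?V \<and>
    ext_coords r c x (hcoord r c (x, q) U) (q c) (vcoord r c (x, q) U) (K ((x, q), U))" for U
  have "subspace {U. P U}"
  proof (rule subspaceI)
    have 0: "0 \<in> ext_power r ?V" by (rule subspace_0[OF subspace_ext_power])
    \<comment> \<open>The fibre coordinates of \<open>K\<close> at 0 are unknown at first. Scaling
      by 0 leaves the argument 0 unchanged and turns both coordinates into zero.\<close>
    obtain u d where "ext_coords r c x u (q c) d (K ((x, q), 0))"
      using ext_coords_of[OF c, of "K ((x, q), 0)" r q] K1 0 by blast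
    from T_scale_coords[OF c this, of 0]
    have "ext_coords r c x 0 (q c) 0 (K ((x, q), 0))" using K1 0 by (metis scaleR_zero_left)
    moreover have "hcoord r c (x, q) 0 = 0" "vcoord r c (x, q) 0 = 0"
      by (simp_all add: hcoord_def vcoord_def vec_eq_iff)
    ultimately show "0 \<in> {U. P U}" using 0 by (simp add: P_def)
  next
    fix U U' assume "U \<in> {U. P U}" "U' \<in> {U. P U}"
    then show "U + U' \<in> {U. P U}"
      using T_add_coords[OF c, of r _ "q c" _ "K ((x, q), U)" _ _ "K ((x, q), U')"] K1
      by (simp add: P_def hcoord_add vcoord_add subspace_add[OF subspace_ext_power])
  next
    fix a U assume "U \<in> {U. P U}"
    then show "a *\<^sub>R U \<in> {U. P U}"
      using T_scale_coords[OF c, of r _ "q c" _ "K ((x, q), U)" a] K1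
      by (simp add: P_def hcoord_scale vcoord_scale subspace_scale[OF subspace_ext_power])
  qed
  moreover have "P U" if W: "U \<in> wedge r ?V ` tuples r ?V" for U
  proof -
    obtain vs where vs: "vs \<in> tuples r ?V" "U = wedge r ?V vs" using W by blast
    then show ?thesis
      using T_wedge_coords[OF c q vs(1) r] K1 wedge_in_ext_power by (simp add: P_def)
  qed
  ultimately have "P U" using span_induct[of U "wedge r ?V ` tuples r ?V" P] U by (simp add: ext_power_def)
  then show ?thesis by (simp add: P_def)
qed

text \<open>\<open>K\<close> is defined by the expected coordinates, in a chart selected at the base
  point. The equations demanded of it then follow from uniqueness of coordinates.\<close>

lemma ex_kappa_pow:
  assumes r: "r \<noteq> 0"
  shows "\<exists>K. is_kappa_pow A I r K"
proof -
  define ch where "ch x = (SOME c. c \<in> charts_at A x)" for x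
  define K where "K = (\<lambda>(w, U). SOME z. ext_coords r (ch (fst w)) (fst w)
      (hcoord r (ch (fst w)) w U) (snd w (ch (fst w))) (vcoord r (ch (fst w)) w U) z)"
  have "is_kappa_pow A I r K"
    unfolding is_kappa_pow_def Let_def
  proof (rule ballI, goal_cases)
    case (1 w)
    then obtain x q where w: "w = (x, q)" and q: "q \<in> tangent_space A x"
      by (cases w) (auto simp: tangent_bundle_iff)
    define c where "c = ch x"
    have "charts_at A x \<noteq> {}" using tangent_space_points[OF q] points_charts_at by simp
    then have c: "c \<in> charts_at A x" unfolding c_def ch_def by (simp add: some_in_eq)
    have K: "ext_coords r c x (hcoord r c w U) (q c) (vcoord r c w U) (K (w, U))" for U
    proof -
      have "\<exists>z. ext_coords r c x (hcoord r c w U) (q c) (vcoord r c w U) z"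
        by (rule EB.coords_exists[OF c hcoord_in coords_in_S[OF c q] vcoord_in])
      then show ?thesis unfolding K_def c_def w by (auto intro: someI_ex)
    qed
    show ?case
    proof (intro conjI ballI allI)
      fix U show "K (w, U) \<in> tangent_bundle (ext_atlas A I r)" by (rule ext_coords_in[OF K])
      show "tangent_map (ext_atlas A I r) A fst (K (w, U)) = w"
        using ext_coords_base[OF c K] c q w by simp
    next
      fix U U'
      show "K (w, U + U') = T_add A I r (K (w, U)) (K (w, U'))"
        by (rule EB.coords_unique[OF c K]) (use T_add_coords[OF c K K] in \<open>simp add: hcoord_add vcoord_add\<close>)
    next
      fix U a
      show "K (w, a *\<^sub>R U) = T_scale A I r a (K (w, U))"
        by (rule EB.coords_unique[OF c K]) (use T_scale_coords[OF c K] in \<open>simp add: hcoord_scale vcoord_scale\<close>)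
    next
      fix vs assume vs: "vs \<in> tuples r (TTS w)"
      show "K (w, wedge r (TTS w) vs) = T_wedge A I r (map (\<lambda>v. kappa A (w, v)) vs)"
        by (rule EB.coords_unique[OF c K]) (use T_wedge_coords[OF c q _ r] vs in \<open>simp add: w\<close>)
    qed
  qed
  then show ?thesis by blast
qed

lemma index_sets_0: "B \<in> J 0 \<longleftrightarrow> B = {}"
  by (auto simp: index_sets_def)

text \<open>Joins degree 0, which is defined by constant sections, to the positive degrees, so that
  the argument below is uniform in the degree.\<close>

lemma kappa_pow_coords:
  assumes c: "c \<in> charts_at A x" and q: "q \<in> tangent_space A x" and U: "U \<in> ext_power r (TTS (x, q))"
  shows "ext_coords r c x (hcoord r c (x, q) U) (q c) (vcoord r c (x, q) U) (kappa_pow A I r ((x, q), U))"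
proof (cases "r = 0")
  case False
  have "is_kappa_pow A I r (kappa_pow A I r)"
    using ex_kappa_pow[OF False] False unfolding kappa_pow_def by (simp add: someI_ex)
  from is_kappa_pow_coords[OF this False c q U] show ?thesis .
next
  case True
  define s where "s = U (\<lambda>vs. if vs = [] then 1 else 0)"
  let ?f = "\<lambda>y. (y, s *\<^sub>R wedge 0 (tangent_space A y) [])"
  let ?v = "(\<chi> B. if B \<in> J 0 then s else 0) :: (real, 'n set) vec"
  have one: "dxf {} [] = 1" using dxf_basis_tuple[of "{}" "{}"] by simp
  have f_in: "snd (?f y) \<in> ext_power 0 (tangent_space A y)" for y
    by (simp add: subspace_scale[OF subspace_ext_power] wedge_in_ext_power)
  have f_coord: "mvec_coord 0 c y (snd (?f y)) = ?v" if "c \<in> charts_at A y" for y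
  proof -
    have "coord_form A c y {} [] = 1" using coord_form_eq[of "{}" 0 c y] one by (simp add: index_sets_0)
    then show ?thesis
      using coord_form_in[OF that, of "{}" 0]
      by (auto simp: mvec_coord_def vec_eq_iff index_sets_0 scaleR_fun_def wedge_def)
  qed
  obtain \<gamma> where \<gamma>: "curve_at0 A \<gamma>" "velocity A \<gamma> = (x, q)"
    and K: "kappa_pow A I r ((x, q), U) = velocity (ext_atlas A I 0) (?f \<circ> \<gamma>)"
    using tangent_map_curve[of "(x, q)" "ext_atlas A I 0" ?f] q True
    by (auto simp: kappa_pow_def s_def tangent_bundle_iff)
  have \<gamma>c: "curve_in c \<gamma> x (q c)" by (rule curve_at0_curve_in[OF \<gamma> c])
  then have \<gamma>0: "\<gamma> 0 = x" and ev: "\<forall>\<^sub>F t in nhds 0. \<gamma> t \<in> fst c" by (auto simp: curve_in_def)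
  have eq: "\<forall>\<^sub>F t in nhds 0. ?v = mvec_coord 0 c (fst ((?f \<circ> \<gamma>) t)) (snd ((?f \<circ> \<gamma>) t))"
    using ev
  proof eventually_elim
    case (elim t)
    then have "c \<in> charts_at A (\<gamma> t)" using c by (simp add: charts_at_def)
    from f_coord[OF this] show ?case by simp
  qed
  have "curve_in (ext_chart 0 c) (?f \<circ> \<gamma>) (?f x) (q c, 0)"
    unfolding curve_in_bundle_chart hvd_cong[OF eq, symmetric] using \<gamma>c \<gamma>0 f_in by simp
  from ext_coords_curveI[OF c this] have "ext_coords 0 c x ?v (q c) 0 (kappa_pow A I r ((x, q), U))"
    unfolding K using f_coord[OF c] by simp
  moreover have "hcoord 0 c (x, q) U = ?v"
  proof -
    have "hform 0 c (x, q) {} = (\<lambda>vs. if vs = [] then 1 else 0)" using one by (auto simp: hform_def)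
    then show ?thesis by (auto simp: hcoord_def vec_eq_iff index_sets_0 s_def)
  qed
  \<comment> \<open>In degree 0 \<open>vform\<close> is an empty sum, which matches the vanishing
    fibre velocity of a constant section.\<close>
  moreover have "vcoord 0 c (x, q) U = 0"
  proof -
    have "vform 0 c (x, q) {} = (\<lambda>vs. 0)" by (auto simp: vform_def)
    then show ?thesis using ext_power_zero[OF U] by (auto simp: vcoord_def vec_eq_iff index_sets_0)
  qed
  ultimately show ?thesis using True by simp
qed


abbreviation "coext_coords r \<equiv> bundle_coords A (\<lambda>x. alt_forms r (tangent_space A x)) (form_coord r)"

lemmas coext_coords_curveI = CB.coords_curveI[folded coext_atlas_eq]
  and coext_coords_curveD = CB.coords_curveD[folded coext_atlas_eq]
  and coext_coords_curve = CB.coords_curve[folded coext_atlas_eq]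
  and coext_coords_base = CB.coords_base[folded coext_atlas_eq]

section \<open>Tangent pairing and contractions\<close>

text \<open>As long as the two curves have the same base point, the pairing is a sum of products of
  components; the product rule gives its derivative, whichever pair of curves is chosen.\<close>

lemma tangent_pairing_coords:
  assumes c: "c \<in> charts_at A x" and z: "ext_coords k c x u h d z" and w: "coext_coords k c x a h b w"
  shows "tangent_pairing A I k z w = (\<Sum>B\<in>J k. d $ B * a $ B + u $ B * b $ B)"
proof -
  let ?E = "ext_atlas A I k" and ?C = "coext_atlas A I k"
  have cA: "c \<in> A" using c by (simp add: charts_at_def)
  define P where "P = (\<lambda>(\<gamma>, \<delta>). curve_at0 ?E \<gamma> \<and> velocity ?E \<gamma> = z \<and> curve_at0 ?C \<delta> \<and> velocity ?C \<delta> = w \<and>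
      (\<forall>\<^sub>F t in nhds 0. fst (\<gamma> t) = fst (\<delta> t)))"
  obtain \<gamma>1 where 1: "curve_at0 ?E \<gamma>1" "velocity ?E \<gamma>1 = z"
    "\<forall>\<^sub>F t in nhds 0. fst (\<gamma>1 t) = chart_inv c (snd c x + t *\<^sub>R h)" using ext_coords_curve[OF c z] by blast
  obtain \<delta>1 where 2: "curve_at0 ?C \<delta>1" "velocity ?C \<delta>1 = w"
    "\<forall>\<^sub>F t in nhds 0. fst (\<delta>1 t) = chart_inv c (snd c x + t *\<^sub>R h)" using coext_coords_curve[OF c w] by blast
  have "P (\<gamma>1, \<delta>1)" unfolding P_def using 1 2 by (auto elim: eventually_elim2)
  then have "P (SOME p. P p)" by (rule someI)
  then obtain \<gamma> \<delta> where some: "(SOME p. P p) = (\<gamma>, \<delta>)" and P: "P (\<gamma>, \<delta>)" by (metis surj_pair)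
  then have \<gamma>: "curve_at0 ?E \<gamma>" "velocity ?E \<gamma> = z" and \<delta>: "curve_at0 ?C \<delta>" "velocity ?C \<delta> = w"
    and base: "\<forall>\<^sub>F t in nhds 0. fst (\<gamma> t) = fst (\<delta> t)"
    by (auto simp: P_def)
  have T: "tangent_pairing A I k z w = deriv (\<lambda>t. snd (\<gamma> t) (snd (\<delta> t))) 0"
    unfolding tangent_pairing_def P_def[symmetric] some by simp
  have zx: "fst (fst z) = x" "mvec_coord k c x (snd (fst z)) = u"
    "fst (fst w) = x" "form_coord k c x (snd (fst w)) = a"
    using z w by (auto simp: bundle_coords_def)
  have g: "\<gamma> 0 = fst z" "\<forall>\<^sub>F t in nhds 0. snd (\<gamma> t) \<in> ext_power k (tangent_space A (fst (\<gamma> t)))"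
    "curve_in c (\<lambda>t. fst (\<gamma> t)) x h"
    "((\<lambda>t. mvec_coord k c (fst (\<gamma> t)) (snd (\<gamma> t))) has_vector_derivative d) (at 0)"
    using ext_coords_curveD[OF c z \<gamma>] zx unfolding curve_in_bundle_chart by auto
  have g': "\<delta> 0 = fst w" "\<forall>\<^sub>F t in nhds 0. snd (\<delta> t) \<in> alt_forms k (tangent_space A (fst (\<delta> t)))"
    "((\<lambda>t. form_coord k c (fst (\<delta> t)) (snd (\<delta> t))) has_vector_derivative b) (at 0)"
    using coext_coords_curveD[OF c w \<delta>] unfolding curve_in_bundle_chart by auto
  have "\<forall>\<^sub>F t in nhds 0. fst (\<gamma> t) \<in> fst c" using g(3) by (simp add: curve_in_def)
  then have eq: "\<forall>\<^sub>F t in nhds 0. (\<Sum>B\<in>J k. form_coord k c (fst (\<delta> t)) (snd (\<delta> t)) $ B *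
      mvec_coord k c (fst (\<gamma> t)) (snd (\<gamma> t)) $ B) = snd (\<gamma> t) (snd (\<delta> t))"
    using g(2) g'(2) base
  proof eventually_elim
    case (elim t)
    then have "c \<in> charts_at A (fst (\<gamma> t))" using cA by (simp add: charts_at_def)
    from mvec_expand[OF this _ elim(2), of "snd (\<delta> t)"] elim(3,4)
    show ?case by (simp add: form_coord_def mvec_coord_def)
  qed
  have "((\<lambda>t. form_coord k c (fst (\<delta> t)) (snd (\<delta> t)) $ B * mvec_coord k c (fst (\<gamma> t)) (snd (\<gamma> t)) $ B)
      has_vector_derivative a $ B * d $ B + b $ B * u $ B) (at 0)" for B
    using has_vector_derivative_mult[OF bounded_linear.has_vector_derivative[OF bounded_linear_vec_nth g'(3), of B]
        bounded_linear.has_vector_derivative[OF bounded_linear_vec_nth g(4), of B]]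
    unfolding g(1) g'(1) zx by simp
  then have "((\<lambda>t. \<Sum>B\<in>J k. form_coord k c (fst (\<delta> t)) (snd (\<delta> t)) $ B *
      mvec_coord k c (fst (\<gamma> t)) (snd (\<gamma> t)) $ B) has_vector_derivative
      (\<Sum>B\<in>J k. a $ B * d $ B + b $ B * u $ B)) (at 0)"
    by (rule has_vector_derivative_sum)
  then have "((\<lambda>t. snd (\<gamma> t) (snd (\<delta> t))) has_vector_derivative (\<Sum>B\<in>J k. a $ B * d $ B + b $ B * u $ B)) (at 0)"
    unfolding hvd_cong[OF eq] .
  then show ?thesis
    unfolding T by (intro DERIV_imp_deriv) (simp add: has_real_derivative_iff_has_vector_derivative ac_simps)
qed

end

section \<open>Contraction along curves\<close>

context manifold_form begin

text \<open>The matrix of the contraction in the frames. The concatenated indices may overlap and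
  need not increase, so the entries differ from the components \<open>\<mu> y (frame c y B)\<close>
  used before.\<close>

definition \<mu>2 :: "('a, (real, 'n) vec) chart \<Rightarrow> 'a \<Rightarrow> 'n set \<Rightarrow> 'n set \<Rightarrow> real" where
  "\<mu>2 c y C B = \<mu> y (frame c y C @ frame c y B)"

definition d\<mu>2 :: "('a, (real, 'n) vec) chart \<Rightarrow> 'a \<Rightarrow> 'n set \<Rightarrow> 'n set \<Rightarrow> (real, 'n) vec \<Rightarrow> real" where
  "d\<mu>2 c x C B = (SOME D. has_cderiv c (\<lambda>y. \<mu>2 c y C B) D x)"

lemma d\<mu>2:
  assumes c: "c \<in> charts_at A x" and "C \<in> J i" "B \<in> J k" "r = i + k"
  shows "has_cderiv c (\<lambda>y. \<mu>2 c y C B) (d\<mu>2 c x C B) x"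
proof -
  have "basis_tuple C @ basis_tuple B \<in> tuples r S"
    unfolding assms(4) using assms by (intro tuples_append basis_tuple_in) (auto simp: index_sets_def)
  from \<mu>_has_cderiv[OF c this] show ?thesis
    unfolding d\<mu>2_def \<mu>2_def frame_def map_append by (rule someI_ex)
qed

lemma contraction_eq:
  assumes c: "c \<in> charts_at A y" and r: "r = i + k"
  shows "contraction A r i \<mu> (y, u) = (y, \<lambda>vs. if vs \<in> tuples k (tangent_space A y) then u (\<lambda>us. \<mu> y (us @ vs)) else 0)"
  using wedge_prod_wedge[of "\<mu> y" i k "tangent_space A y" _ u] \<mu>_in_chart[OF c]
  by (auto simp: contraction_def r fun_eq_iff)

lemma contraction_in:
  assumes c: "c \<in> charts_at A y" and r: "r = i + k" and u: "u \<in> ext_power i (tangent_space A y)"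
  shows "snd (contraction A r i \<mu> (y, u)) \<in> alt_forms k (tangent_space A y)"
  unfolding contraction_eq[OF c r] snd_conv
  by (rule contracted_form_in[OF _ subspace_tangent_space[OF c] u]) (use \<mu>_in_chart[OF c] r in simp)

lemma contraction_coord:
  assumes c: "c \<in> charts_at A y" and r: "r = i + k" and u: "u \<in> ext_power i (tangent_space A y)"
  shows "form_coord k c y (snd (contraction A r i \<mu> (y, u))) =
    (\<chi> B. if B \<in> J k then \<Sum>C\<in>J i. \<mu>2 c y C B * mvec_coord i c y u $ C else 0)"
proof -
  have "u (\<lambda>us. \<mu> y (us @ frame c y B)) = (\<Sum>C\<in>J i. \<mu>2 c y C B * mvec_coord i c y u $ C)" if B: "B \<in> J k" for B
  proof -
    have "\<mu> y \<in> alt_forms (i + k) (tangent_space A y)" using \<mu>_in_chart[OF c] r by simp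
    from mvec_expand[OF c alt_forms_append(1)[OF this frame_in[OF c B]] u]
    show ?thesis by (simp add: \<mu>2_def mvec_coord_def)
  qed
  then show ?thesis
    unfolding contraction_eq[OF c r] snd_conv using frame_in[OF c]
    by (auto simp: form_coord_def vec_eq_iff)
qed

text \<open>Contraction is linear on fibres with matrix \<open>\<mu>2\<close>. The product rule
  gives the velocity of the image, where \<open>d\<mu>2\<close> accounts for the motion of the base
  point.\<close>

lemma tangent_contraction_coords:
  assumes c: "c \<in> charts_at A x" and r: "r = i + k" and z: "ext_coords i c x u h d z"
  shows "coext_coords k c x (\<chi> B. if B \<in> J k then \<Sum>C\<in>J i. \<mu>2 c x C B * u $ C else 0) h
    (\<chi> B. if B \<in> J k then \<Sum>C\<in>J i. \<mu>2 c x C B * d $ C + d\<mu>2 c x C B h * u $ C else 0)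
    (tangent_map (ext_atlas A I i) (coext_atlas A I k) (contraction A r i \<mu>) z)"
proof -
  let ?E = "ext_atlas A I i"
  have cA: "c \<in> A" using c by (simp add: charts_at_def)
  obtain \<gamma> where \<gamma>: "curve_at0 ?E \<gamma>" "velocity ?E \<gamma> = z"
    and T: "tangent_map ?E (coext_atlas A I k) (contraction A r i \<mu>) z =
      velocity (coext_atlas A I k) (contraction A r i \<mu> \<circ> \<gamma>)"
    using EB.total.tangent_map_curve[folded ext_atlas_eq, OF ext_coords_in[OF z]] by blast
  let ?\<eta> = "contraction A r i \<mu> \<circ> \<gamma>"
  have zx: "fst (fst z) = x" "mvec_coord i c x (snd (fst z)) = u"
    using z by (auto simp: bundle_coords_def)
  have g: "\<gamma> 0 = fst z" "\<forall>\<^sub>F t in nhds 0. snd (\<gamma> t) \<in> ext_power i (tangent_space A (fst (\<gamma> t)))"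
    "curve_in c (\<lambda>t. fst (\<gamma> t)) x h"
    "((\<lambda>t. mvec_coord i c (fst (\<gamma> t)) (snd (\<gamma> t))) has_vector_derivative d) (at 0)"
    using ext_coords_curveD[OF c z \<gamma>] zx unfolding curve_in_bundle_chart by auto
  have fst_\<eta>: "fst (?\<eta> t) = fst (\<gamma> t)" for t by (simp add: contraction_def case_prod_beta)
  have "\<forall>\<^sub>F t in nhds 0. fst (\<gamma> t) \<in> fst c" using g(3) by (simp add: curve_in_def)
  then have ev: "\<forall>\<^sub>F t in nhds 0. c \<in> charts_at A (fst (\<gamma> t)) \<and> snd (\<gamma> t) \<in> ext_power i (tangent_space A (fst (\<gamma> t)))"
    using g(2) by eventually_elim (simp add: charts_at_def cA)
  let ?F = "\<lambda>t. \<chi> B. if B \<in> J k then \<Sum>C\<in>J i. \<mu>2 c (fst (\<gamma> t)) C B * mvec_coord i c (fst (\<gamma> t)) (snd (\<gamma> t)) $ C else 0"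
  let ?b = "\<chi> B. if B \<in> J k then \<Sum>C\<in>J i. \<mu>2 c x C B * d $ C + d\<mu>2 c x C B h * u $ C else 0"
  have eq: "\<forall>\<^sub>F t in nhds 0. ?F t = form_coord k c (fst (?\<eta> t)) (snd (?\<eta> t))"
    using ev
  proof eventually_elim
    case (elim t)
    then show ?case
      using contraction_coord[OF _ r, of c "fst (\<gamma> t)" "snd (\<gamma> t)"] unfolding fst_\<eta> by simp
  qed
  have "((\<lambda>t. \<mu>2 c (fst (\<gamma> t)) C B * mvec_coord i c (fst (\<gamma> t)) (snd (\<gamma> t)) $ C) has_vector_derivative
      \<mu>2 c x C B * d $ C + d\<mu>2 c x C B h * u $ C) (at 0)" if "C \<in> J i" "B \<in> J k" for C B
    using has_vector_derivative_mult[OF has_cderivD[OF d\<mu>2[OF c that r] g(3)]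
        bounded_linear.has_vector_derivative[OF bounded_linear_vec_nth g(4), of C]]
    unfolding g(1) zx .
  then have "(?F has_vector_derivative ?b) (at 0)"
    by (intro hvd_vec) (auto intro!: has_vector_derivative_sum)
  then have der: "((\<lambda>t. form_coord k c (fst (?\<eta> t)) (snd (?\<eta> t))) has_vector_derivative ?b) (at 0)"
    unfolding hvd_cong[OF eq] .
  have \<eta>0: "?\<eta> 0 = (x, snd (?\<eta> 0))" using fst_\<eta>[of 0] g(1) zx by (metis prod.collapse)
  have "curve_in (coext_chart k c) ?\<eta> (x, snd (?\<eta> 0)) (h, ?b)"
    unfolding curve_in_bundle_chart
  proof (intro conjI)
    show "\<forall>\<^sub>F t in nhds 0. snd (?\<eta> t) \<in> alt_forms k (tangent_space A (fst (?\<eta> t)))"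
      using ev
    proof eventually_elim
      case (elim t)
      then show ?case
        using contraction_in[OF _ r, of c "fst (\<gamma> t)" "snd (\<gamma> t)"] unfolding fst_\<eta> by simp
    qed
    show "curve_in c (\<lambda>t. fst (?\<eta> t)) (fst (x, snd (?\<eta> 0))) (fst (h, ?b))"
      unfolding fst_\<eta> using g(3) by simp
  qed (use \<eta>0 der in simp_all)
  from coext_coords_curveI[OF c this]
  have "coext_coords k c x (form_coord k c x (snd (?\<eta> 0))) h ?b (velocity (coext_atlas A I k) ?\<eta>)" .
  moreover have "form_coord k c x (snd (?\<eta> 0)) = (\<chi> B. if B \<in> J k then \<Sum>C\<in>J i. \<mu>2 c x C B * u $ C else 0)"
    using eventually_nhds_x_imp_x[OF eq] unfolding fst_\<eta> g(1) zx by simp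
  ultimately show ?thesis unfolding T by (simp only:)
qed

text \<open>The value of \<mu> on vectors with components \<open>hor + t ver\<close> is
  differentiated in two ways: expanded over index sets of size \<open>r\<close> it gives
  \<open>lift_coord\<close>, expanded over pairs \<open>(C, B)\<close> through \<open>\<mu>2\<close>
  it gives the right-hand side. Uniqueness of the derivative identifies the results.\<close>

lemma lift_coord_append:
  assumes c: "c \<in> charts_at A x" and q: "q \<in> tangent_space A x" and r: "r = i + k"
    and us: "us \<in> tuples i (TTS (x, q))" and vs: "vs \<in> tuples k (TTS (x, q))"
  shows "lift_coord c x q (us @ vs) = (\<Sum>C\<in>J i. \<Sum>B\<in>J k.
    d\<mu>2 c x C B (q c) * (hform i c (x, q) C us * hform k c (x, q) B vs) +
    \<mu>2 c x C B * (vform i c (x, q) C us * hform k c (x, q) B vs + hform i c (x, q) C us * vform k c (x, q) B vs))"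
proof -
  let ?w = "(x, q)"
  have cA: "c \<in> A" using c by (simp add: charts_at_def)
  have qS: "q c \<in> S" by (rule coords_in_S[OF c q])
  obtain \<gamma> where \<gamma>: "curve_in c \<gamma> x (q c)" using curve_in_line(1)[OF c qS] by blast
  have \<gamma>0: "\<gamma> 0 = x" using \<gamma> by (simp add: curve_in_def)
  define f where "f t v = hor c v + t *\<^sub>R ver c v" for t v
  have fS: "f t v \<in> S" if "v \<in> TTS ?w" for t v
    using hor_ver_in[OF c that] subspace by (simp add: f_def subspace_add subspace_scale)
  have uv: "us @ vs \<in> tuples r (TTS ?w)" using tuples_append[OF us vs] r by simp
  have f_in: "map (f t) us \<in> tuples i S" "map (f t) vs \<in> tuples k S" "map (f t) (us @ vs) \<in> tuples r S" for t
    using tuples_map[OF us fS] tuples_map[OF vs fS] tuples_map[OF uv fS] by auto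
  have "((\<lambda>t. map (f t) (us @ vs) ! j) has_vector_derivative map (ver c) (us @ vs) ! j) (at 0)" if "j < r" for j
  proof -
    have "((\<lambda>t. f t v) has_vector_derivative ver c v) (at 0)" for v
      unfolding f_def by (auto intro!: derivative_eq_intros)
    then show ?thesis using that uv by (simp add: tuples_def del: map_append)
  qed
  from \<mu>_along_curve[OF c \<gamma> _ this] f_in(3)
  have "((\<lambda>t. \<mu> (\<gamma> t) (map (coord_vec A c (\<gamma> t)) (map (f t) (us @ vs)))) has_vector_derivative
    (\<Sum>B\<in>J r. d\<mu> c x B (q c) * dxf B (map (f 0) (us @ vs)) + \<mu> x (frame c x B) *
      (\<Sum>j<r. dxf B ((map (f 0) (us @ vs))[j := map (ver c) (us @ vs) ! j])))) (at 0)"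
    by simp
  moreover have "(\<Sum>j<r. dxf B ((map (f 0) (us @ vs))[j := map (ver c) (us @ vs) ! j])) =
      (\<Sum>j<r. dxf B ((map (hor c) (us @ vs))[j := ver c ((us @ vs) ! j)]))" for B
    by (rule sum.cong) (use uv in \<open>auto simp: f_def[abs_def] tuples_def simp del: map_append\<close>)
  moreover have "map (f 0) (us @ vs) = map (hor c) (us @ vs)" by (simp add: f_def)
  ultimately have 1: "((\<lambda>t. \<mu> (\<gamma> t) (map (coord_vec A c (\<gamma> t)) (map (f t) (us @ vs)))) has_vector_derivative
      lift_coord c x q (us @ vs)) (at 0)"
    by (simp only: lift_coord_def)
  have "\<forall>\<^sub>F t in nhds 0. \<gamma> t \<in> fst c" using \<gamma> by (simp add: curve_in_def)
  then have eq: "\<forall>\<^sub>F t in nhds 0. \<mu> (\<gamma> t) (map (coord_vec A c (\<gamma> t)) (map (f t) (us @ vs))) =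
      (\<Sum>C\<in>J i. \<Sum>B\<in>J k. \<mu>2 c (\<gamma> t) C B * (dxf C (map (f t) us) * dxf B (map (f t) vs)))"
  proof eventually_elim
    case (elim t)
    let ?T = "tangent_space A (\<gamma> t)" and ?v = "coord_vec A c (\<gamma> t)"
    have ct: "c \<in> charts_at A (\<gamma> t)" using elim cA by (simp add: charts_at_def)
    have m: "\<mu> (\<gamma> t) \<in> alt_forms (i + k) ?T" using \<mu>_in_chart[OF ct] r by simp
    have Us: "map ?v (map (f t) us) \<in> tuples i ?T" and Vs: "map ?v (map (f t) vs) \<in> tuples k ?T"
      using tuples_map[OF f_in(1) coord_vec_in[OF ct]] tuples_map[OF f_in(2) coord_vec_in[OF ct]] by auto
    have co: "map (\<lambda>v. v c) (map ?v hs) = hs" if "hs \<in> tuples m S" for hs m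
      using that ct by (auto simp: tuples_def subset_iff intro!: map_idI)
    \<comment> \<open>Expansion in the first \<open>i\<close> arguments with the last
      \<open>k\<close> frozen, then in the last \<open>k\<close> with a frame frozen in
      front.\<close>
    have "\<mu> (\<gamma> t) (map ?v (map (f t) us) @ map ?v (map (f t) vs)) =
        (\<Sum>C\<in>J i. \<mu> (\<gamma> t) (frame c (\<gamma> t) C @ map ?v (map (f t) vs)) * dxf C (map (f t) us))"
      using form_expand[OF ct alt_forms_append(1)[OF m Vs] Us] unfolding co[OF f_in(1)] .
    also have "\<dots> = (\<Sum>C\<in>J i. (\<Sum>B\<in>J k. \<mu>2 c (\<gamma> t) C B * dxf B (map (f t) vs)) * dxf C (map (f t) us))"
    proof (rule sum.cong[OF refl])
      fix C assume C: "C \<in> J i"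
      show "\<mu> (\<gamma> t) (frame c (\<gamma> t) C @ map ?v (map (f t) vs)) * dxf C (map (f t) us) =
        (\<Sum>B\<in>J k. \<mu>2 c (\<gamma> t) C B * dxf B (map (f t) vs)) * dxf C (map (f t) us)"
        using form_expand[OF ct alt_forms_append(2)[OF m frame_in[OF ct C]] Vs] unfolding co[OF f_in(2)] \<mu>2_def by simp
    qed
    also have "\<dots> = (\<Sum>C\<in>J i. \<Sum>B\<in>J k. \<mu>2 c (\<gamma> t) C B * (dxf C (map (f t) us) * dxf B (map (f t) vs)))"
      by (simp add: sum_distrib_left sum_distrib_right ac_simps)
    finally show ?case by simp
  qed
  have df: "((\<lambda>t. dxf C (map (f t) us)) has_vector_derivative vform i c ?w C us) (at 0)" if "C \<in> J i" for C
    using dxf_flow[of us C c] that us by (simp add: f_def[abs_def] vform_def index_sets_def tuplesD(1))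
  have dg: "((\<lambda>t. dxf B (map (f t) vs)) has_vector_derivative vform k c ?w B vs) (at 0)" if "B \<in> J k" for B
    using dxf_flow[of vs B c] that vs by (simp add: f_def[abs_def] vform_def index_sets_def tuplesD(1))
  have f0: "dxf C (map (f 0) us) = hform i c ?w C us" "dxf B (map (f 0) vs) = hform k c ?w B vs" for B C
    using us vs by (simp_all add: f_def[abs_def] hform_def)
  have "((\<lambda>t. \<mu>2 c (\<gamma> t) C B * (dxf C (map (f t) us) * dxf B (map (f t) vs))) has_vector_derivative
    d\<mu>2 c x C B (q c) * (hform i c ?w C us * hform k c ?w B vs) +
    \<mu>2 c x C B * (vform i c ?w C us * hform k c ?w B vs + hform i c ?w C us * vform k c ?w B vs)) (at 0)"
    if "C \<in> J i" "B \<in> J k" for C B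
    using has_vector_derivative_mult[OF has_cderivD[OF d\<mu>2[OF c that r] \<gamma>]
        has_vector_derivative_mult[OF df[OF that(1)] dg[OF that(2)]]]
    unfolding \<gamma>0 f0 by (simp add: ac_simps)
  then have 2: "((\<lambda>t. \<Sum>C\<in>J i. \<Sum>B\<in>J k. \<mu>2 c (\<gamma> t) C B * (dxf C (map (f t) us) * dxf B (map (f t) vs)))
     has_vector_derivative (\<Sum>C\<in>J i. \<Sum>B\<in>J k.
      d\<mu>2 c x C B (q c) * (hform i c ?w C us * hform k c ?w B vs) +
      \<mu>2 c x C B * (vform i c ?w C us * hform k c ?w B vs + hform i c ?w C us * vform k c ?w B vs))) (at 0)"
    by (intro has_vector_derivative_sum)
  show ?thesis by (rule vector_derivative_unique_at[OF 1 2[folded hvd_cong[OF eq]]])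
qed

text \<open>Both sides turn out to be the form with coefficients \<open>b\<close> on
  \<open>hform\<close> and \<open>a\<close> on \<open>vform\<close>, where \<open>a\<close> and
  \<open>b\<close> are position and velocity of the vector to which \<open>kappa_dual\<close> is
  applied. The tangent pairing crosses them likewise: the position of one factor meets the velocity
  of the other.\<close>

lemma contraction_d_T:
  assumes r: "r = i + k" and q: "q \<in> tangent_space A x" and U: "U \<in> ext_power i (TTS (x, q))"
  shows "contraction (tangent_atlas A) r i (d_T A r \<mu>) ((x, q), U) =
    kappa_dual A I k (tangent_map (ext_atlas A I i) (coext_atlas A I k) (contraction A r i \<mu>)
      (kappa_pow A I i ((x, q), U)))"
proof -
  let ?w = "(x, q)" and ?V = "TTS (x, q)"
  obtain c where c: "c \<in> charts_at A x"
    and dT: "\<And>vs. d_T A r \<mu> ?w vs = (if vs \<in> tuples r ?V then lift_coord c x q vs else 0)"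
    using d_T_eq[OF q] by blast
  let ?\<omega> = "d_T A r \<mu> ?w"
  have V: "subspace ?V" by (rule subspace_TTS[OF c q])
  note h_in = hform_in[OF c q] and v_in = vform_in[OF c q]
  \<comment> \<open>Alternation is read off from the expansion of the lift in \<open>hform\<close>
    and \<open>vform\<close>.\<close>
  have \<omega>: "?\<omega> \<in> alt_forms (i + k) ?V"
  proof -
    have "?\<omega> = (\<lambda>vs. 1 * (\<Sum>B\<in>J r. d\<mu> c x B (q c) * hform r c ?w B vs) +
        1 * (\<Sum>B\<in>J r. \<mu> x (frame c x B) * vform r c ?w B vs))"
      by (auto simp: fun_eq_iff dT lift_coord_def hform_def vform_def sum.distrib)
    also have "\<dots> \<in> alt_forms r ?V"
      by (rule alt_forms_lin2[OF alt_forms_sum[OF h_in] alt_forms_sum[OF v_in]])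
    finally show ?thesis using r by simp
  qed
  let ?\<alpha> = "\<lambda>vs. if vs \<in> tuples k ?V then U (\<lambda>us. ?\<omega> (us @ vs)) else 0"
  have \<alpha>_in: "?\<alpha> \<in> alt_forms k ?V" by (rule contracted_form_in[OF \<omega> V U])
  have lhs: "contraction (tangent_atlas A) r i (d_T A r \<mu>) (?w, U) = (?w, ?\<alpha>)"
    using wedge_prod_wedge[OF \<omega>] by (auto simp: contraction_def r fun_eq_iff)
  define a where "a = (\<chi> B. if B \<in> J k then \<Sum>C\<in>J i. \<mu>2 c x C B * hcoord i c ?w U $ C else 0)"
  define b where "b = (\<chi> B. if B \<in> J k then \<Sum>C\<in>J i. \<mu>2 c x C B * vcoord i c ?w U $ C +
      d\<mu>2 c x C B (q c) * hcoord i c ?w U $ C else 0)"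
  let ?z = "tangent_map (ext_atlas A I i) (coext_atlas A I k) (contraction A r i \<mu>) (kappa_pow A I i (?w, U))"
  have z: "coext_coords k c x a (q c) b ?z"
    unfolding a_def b_def by (rule tangent_contraction_coords[OF c r kappa_pow_coords[OF c q U]])
  \<comment> \<open>\<open>U\<close> is moved inside the sums over \<open>C\<close>, where it meets
    \<open>hform\<close> and \<open>vform\<close> and becomes \<open>hcoord\<close> and
    \<open>vcoord\<close>; the remaining sum over \<open>B\<close> has the coefficients
    \<open>a\<close> and \<open>b\<close>.\<close>
  have \<alpha>_eq: "?\<alpha> = (\<lambda>vs. 1 * (\<Sum>B\<in>J k. b $ B * hform k c ?w B vs) + 1 * (\<Sum>B\<in>J k. a $ B * vform k c ?w B vs))"
  proof
    fix vs
    show "?\<alpha> vs = 1 * (\<Sum>B\<in>J k. b $ B * hform k c ?w B vs) + 1 * (\<Sum>B\<in>J k. a $ B * vform k c ?w B vs)"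
    proof (cases "vs \<in> tuples k ?V")
      case True
      let ?s = "\<lambda>C. \<Sum>B\<in>J k. d\<mu>2 c x C B (q c) * hform k c ?w B vs + \<mu>2 c x C B * vform k c ?w B vs"
      let ?t = "\<lambda>C. \<Sum>B\<in>J k. \<mu>2 c x C B * hform k c ?w B vs"
      have "(\<lambda>us. ?\<omega> (us @ vs)) = (\<lambda>us. 1 * (\<Sum>C\<in>J i. ?s C * hform i c ?w C us) + 1 * (\<Sum>C\<in>J i. ?t C * vform i c ?w C us))"
      proof
        fix us
        show "?\<omega> (us @ vs) = 1 * (\<Sum>C\<in>J i. ?s C * hform i c ?w C us) + 1 * (\<Sum>C\<in>J i. ?t C * vform i c ?w C us)"
        proof (cases "us \<in> tuples i ?V")
          case us: True
          have "us @ vs \<in> tuples r ?V" using tuples_append[OF us True] r by simp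
          then show ?thesis
            by (simp add: dT lift_coord_append[OF c q r us True] sum.distrib sum_distrib_left sum_distrib_right algebra_simps)
        next
          case False
          then show ?thesis
            using alt_form_append_outside[OF \<omega> True] by (simp add: hform_def vform_def)
        qed
      qed
      then have "?\<alpha> vs = U (\<lambda>us. 1 * (\<Sum>C\<in>J i. ?s C * hform i c ?w C us) + 1 * (\<Sum>C\<in>J i. ?t C * vform i c ?w C us))"
        using True by simp
      also have "\<dots> = 1 * U (\<lambda>us. \<Sum>C\<in>J i. ?s C * hform i c ?w C us) + 1 * U (\<lambda>us. \<Sum>C\<in>J i. ?t C * vform i c ?w C us)"
        by (rule ext_power_lin2[OF U alt_forms_sum[OF h_in] alt_forms_sum[OF v_in]])
      also have "\<dots> = (\<Sum>C\<in>J i. ?s C * U (hform i c ?w C)) + (\<Sum>C\<in>J i. ?t C * U (vform i c ?w C))"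
        by (simp only: ext_power_linear[OF U h_in] ext_power_linear[OF U v_in] mult_1)
      also have "\<dots> = (\<Sum>C\<in>J i. \<Sum>B\<in>J k. (\<mu>2 c x C B * U (vform i c ?w C) + d\<mu>2 c x C B (q c) * U (hform i c ?w C)) * hform k c ?w B vs
          + \<mu>2 c x C B * U (hform i c ?w C) * vform k c ?w B vs)"
        by (simp add: sum.distrib sum_distrib_left sum_distrib_right algebra_simps)
      also have "\<dots> = (\<Sum>B\<in>J k. \<Sum>C\<in>J i. (\<mu>2 c x C B * U (vform i c ?w C) + d\<mu>2 c x C B (q c) * U (hform i c ?w C)) * hform k c ?w B vs
          + \<mu>2 c x C B * U (hform i c ?w C) * vform k c ?w B vs)"
        by (rule sum.swap)
      also have "\<dots> = (\<Sum>B\<in>J k. b $ B * hform k c ?w B vs + a $ B * vform k c ?w B vs)"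
        by (rule sum.cong) (simp_all add: a_def b_def hcoord_def vcoord_def sum.distrib sum_distrib_right distrib_right)
      finally show ?thesis by (simp add: sum.distrib)
    qed (simp add: hform_def vform_def)
  qed
  have pairing: "tangent_pairing A I k (kappa_pow A I k (?w, U')) ?z = U' ?\<alpha>" if U': "U' \<in> ext_power k ?V" for U'
  proof -
    have "U' ?\<alpha> = 1 * U' (\<lambda>vs. \<Sum>B\<in>J k. b $ B * hform k c ?w B vs) + 1 * U' (\<lambda>vs. \<Sum>B\<in>J k. a $ B * vform k c ?w B vs)"
      unfolding \<alpha>_eq by (rule ext_power_lin2[OF U' alt_forms_sum[OF h_in] alt_forms_sum[OF v_in]])
    also have "\<dots> = (\<Sum>B\<in>J k. b $ B * U' (hform k c ?w B)) + (\<Sum>B\<in>J k. a $ B * U' (vform k c ?w B))"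
      by (simp only: ext_power_linear[OF U' h_in] ext_power_linear[OF U' v_in] mult_1)
    finally show ?thesis
      unfolding tangent_pairing_coords[OF c kappa_pow_coords[OF c q U'] z]
      by (simp add: hcoord_def vcoord_def sum.distrib[symmetric] ac_simps)
  qed
  \<comment> \<open>Uniqueness: decomposable multivectors evaluate a form on tuples, and off tuples
    all forms vanish.\<close>
  have "(THE \<alpha>. \<alpha> \<in> alt_forms k ?V \<and> (\<forall>U\<in>ext_power k ?V. tangent_pairing A I k (kappa_pow A I k (?w, U)) ?z = U \<alpha>)) = ?\<alpha>"
  proof (rule the_equality)
    show "?\<alpha> \<in> alt_forms k ?V \<and> (\<forall>U\<in>ext_power k ?V. tangent_pairing A I k (kappa_pow A I k (?w, U)) ?z = U ?\<alpha>)"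
      using \<alpha>_in pairing by blast
    fix \<beta> assume \<beta>: "\<beta> \<in> alt_forms k ?V \<and> (\<forall>U\<in>ext_power k ?V. tangent_pairing A I k (kappa_pow A I k (?w, U)) ?z = U \<beta>)"
    show "\<beta> = ?\<alpha>"
    proof
      fix vs
      show "\<beta> vs = ?\<alpha> vs"
      proof (cases "vs \<in> tuples k ?V")
        case True
        have W: "wedge k ?V vs \<in> ext_power k ?V" by (rule wedge_in_ext_power[OF True])
        have "wedge k ?V vs \<beta> = wedge k ?V vs ?\<alpha>" using \<beta> W pairing[OF W] by simp
        then show ?thesis using \<beta> \<alpha>_in by (simp add: wedge_def)
      qed (use \<beta> alt_form_outside in auto)
    qed
  qed
  \<comment> \<open>The base point that \<open>kappa_dual\<close> extracts from its argument; it is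
    \<open>(x, q)\<close> again because the base velocity of that vector is
    \<open>q c\<close>.\<close>
  moreover have "tangent_map (coext_atlas A I k) A fst ?z = ?w"
    using coext_coords_base[OF c z] c q by simp
  ultimately show ?thesis unfolding lhs kappa_dual_def Let_def by simp
qed

end

theorem theorem2p1:
  fixes X :: "'a topology"
    and I :: "'n::{finite,linorder} set"
    and A :: "('a, 'n) natlas"
    and \<mu> :: "'a \<Rightarrow> ('a, 'n) nfib form"
    and r i :: nat
  assumes "smooth_manifold X (coord_space I) A"
    and "diff_form (coord_space I) A r \<mu>"
    and "i \<le> r"
  shows "\<forall>z\<in>ext_bundle (tangent_atlas A) i.
    contraction (tangent_atlas A) r i (d_T A r \<mu>) z =
      (kappa_dual A I (r - i)
        \<circ> tangent_map (ext_atlas A I i) (coext_atlas A I (r - i)) (contraction A r i \<mu>)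
        \<circ> kappa_pow A I i) z"
proof
  interpret manifold_form X I A \<mu> r
    by unfold_locales (use assms in auto)
  fix z assume "z \<in> ext_bundle (tangent_atlas A) i"
  then obtain x q U where z: "z = ((x, q), U)" and p: "(x, q) \<in> points (tangent_atlas A)"
    and U: "U \<in> ext_power i (tangent_space (tangent_atlas A) (x, q))"
    by (auto simp: ext_bundle_def)
  have q: "q \<in> tangent_space A x"
    using p by (auto simp: points_def tangent_atlas_def tangent_chart_def tangent_bundle_iff)
  show "contraction (tangent_atlas A) r i (d_T A r \<mu>) z =
      (kappa_dual A I (r - i)
        \<circ> tangent_map (ext_atlas A I i) (coext_atlas A I (r - i)) (contraction A r i \<mu>)
        \<circ> kappa_pow A I i) z"
    using contraction_d_T[OF _ q U, of "r - i"] assms(3) by (simp add: z)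
qed

end
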